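(* Let $n \geq 3$ and $p \geq 4$, and let $H = \mathrm{SL}_p(\mathbb{C}) \times \mathrm{SL}_p(\mathbb{C})$ act on $\mathcal{M}_p^n$ by $(h_1,h_2)\cdot(A_1,\dots,A_n) = (h_1A_1h_2^{-1},\dots,h_1A_nh_2^{-1})$. Then the algebra of matrix semi-invariants $\mathbb{C}[\mathcal{M}_p^n]^H$ contains neither a polynomial separating set nor a hypersurface separating set.
   Context: $\mathcal{M}_p$ is the space of complex $p\times p$ matrices and $\mathcal{V}=\mathcal{M}_p^n$. A subset $S \subseteq \mathbb{C}[\mathcal{V}]^H$ is a separating set if for all $v,w\in\mathcal{V}$: $s(v)=s(w)$ for all $s\in S$ iff $f(v)=f(w)$ for all $f\in\mathbb{C}[\mathcal{V}]^H$. A polynomial separating set is a separating set of cardinality $\dim(\mathbb{C}[\mathcal{V}]^H)$ (Krull dimension), and a hypersurface separating set is a separating set of cardinality $\dim(\mathbb{C}[\mathcal{V}]^H)+1$. *)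

theory Defs
  imports "HOL-Analysis.Analysis" "HOL-Algebra.Ideal" "HOL-Library.Extended_Nat"
begin

text \<open>
  The space of \<open>n\<close>-tuples of complex \<open>p \<times> p\<close> matrices is rendered as \<open>complex^'p^'p^'n\<close>, with
  \<open>p = CARD('p)\<close> and \<open>n = CARD('n)\<close>.
\<close>

definition special_linear :: "(complex^'p^'p) set" where
  "special_linear = {h. det h = 1}"

definition left_right_action ::
    "(complex^'p^'p) \<times> (complex^'p^'p) \<Rightarrow> complex^'p^'p^'n \<Rightarrow> complex^'p^'p^'n" where
  "left_right_action h A = (\<chi> k. fst h ** (A $ k) ** matrix_inv (snd h))"

text \<open>
  The coordinate ring: since the complex field is infinite, polynomials in the matrix entries are
  identified with the functions they induce, i.e. with the algebra of functions generated by the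
  coordinate functions.
\<close>

inductive_set polynomial_functions :: "(complex^'p^'p^'n \<Rightarrow> complex) set" where
  const: "(\<lambda>_. c) \<in> polynomial_functions"
| coord: "(\<lambda>A. A $ k $ i $ j) \<in> polynomial_functions"
| add: "f \<in> polynomial_functions \<Longrightarrow> g \<in> polynomial_functions \<Longrightarrow>
    (\<lambda>A. f A + g A) \<in> polynomial_functions"
| mult: "f \<in> polynomial_functions \<Longrightarrow> g \<in> polynomial_functions \<Longrightarrow>
    (\<lambda>A. f A * g A) \<in> polynomial_functions"

definition matrix_semi_invariants :: "(complex^'p^'p^'n \<Rightarrow> complex) ring" where
  "matrix_semi_invariants =
    \<lparr>carrier = {f \<in> polynomial_functions.
        \<forall>h \<in> special_linear \<times> special_linear. \<forall>A. f (left_right_action h A) = f A},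
     mult = (\<lambda>f g A. f A * g A),
     one = (\<lambda>_. 1),
     zero = (\<lambda>_. 0),
     add = (\<lambda>f g A. f A + g A)\<rparr>"

lemma cring_matrix_semi_invariants:
  "cring (matrix_semi_invariants :: (complex^'p^'p^'n \<Rightarrow> complex) ring)"
proof (rule cringI)
  let ?R = "matrix_semi_invariants :: (complex^'p^'p^'n \<Rightarrow> complex) ring"
  show "abelian_group ?R"
  proof (rule abelian_groupI)
    fix f assume f: "f \<in> carrier ?R"
    have "(\<lambda>A. (- 1) * f A) \<in> polynomial_functions"
      using f by (intro polynomial_functions.mult polynomial_functions.const)
        (simp add: matrix_semi_invariants_def)
    then show "\<exists>g \<in> carrier ?R. g \<oplus>\<^bsub>?R\<^esub> f = \<zero>\<^bsub>?R\<^esub>"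
      using f by (intro bexI[of _ "\<lambda>A. - f A"]) (simp_all add: matrix_semi_invariants_def)
  qed (auto simp: matrix_semi_invariants_def algebra_simps
         intro: polynomial_functions.intros)
  show "Group.comm_monoid ?R"
    by (rule comm_monoidI)
      (auto simp: matrix_semi_invariants_def algebra_simps intro: polynomial_functions.intros)
qed (auto simp: matrix_semi_invariants_def algebra_simps)

text \<open>
  The supremum of the lengths \<open>m\<close> of chains \<open>P 0 \<subset> \<dots> \<subset> P m\<close> of prime ideals. The zero ring, which
  has no prime ideals, gets dimension \<open>0\<close>.
\<close>

definition krull_dim :: "('a, 'b) ring_scheme \<Rightarrow> enat" where
  "krull_dim R = Sup {enat m |m. \<exists>P. (\<forall>i\<le>m. primeideal (P i) R) \<and> (\<forall>i<m. P i \<subset> P (Suc i))}"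

definition separating_set :: "('v \<Rightarrow> complex, 'b) ring_scheme \<Rightarrow> ('v \<Rightarrow> complex) set \<Rightarrow> bool" where
  "separating_set R S \<longleftrightarrow> S \<subseteq> carrier R \<and>
    (\<forall>v w. (\<forall>s \<in> S. s v = s w) \<longleftrightarrow> (\<forall>f \<in> carrier R. f v = f w))"

definition polynomial_separating_set ::
    "('v \<Rightarrow> complex, 'b) ring_scheme \<Rightarrow> ('v \<Rightarrow> complex) set \<Rightarrow> bool" where
  "polynomial_separating_set R S \<longleftrightarrow>
    separating_set R S \<and> finite S \<and> enat (card S) = krull_dim R"

definition hypersurface_separating_set ::
    "('v \<Rightarrow> complex, 'b) ring_scheme \<Rightarrow> ('v \<Rightarrow> complex) set \<Rightarrow> bool" where
  "hypersurface_separating_set R S \<longleftrightarrow>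
    separating_set R S \<and> finite S \<and> enat (card S) = krull_dim R + 1"

end

theory Submission
  imports Defs "HOL-Library.Function_Algebras" "HOL-Computational_Algebra.Fundamental_Theorem_Algebra"
begin

text \<open>
  At a semisimple point with a one-dimensional torus as stabiliser the quotient looks locally like
  an affine space times a cone of matrices \<open>x \<otimes> y\<close>. Two explicit families of tuples map to subvarieties
  of the quotient that meet locally in a single point: a smooth one, in which \<open>x\<close> is a fixed vector,
  and one in which \<open>x\<close> varies in a complementary plane (here \<open>p \<ge> 4\<close> enters). Their dimensions add up
  to two more than the dimension of the quotient. A separating set of size \<open>s\<close> maps the quotient
  injectively to affine \<open>s\<close>-space, where varieties of dimensions \<open>a\<close> and \<open>b\<close> with an isolated common
  point satisfy \<open>a + b \<le> s\<close>. Conversely, restricting invariants to a slice bounds the Krull dimension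
  from above by the dimension of the slice.
\<close>

section \<open>Linear combinations of functions and monomials\<close>

text \<open>The inequality a + b \<le> s is proved by reduction to the diagonal: on the product of
  the two families the functions \<open>s (ptA u) - s (ptB u)\<close> have an isolated common zero,
  and there must be at least as many of them as the dimension. This product has as its ring the
  torus invariants in variables W, X, Y of weights 0, 1, -1. It is singular of dimension |W| + |X| +
  |Y| - 1, so the dimension enters through the growth of the number of invariant monomials. The zero
  is isolated only near the origin; a function \<open>e\<close> with value 1 there marks the
  neighbourhood and takes the place of a localisation. The numbers: x and y have q = (n - 2)(p - 1)
  entries each, so the cone of all x \<otimes> y has dimension 2q - 1. A fixed x with arbitrary y
  gives q, and x in a plane with arbitrary y gives q + 1, together two more than the cone. Fixed
  vector and plane occupy three places in one row of one matrix, off the diagonal; with the index of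
  that row this makes four indices. That the families meet only at the origin is read off from
  closed walks through matrix entries: a walk enters the torus index by an entry of y and leaves it
  by an entry of x, so it sees products only.\<close>

interpretation fun_space: vector_space "\<lambda>(c::complex) f x. c * f x"
  by standard (auto simp: fun_eq_iff algebra_simps)

abbreviation lin :: "('x \<Rightarrow> complex) set \<Rightarrow> ('x \<Rightarrow> complex) set" where
  "lin \<equiv> fun_space.span"

lemma lin_add: "f \<in> lin B \<Longrightarrow> g \<in> lin B \<Longrightarrow> (\<lambda>x. f x + g x) \<in> lin B"
  using fun_space.span_add[of f B g] by (simp add: plus_fun_def)

lemma lin_scale: "f \<in> lin B \<Longrightarrow> (\<lambda>x. c * f x) \<in> lin B"
  by (rule fun_space.span_scale)

lemma lin_zero: "(\<lambda>x. 0) \<in> lin B"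
  using fun_space.span_zero[of B] by (simp add: zero_fun_def)

lemma lin_diff: "f \<in> lin B \<Longrightarrow> g \<in> lin B \<Longrightarrow> (\<lambda>x. f x - g x) \<in> lin B"
  using lin_add[of f B, OF _ lin_scale[of g B "-1"]] by simp

lemma lin_sum:
  assumes "\<And>i. i \<in> I \<Longrightarrow> f i \<in> lin B"
  shows "(\<lambda>x. \<Sum>i\<in>I. f i x) \<in> lin B"
  using assms by (induction I rule: infinite_finite_induct) (auto intro: lin_add lin_zero)

lemma lin_induct [consumes 1, case_names zero step]:
  assumes "f \<in> lin B" "P (\<lambda>x. 0)"
    and "\<And>c b g. b \<in> B \<Longrightarrow> g \<in> lin B \<Longrightarrow> P g \<Longrightarrow> P (\<lambda>x. c * b x + g x)"
  shows "P f"
proof -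
  have "f \<in> lin B \<and> P f"
    using assms(1)
  proof (induction rule: fun_space.span_induct_alt)
    case base
    then show ?case using assms(2) fun_space.span_zero[of B] by (simp add: zero_fun_def)
  next
    case (step c x y)
    then show ?case
      using assms(3)[of x y c] lin_add[OF lin_scale[OF fun_space.span_base[of x B]], of y c]
      by (auto simp: plus_fun_def)
  qed
  then show ?thesis ..
qed

lemma lin_mult:
  assumes "f \<in> lin A" "g \<in> lin B"
    and AB: "\<And>a b. a \<in> A \<Longrightarrow> b \<in> B \<Longrightarrow> (\<lambda>x. a x * b x) \<in> lin C"
  shows "(\<lambda>x. f x * g x) \<in> lin C"
  using assms(1)
proof (induction rule: lin_induct)
  case zero
  then show ?case by (simp add: lin_zero)
next
  case (step c a f)
  have "(\<lambda>x. a x * g x) \<in> lin C"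
    using assms(2)
  proof (induction rule: lin_induct)
    case zero
    then show ?case by (simp add: lin_zero)
  next
    case (step d b g)
    then show ?case
      using lin_add[OF lin_scale[OF AB[OF \<open>a \<in> A\<close> step(1)]] step(3), of d]
      by (simp add: algebra_simps)
  qed
  from lin_add[OF lin_scale[OF this] step(3), of c] show ?case
    by (simp add: algebra_simps)
qed

lemma lin_image_explicit:
  assumes "f \<in> lin (m ` A)"
  obtains F c where "finite F" "F \<subseteq> A" "f = (\<lambda>x. \<Sum>a\<in>F. c a * m a x)"
proof -
  from assms obtain T r where T: "finite T" "T \<subseteq> m ` A" "f = (\<Sum>b\<in>T. (\<lambda>x. r b * b x))"
    unfolding fun_space.span_explicit by blast
  from T(1,2) obtain F where F: "F \<subseteq> A" "finite F" "T = m ` F" "inj_on m F"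
    unfolding subset_image_inj using finite_image_iff by blast
  have "(\<Sum>b\<in>T. (\<lambda>x. r b * b x)) = (\<lambda>x. \<Sum>b\<in>T. r b * b x)"
    using T(1) by (induction T) (auto simp: plus_fun_def zero_fun_def)
  also have "\<dots> = (\<lambda>x. \<Sum>a\<in>F. r (m a) * m a x)"
    unfolding F(3) by (simp add: sum.reindex[OF F(4)])
  finally have "f = (\<lambda>x. \<Sum>a\<in>F. r (m a) * m a x)"
    using T(3) by (rule trans[rotated])
  then show thesis by (rule that[OF F(2,1)])
qed

text \<open>Gaussian elimination: if the new equation \<open>b\<close> involves some unknown
  \<open>a0\<close>, that unknown is eliminated from the other equations and recovered at the end as
  \<open>- s\<close>.\<close>

lemma homogeneous_system_nontrivial:
  fixes m :: "'a \<Rightarrow> 'b \<Rightarrow> complex"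
  assumes "finite B" "finite A" "card B < card A"
  shows "\<exists>c. (\<exists>a\<in>A. c a \<noteq> 0) \<and> (\<forall>b\<in>B. (\<Sum>a\<in>A. c a * m a b) = 0)"
  using assms
proof (induction B arbitrary: A m rule: finite_induct)
  case empty
  then have "A \<noteq> {}" by auto
  then show ?case by (intro exI[of _ "\<lambda>_. 1"]) auto
next
  case (insert b B)
  show ?case
  proof (cases "\<forall>a\<in>A. m a b = 0")
    case True
    from insert.IH[of A m] insert.prems insert.hyps obtain c
      where "\<exists>a\<in>A. c a \<noteq> 0" "\<forall>b\<in>B. (\<Sum>a\<in>A. c a * m a b) = 0" by auto
    with True show ?thesis by (intro exI[of _ c]) auto
  next
    case False
    then obtain a0 where a0: "a0 \<in> A" "m a0 b \<noteq> 0" by auto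
    let ?A = "A - {a0}"
    let ?m = "\<lambda>a d. m a d - m a b / m a0 b * m a0 d"
    have "finite ?A" "card B < card ?A" using insert a0 by auto
    from insert.IH[OF this, of ?m] obtain c where
      c: "\<exists>a\<in>?A. c a \<noteq> 0" "\<And>d. d \<in> B \<Longrightarrow> (\<Sum>a\<in>?A. c a * ?m a d) = 0" by blast
    define s where "s = (\<Sum>a\<in>?A. c a * (m a b / m a0 b))"
    define c' where "c' = c(a0 := - s)"
    have sum_c': "(\<Sum>a\<in>A. c' a * m a d) = (\<Sum>a\<in>?A. c a * ?m a d)" for d
    proof -
      have "(\<Sum>a\<in>A. c' a * m a d) = - s * m a0 d + (\<Sum>a\<in>?A. c' a * m a d)"
        using a0 insert.prems by (simp add: sum.remove c'_def)
      also have "(\<Sum>a\<in>?A. c' a * m a d) = (\<Sum>a\<in>?A. c a * m a d)"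
        by (rule sum.cong) (auto simp: c'_def)
      also have "- s * m a0 d + \<dots> = (\<Sum>a\<in>?A. c a * ?m a d)"
        by (simp add: s_def sum_distrib_right right_diff_distrib sum_subtractf mult.assoc)
      finally show ?thesis .
    qed
    have "(\<Sum>a\<in>A. c' a * m a b) = 0"
      unfolding sum_c' using a0 by simp
    moreover have "(\<Sum>a\<in>A. c' a * m a d) = 0" if "d \<in> B" for d
      unfolding sum_c' using that by (rule c(2))
    ultimately have "\<forall>d\<in>insert b B. (\<Sum>a\<in>A. c' a * m a d) = 0" by blast
    moreover have "\<exists>a\<in>A. c' a \<noteq> 0" using c(1) by (auto simp: c'_def)
    ultimately show ?thesis by blast
  qed
qed

lemma lin_dependent:
  assumes "finite B" "finite A" "card B < card A" and f: "\<And>a. a \<in> A \<Longrightarrow> f a \<in> lin B"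
  obtains c where "\<exists>a\<in>A. c a \<noteq> 0" "\<And>x. (\<Sum>a\<in>A. c a * f a x) = 0"
proof -
  have "\<exists>m. f a = (\<lambda>x. \<Sum>b\<in>B. m b * b x)" if a: "a \<in> A" for a
  proof -
    from f[OF a] obtain F c where F: "finite F" "F \<subseteq> B" "f a = (\<lambda>x. \<Sum>b\<in>F. c b * b x)"
      using lin_image_explicit[of "f a" "\<lambda>b. b" B] by auto
    have "f a = (\<lambda>x. \<Sum>b\<in>B. (if b \<in> F then c b else 0) * b x)"
      unfolding F(3) using F(1,2) assms(1)
      by (intro ext sum.mono_neutral_cong_left) auto
    then show ?thesis by (intro exI[of _ "\<lambda>b. if b \<in> F then c b else 0"])
  qed
  then have "\<forall>a\<in>A. \<exists>m. f a = (\<lambda>x. \<Sum>b\<in>B. m b * b x)" by blast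
  from bchoice[OF this] obtain m where m: "\<And>a. a \<in> A \<Longrightarrow> f a = (\<lambda>x. \<Sum>b\<in>B. m a b * b x)"
    by blast
  from homogeneous_system_nontrivial[OF assms(1-3), of m] obtain c where
    c: "\<exists>a\<in>A. c a \<noteq> 0" "\<forall>b\<in>B. (\<Sum>a\<in>A. c a * m a b) = 0" by blast
  have "(\<Sum>a\<in>A. c a * f a x) = 0" for x
  proof -
    have "(\<Sum>a\<in>A. c a * f a x) = (\<Sum>a\<in>A. \<Sum>b\<in>B. c a * m a b * b x)"
      by (rule sum.cong) (auto simp: m sum_distrib_left mult.assoc)
    also have "\<dots> = (\<Sum>b\<in>B. (\<Sum>a\<in>A. c a * m a b) * b x)"
      by (subst sum.swap) (simp add: sum_distrib_right)
    finally show ?thesis using c(2) by simp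
  qed
  with c(1) that show thesis by blast
qed

text \<open>Ideals as plain sets of functions under pointwise operations, so that the torus
  invariants and the semi-invariants are treated alike without a ring record.\<close>

definition fun_ideal :: "('x \<Rightarrow> complex) set \<Rightarrow> ('x \<Rightarrow> complex) set \<Rightarrow> bool" where
  "fun_ideal R J \<longleftrightarrow> J \<subseteq> R \<and> (\<lambda>x. 0) \<in> J \<and> (\<forall>f\<in>J. \<forall>g\<in>J. (\<lambda>x. f x + g x) \<in> J) \<and>
     (\<forall>f\<in>R. \<forall>g\<in>J. (\<lambda>x. f x * g x) \<in> J)"

definition fun_prime :: "('x \<Rightarrow> complex) set \<Rightarrow> ('x \<Rightarrow> complex) set \<Rightarrow> bool" where
  "fun_prime R P \<longleftrightarrow> fun_ideal R P \<and> (\<lambda>x. 1) \<notin> P \<and>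
     (\<forall>f\<in>R. \<forall>g\<in>R. (\<lambda>x. f x * g x) \<in> P \<longrightarrow> f \<in> P \<or> g \<in> P)"

lemma fun_ideal_sum:
  assumes "fun_ideal R J" "\<And>i. i \<in> I \<Longrightarrow> f i \<in> J"
  shows "(\<lambda>x. \<Sum>i\<in>I. f i x) \<in> J"
  using assms(2)
  by (induction I rule: infinite_finite_induct) (use assms(1) in \<open>auto simp: fun_ideal_def\<close>)

section \<open>Monomials in finitely many variables and their linear independence\<close>

definition monomial :: "('i::finite \<Rightarrow> nat) \<Rightarrow> ('i \<Rightarrow> complex) \<Rightarrow> complex" where
  "monomial \<alpha> u = (\<Prod>i\<in>UNIV. u i ^ \<alpha> i)"

lemma monomial_plus: "monomial (\<lambda>i. \<alpha> i + \<beta> i) u = monomial \<alpha> u * monomial \<beta> u"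
  by (simp add: monomial_def power_add prod.distrib)

lemma monomial_zero: "monomial (\<lambda>_. 0) u = 1"
  by (simp add: monomial_def)

lemma monomial_mult: "monomial (\<lambda>i. M * \<alpha> i) u = monomial \<alpha> u ^ M"
  by (simp add: monomial_def prod_power_distrib power_mult[symmetric] mult.commute)

lemma monomial_single: "monomial (\<lambda>j. if j = i then 1 else 0) u = u i"
proof -
  have "a ^ (if b then 1 else 0) = (if b then a else 1)" for a :: complex and b by simp
  then show ?thesis by (simp add: monomial_def)
qed

lemma monomial_pair:
  assumes "x \<noteq> y"
  shows "monomial (\<lambda>j. if j = x \<or> j = y then 1 else 0) u = u x * u y"
proof -
  have "(\<lambda>j. if j = x \<or> j = y then 1 else 0 :: nat) =
      (\<lambda>j. (if j = x then 1 else 0) + (if j = y then 1 else 0))"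
    using assms by auto
  then show ?thesis by (simp only: monomial_plus monomial_single)
qed

lemma polynomial_fun_coeff_zero:
  fixes g :: "nat \<Rightarrow> complex"
  assumes "finite N" "\<And>t. (\<Sum>n\<in>N. g n * t ^ n) = 0" "n \<in> N"
  shows "g n = 0"
proof -
  define c where "c k = (if k \<in> N then g k else 0)" for k
  have "(\<Sum>i\<le>Max N. c i * t ^ i) = 0" for t
  proof -
    have "(\<Sum>i\<le>Max N. c i * t ^ i) = (\<Sum>n\<in>N. g n * t ^ n)"
      using assms(1) by (intro sum.mono_neutral_cong_right) (auto simp: c_def)
    then show ?thesis using assms(2) by simp
  qed
  then have "\<forall>i\<le>Max N. c i = 0" using polyfun_eq_0 by blast
  then show ?thesis using assms(1,3) by (auto simp: c_def split: if_splits)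
qed

text \<open>Induction on the variables: exponents are grouped by the power of the variable
  \<open>j\<close>, and each group is a coefficient of an identically vanishing polynomial in
  \<open>t\<close>. The hypothesis that members of \<open>F\<close> are told apart by their values
  on \<open>I\<close> survives the passage to one group, where the value at \<open>j\<close> is
  constant.\<close>

lemma restricted_monomials_independent:
  fixes c :: "('i \<Rightarrow> nat) \<Rightarrow> complex"
  assumes "finite I" "finite F"
    and "\<And>\<alpha> \<beta>. \<alpha> \<in> F \<Longrightarrow> \<beta> \<in> F \<Longrightarrow> (\<And>i. i \<in> I \<Longrightarrow> \<alpha> i = \<beta> i) \<Longrightarrow> \<alpha> = \<beta>"
    and "\<And>u. (\<Sum>\<alpha>\<in>F. c \<alpha> * (\<Prod>i\<in>I. u i ^ \<alpha> i)) = 0" "\<alpha> \<in> F"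
  shows "c \<alpha> = 0"
  using assms
proof (induction I arbitrary: F \<alpha> rule: finite_induct)
  case empty
  then have "F = {\<alpha>}" by auto
  with empty(3)[of undefined] show ?case by simp
next
  case (insert j I)
  define G where "G n = {\<beta> \<in> F. \<beta> j = n}" for n
  have "(\<Sum>\<beta>\<in>G n. c \<beta> * (\<Prod>i\<in>I. u i ^ \<beta> i)) = 0" if n: "n \<in> (\<lambda>\<beta>. \<beta> j) ` F" for n u
  proof (rule polynomial_fun_coeff_zero[where N = "(\<lambda>\<beta>. \<beta> j) ` F"
        and g = "\<lambda>n. \<Sum>\<beta>\<in>G n. c \<beta> * (\<Prod>i\<in>I. u i ^ \<beta> i)"])
    fix t :: complex
    have "(\<Sum>n\<in>(\<lambda>\<beta>. \<beta> j) ` F. (\<Sum>\<beta>\<in>G n. c \<beta> * (\<Prod>i\<in>I. u i ^ \<beta> i)) * t ^ n)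
        = (\<Sum>n\<in>(\<lambda>\<beta>. \<beta> j) ` F. \<Sum>\<beta>\<in>G n. c \<beta> * (\<Prod>i\<in>I. u i ^ \<beta> i) * t ^ \<beta> j)"
      by (auto simp: sum_distrib_right G_def intro!: sum.cong)
    also have "\<dots> = (\<Sum>\<beta>\<in>F. c \<beta> * (\<Prod>i\<in>I. u i ^ \<beta> i) * t ^ \<beta> j)"
      unfolding G_def by (rule sum.image_gen[symmetric]) (rule insert.prems(1))
    also have "\<dots> = (\<Sum>\<beta>\<in>F. c \<beta> * (\<Prod>i\<in>insert j I. (u(j := t)) i ^ \<beta> i))"
    proof (rule sum.cong)
      fix \<beta>
      have "(\<Prod>i\<in>I. (u(j := t)) i ^ \<beta> i) = (\<Prod>i\<in>I. u i ^ \<beta> i)"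
        by (rule prod.cong) (use insert.hyps in auto)
      then show "c \<beta> * (\<Prod>i\<in>I. u i ^ \<beta> i) * t ^ \<beta> j =
          c \<beta> * (\<Prod>i\<in>insert j I. (u(j := t)) i ^ \<beta> i)"
        using insert.hyps by simp
    qed simp
    finally show "(\<Sum>n\<in>(\<lambda>\<beta>. \<beta> j) ` F. (\<Sum>\<beta>\<in>G n. c \<beta> * (\<Prod>i\<in>I. u i ^ \<beta> i)) * t ^ n) = 0"
      using insert.prems(3) by simp
  qed (use insert.prems n in auto)
  then have z: "(\<Sum>\<beta>\<in>G (\<alpha> j). c \<beta> * (\<Prod>i\<in>I. u i ^ \<beta> i)) = 0" for u
    using insert.prems(4) by auto
  show ?case
  proof (rule insert.IH[of "G (\<alpha> j)"])
    show "\<beta> = \<gamma>" if "\<beta> \<in> G (\<alpha> j)" "\<gamma> \<in> G (\<alpha> j)" "\<And>i. i \<in> I \<Longrightarrow> \<beta> i = \<gamma> i" for \<beta> \<gamma>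
      by (rule insert.prems(2)) (use that in \<open>auto simp: G_def\<close>)
  qed (use z insert.prems in \<open>auto simp: G_def\<close>)
qed

lemma monomial_independent:
  assumes "finite F" "\<And>u. (\<Sum>\<alpha>\<in>F. c \<alpha> * monomial \<alpha> u) = 0" "\<alpha> \<in> F"
  shows "c \<alpha> = 0"
  by (rule restricted_monomials_independent[of UNIV F c \<alpha>])
    (use assms in \<open>simp_all add: monomial_def fun_eq_iff\<close>)

section \<open>Algebras of countable dimension\<close>

lemma fun_prime_ideal: "fun_prime R P \<Longrightarrow> fun_ideal R P"
  by (simp add: fun_prime_def)

lemma fun_ideal_absorb: "fun_ideal R J \<Longrightarrow> f \<in> R \<Longrightarrow> g \<in> J \<Longrightarrow> (\<lambda>x. f x * g x) \<in> J"
  by (simp add: fun_ideal_def)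

lemma fun_ideal_add: "fun_ideal R J \<Longrightarrow> f \<in> J \<Longrightarrow> g \<in> J \<Longrightarrow> (\<lambda>x. f x + g x) \<in> J"
  by (simp add: fun_ideal_def)

lemma fun_primeD:
  "fun_prime R P \<Longrightarrow> (\<lambda>x. f x * g x) \<in> P \<Longrightarrow> f \<in> R \<Longrightarrow> g \<in> R \<Longrightarrow> f \<notin> P \<Longrightarrow> g \<in> P"
  by (auto simp: fun_prime_def)

text \<open>Over the complex numbers \<open>q\<close> splits into linear factors, and a prime that
  contains the product contains one of them. This is the algebraic case in the computation of a
  residue field.\<close>

lemma fun_prime_poly_root:
  assumes P: "fun_prime R P" and f: "f \<in> R"
    and const: "\<And>c. (\<lambda>x. c) \<in> R" and poly: "\<And>q. (\<lambda>x. poly q (f x)) \<in> R"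
    and "q \<noteq> 0" "(\<lambda>x. poly q (f x)) \<in> P"
  shows "\<exists>c. (\<lambda>x. f x - c) \<in> P"
  using assms(5,6)
proof (induction "degree q" arbitrary: q)
  case 0
  then obtain a where "q = [:a:]" by (metis degree_eq_zeroE)
  with 0(2) have a: "q = [:a:]" "a \<noteq> 0" by auto
  have "(\<lambda>x. inverse a * poly q (f x)) \<in> P"
    by (rule fun_ideal_absorb[OF fun_prime_ideal[OF P] const 0(3)])
  with a have "(\<lambda>x. 1) \<in> P" by simp
  with P show ?case by (simp add: fun_prime_def)
next
  case (Suc d)
  then have "\<not> constant (poly q)"
    by (metis constant_degree nat.simps(3))
  from fundamental_theorem_of_algebra[OF this] obtain c where "poly q c = 0" ..
  then obtain r where r: "q = [:-c, 1:] * r" by (auto simp: poly_eq_0_iff_dvd)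
  with Suc.prems have "r \<noteq> 0" by auto
  with r have "degree q = Suc (degree r)"
    using degree_mult_eq[of "[:-c, 1:]" r] by simp
  with Suc.hyps have d: "d = degree r" by simp
  have lin: "(\<lambda>x. poly [:-c, 1:] (f x)) \<in> R" by (rule poly)
  have "(\<lambda>x. poly [:-c, 1:] (f x) * poly r (f x)) \<in> P"
    using Suc.prems(2) unfolding r poly_mult .
  then have "(\<lambda>x. poly [:-c, 1:] (f x)) \<in> P \<or> (\<lambda>x. poly r (f x)) \<in> P"
    using fun_primeD[OF P _ lin poly[of r]] by blast
  then show ?case
  proof
    assume "(\<lambda>x. poly [:-c, 1:] (f x)) \<in> P"
    then show ?thesis by (auto simp: algebra_simps)
  next
    assume "(\<lambda>x. poly r (f x)) \<in> P"
    with Suc.hyps(1)[OF d \<open>r \<noteq> 0\<close>] show ?thesis .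
  qed
qed

lemma infinite_fibre:
  fixes F :: "complex \<Rightarrow> 'a"
  assumes "countable (range F)"
  obtains y where "infinite {c. F c = y}"
proof -
  have "uncountable (UNIV :: complex set)"
    by (simp add: uncountable_UNIV_complex)
  moreover have "(UNIV :: complex set) = (\<Union>y\<in>range F. {c. F c = y})" by auto
  ultimately have "\<not> (\<forall>y\<in>range F. countable {c. F c = y})"
    using countable_UN[OF assms] by metis
  then show thesis using that countable_finite by blast
qed

lemma lin_finite_support:
  assumes "f \<in> lin B"
  obtains F where "finite F" "F \<subseteq> B" "f \<in> lin F"
proof -
  from assms obtain F c where F: "finite F" "F \<subseteq> B" "f = (\<lambda>x. \<Sum>b\<in>F. c b * b x)"
    using lin_image_explicit[of f "\<lambda>b. b" B] by auto
  then have "f \<in> lin F"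
    unfolding F(3) by (intro lin_sum lin_scale fun_space.span_base)
  with F that show thesis by blast
qed

locale fun_algebra =
  fixes B R :: "('x \<Rightarrow> complex) set"
  assumes R_eq: "R = lin B"
    and one: "(\<lambda>x. 1) \<in> R"
    and basis_mult: "\<And>a b. a \<in> B \<Longrightarrow> b \<in> B \<Longrightarrow> (\<lambda>x. a x * b x) \<in> R"
begin

lemma add: "f \<in> R \<Longrightarrow> g \<in> R \<Longrightarrow> (\<lambda>x. f x + g x) \<in> R"
  by (simp add: R_eq lin_add)

lemma mult: "f \<in> R \<Longrightarrow> g \<in> R \<Longrightarrow> (\<lambda>x. f x * g x) \<in> R"
  unfolding R_eq by (rule lin_mult) (use basis_mult R_eq in auto)

lemma const: "(\<lambda>x. c) \<in> R"
  using lin_scale[of "\<lambda>x. 1" B c] one by (simp add: R_eq)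

lemma diff: "f \<in> R \<Longrightarrow> g \<in> R \<Longrightarrow> (\<lambda>x. f x - g x) \<in> R"
  by (simp add: R_eq lin_diff)

lemma power: "f \<in> R \<Longrightarrow> (\<lambda>x. f x ^ n) \<in> R"
  by (induction n) (auto intro: const mult)

lemma poly: "f \<in> R \<Longrightarrow> (\<lambda>x. poly q (f x)) \<in> R"
  by (induction q) (auto intro!: add const mult)

lemma prod: "(\<And>i. i \<in> I \<Longrightarrow> f i \<in> R) \<Longrightarrow> (\<lambda>x. \<Prod>i\<in>I. f i x) \<in> R"
  by (induction I rule: infinite_finite_induct) (auto intro: const mult)

lemma sum: "(\<And>i. i \<in> I \<Longrightarrow> f i \<in> R) \<Longrightarrow> (\<lambda>x. \<Sum>i\<in>I. f i x) \<in> R"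
  by (induction I rule: infinite_finite_induct) (auto intro: const add)

lemma ideal_diff: "fun_ideal R J \<Longrightarrow> f \<in> J \<Longrightarrow> g \<in> J \<Longrightarrow> (\<lambda>x. f x - g x) \<in> J"
  using fun_ideal_add[of R J f "\<lambda>x. - 1 * g x"] fun_ideal_absorb[of R J "\<lambda>x. - 1" g] const by simp

text \<open>An ideal maximal among those avoiding all powers of \<open>h\<close> is prime. The last
  conclusion spells out maximality: once \<open>h\<close> is inverted, every \<open>f\<close>
  outside \<open>P\<close> becomes invertible modulo \<open>P\<close>, so the residue ring is a
  field.\<close>

lemma maximal_avoiding_ideal:
  assumes J: "fun_ideal R J" and h: "h \<in> R" "\<And>n. (\<lambda>x. h x ^ n) \<notin> J"
  obtains P where "fun_prime R P" "J \<subseteq> P" "\<forall>n. (\<lambda>x. h x ^ n) \<notin> P"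
    "\<forall>f\<in>R - P. \<exists>n. \<exists>p\<in>P. \<exists>g\<in>R. (\<lambda>x. h x ^ n) = (\<lambda>x. p x + f x * g x)"
proof -
  define A where "A = {P. fun_ideal R P \<and> J \<subseteq> P \<and> (\<forall>n. (\<lambda>x. h x ^ n) \<notin> P)}"
  have "\<exists>P\<in>A. \<forall>X\<in>A. P \<subseteq> X \<longrightarrow> X = P"
  proof (rule subset_Zorn_nonempty)
    show "A \<noteq> {}" using assms by (auto simp: A_def)
    fix C assume C: "C \<noteq> {}" "subset.chain A C"
    then have CA: "C \<subseteq> A" by (auto simp: subset.chain_def)
    then have idl: "fun_ideal R N" if "N \<in> C" for N using that by (auto simp: A_def)
    have "fun_ideal R (\<Union>C)"
      unfolding fun_ideal_def
    proof (intro conjI ballI)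
      show "\<Union>C \<subseteq> R" "(\<lambda>x. 0) \<in> \<Union>C"
        using CA C(1) by (auto simp: A_def fun_ideal_def)
      fix f g assume g: "g \<in> \<Union>C"
      show "(\<lambda>x. f x * g x) \<in> \<Union>C" if "f \<in> R"
      proof -
        from g obtain N where "N \<in> C" "g \<in> N" by blast
        with fun_ideal_absorb[OF idl[of N] that] show ?thesis by blast
      qed
      show "(\<lambda>x. f x + g x) \<in> \<Union>C" if "f \<in> \<Union>C"
      proof -
        from that g obtain K L where KL: "K \<in> C" "f \<in> K" "L \<in> C" "g \<in> L" by blast
        with C(2) have "K \<subseteq> L \<or> L \<subseteq> K" by (auto simp: subset.chain_def)
        with KL obtain N where "N \<in> C" "f \<in> N" "g \<in> N" by blast
        with fun_ideal_add[OF idl[of N]] show ?thesis by blast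
      qed
    qed
    with CA C(1) show "\<Union>C \<in> A" by (auto simp: A_def)
  qed
  then obtain P where "P \<in> A" and max: "\<And>X. X \<in> A \<Longrightarrow> P \<subseteq> X \<Longrightarrow> X = P" by blast
  then have P: "fun_ideal R P" "J \<subseteq> P" "\<And>n. (\<lambda>x. h x ^ n) \<notin> P" by (auto simp: A_def)
  have P_R: "P \<subseteq> R" using P(1) by (simp add: fun_ideal_def)
  have ext: "\<exists>n. \<exists>p\<in>P. \<exists>g\<in>R. (\<lambda>x. h x ^ n) = (\<lambda>x. p x + f x * g x)"
    if f: "f \<in> R" "f \<notin> P" for f
  proof -
    define X where "X = {(\<lambda>x. p x + f x * g x) |p g. p \<in> P \<and> g \<in> R}"
    have XI: "(\<lambda>x. p x + f x * g x) \<in> X" if "p \<in> P" "g \<in> R" for p g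
      using that by (auto simp: X_def)
    have "P \<subseteq> X" using XI[OF _ const[of 0]] by auto
    moreover have "f \<in> X"
      using XI[OF _ const[of 1], of "\<lambda>x. 0"] P(1) by (simp add: fun_ideal_def)
    ultimately have "X \<notin> A" using max[of X] f by blast
    moreover have "fun_ideal R X"
      unfolding fun_ideal_def
    proof (intro conjI ballI)
      show "X \<subseteq> R" using P_R f by (auto simp: X_def intro!: add mult)
      show "(\<lambda>x. 0) \<in> X" using \<open>P \<subseteq> X\<close> P(1) by (auto simp: fun_ideal_def)
      fix a b assume "b \<in> X"
      then obtain p g where b: "b = (\<lambda>x. p x + f x * g x)" "p \<in> P" "g \<in> R"
        by (auto simp: X_def)
      show "(\<lambda>x. a x * b x) \<in> X" if "a \<in> R"
        using XI[OF fun_ideal_absorb[OF P(1) that b(2)] mult[OF that b(3)]]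
        by (simp add: b(1) algebra_simps)
      show "(\<lambda>x. a x + b x) \<in> X" if "a \<in> X"
      proof -
        from that obtain q k where a: "a = (\<lambda>x. q x + f x * k x)" "q \<in> P" "k \<in> R"
          by (auto simp: X_def)
        show ?thesis
          using XI[OF fun_ideal_add[OF P(1) a(2) b(2)] add[OF a(3) b(3)]]
          by (simp add: a(1) b(1) algebra_simps)
      qed
    qed
    ultimately obtain n where "(\<lambda>x. h x ^ n) \<in> X"
      using \<open>P \<subseteq> X\<close> P(2) by (auto simp: A_def)
    then obtain p g where "(\<lambda>x. h x ^ n) = (\<lambda>x. p x + f x * g x)" "p \<in> P" "g \<in> R"
      by (auto simp: X_def)
    then show ?thesis by blast
  qed
  have "fun_prime R P"
    unfolding fun_prime_def
  proof (intro conjI ballI impI P(1))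
    show "(\<lambda>x. 1) \<notin> P" using P(3)[of 0] by simp
    fix f g assume fg: "f \<in> R" "g \<in> R" "(\<lambda>x. f x * g x) \<in> P"
    show "f \<in> P \<or> g \<in> P"
    proof (rule ccontr)
      assume "\<not> ?thesis"
      with ext[OF fg(1)] ext[OF fg(2)] obtain n m p q a b where
        1: "p \<in> P" "a \<in> R" "(\<lambda>x. h x ^ n) = (\<lambda>x. p x + f x * a x)" and
        2: "q \<in> P" "b \<in> R" "(\<lambda>x. h x ^ m) = (\<lambda>x. q x + g x * b x)" by blast
      have "(\<lambda>x. (h x ^ m) * p x + ((f x * a x) * q x + (a x * b x) * (f x * g x))) \<in> P"
        by (rule fun_ideal_add[OF P(1) fun_ideal_absorb[OF P(1) power[OF h(1)] 1(1)]
              fun_ideal_add[OF P(1) fun_ideal_absorb[OF P(1) mult[OF fg(1) 1(2)] 2(1)]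
                fun_ideal_absorb[OF P(1) mult[OF 1(2) 2(2)] fg(3)]]])
      also have "(\<lambda>x. (h x ^ m) * p x + ((f x * a x) * q x + (a x * b x) * (f x * g x)))
          = (\<lambda>x. h x ^ (n + m))"
      proof
        fix x
        from fun_cong[OF 1(3), of x] fun_cong[OF 2(3), of x]
        show "(h x ^ m) * p x + ((f x * a x) * q x + (a x * b x) * (f x * g x)) = h x ^ (n + m)"
          by (simp add: power_add algebra_simps)
      qed
      finally show False using P(3) by blast
    qed
  qed
  then show thesis using P(2,3) ext by (intro that ballI allI) auto
qed

text \<open>The residue field at a maximal ideal has countable dimension over the complex numbers,
  whereas for a transcendental \<open>f\<close> the uncountably many inverses of \<open>f - c\<close> would be independent.\<close>

lemma residue_field_is_complex:
  assumes "countable B" and J: "fun_ideal R J" and h: "h \<in> R" "\<And>n. (\<lambda>x. h x ^ n) \<notin> J"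
  obtains P where "fun_prime R P" "J \<subseteq> P" "h \<notin> P"
    "\<And>f. f \<in> R \<Longrightarrow> \<exists>c. (\<lambda>x. f x - c) \<in> P"
proof -
  obtain P where P: "fun_prime R P" "J \<subseteq> P" "\<forall>n. (\<lambda>x. h x ^ n) \<notin> P" and
    ext: "\<forall>f\<in>R - P. \<exists>n. \<exists>p\<in>P. \<exists>g\<in>R. (\<lambda>x. h x ^ n) = (\<lambda>x. p x + f x * g x)"
    by (rule maximal_avoiding_ideal[OF J h], rule that)
  note id = fun_prime_ideal[OF P(1)]
  have "\<exists>c. (\<lambda>x. f x - c) \<in> P" if f: "f \<in> R" for f
  proof (rule ccontr)
    assume nex: "\<not> ?thesis"
    have "\<forall>c. \<exists>n p g F. p \<in> P \<and> (\<lambda>x. h x ^ n) = (\<lambda>x. p x + (f x - c) * g x) \<and>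
        finite F \<and> F \<subseteq> B \<and> g \<in> lin F"
    proof
      fix c
      have "(\<lambda>x. f x - c) \<in> R - P"
        using nex diff[OF f const] by blast
      from bspec[OF ext this] obtain n p g where
        g: "p \<in> P" "g \<in> R" "(\<lambda>x. h x ^ n) = (\<lambda>x. p x + (f x - c) * g x)" by blast
      from g(2) obtain F where "finite F" "F \<subseteq> B" "g \<in> lin F"
        unfolding R_eq by (rule lin_finite_support)
      with g show "\<exists>n p g F. p \<in> P \<and> (\<lambda>x. h x ^ n) = (\<lambda>x. p x + (f x - c) * g x) \<and>
        finite F \<and> F \<subseteq> B \<and> g \<in> lin F" by blast
    qed
    then obtain n where "\<forall>c. \<exists>p g F. p \<in> P \<and> (\<lambda>x. h x ^ n c) = (\<lambda>x. p x + (f x - c) * g x) \<and>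
        finite F \<and> F \<subseteq> B \<and> g \<in> lin F"
      by (rule choice[THEN exE])
    then obtain p where "\<forall>c. \<exists>g F. p c \<in> P \<and> (\<lambda>x. h x ^ n c) = (\<lambda>x. p c x + (f x - c) * g x) \<and>
        finite F \<and> F \<subseteq> B \<and> g \<in> lin F"
      by (rule choice[THEN exE])
    then obtain g where "\<forall>c. \<exists>F. p c \<in> P \<and> (\<lambda>x. h x ^ n c) = (\<lambda>x. p c x + (f x - c) * g c x) \<and>
        finite F \<and> F \<subseteq> B \<and> g c \<in> lin F"
      by (rule choice[THEN exE])
    then obtain F where "\<forall>c. p c \<in> P \<and> (\<lambda>x. h x ^ n c) = (\<lambda>x. p c x + (f x - c) * g c x) \<and>
        finite (F c) \<and> F c \<subseteq> B \<and> g c \<in> lin (F c)"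
      by (rule choice[THEN exE])
    then have *: "\<And>c. p c \<in> P" "\<And>c. (\<lambda>x. h x ^ n c) = (\<lambda>x. p c x + (f x - c) * g c x)"
        "\<And>c. finite (F c)" "\<And>c. F c \<subseteq> B" "\<And>c. g c \<in> lin (F c)"
      by blast+
    \<comment> \<open>The exponent of \<open>h\<close> and the finite support of \<open>g c\<close>
      take only countably many values, so infinitely many \<open>c\<close> share one pair
      \<open>(N, E)\<close>. More than \<open>card E\<close> of these \<open>g c\<close> are
      linearly dependent.\<close>
    have "range (\<lambda>c. (n c, F c)) \<subseteq> UNIV \<times> {F. finite F \<and> F \<subseteq> B}"
      using *(3,4) by auto
    moreover have "countable (UNIV \<times> {F. finite F \<and> F \<subseteq> B} :: (nat \<times> _) set)"
      by (intro countable_SIGMA countable_Collect_finite_subset assms(1) countableI_type)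
    ultimately have "countable (range (\<lambda>c. (n c, F c)))" by (rule countable_subset)
    then obtain y where y: "infinite {c. (n c, F c) = y}" by (rule infinite_fibre)
    obtain N E where "y = (N, E)" by (cases y)
    with y have "infinite {c. (n c, F c) = (N, E)}" by simp
    from infinite_arbitrarily_large[OF this] obtain C where
      C: "finite C" "card C = Suc (card E)" "C \<subseteq> {c. (n c, F c) = (N, E)}" by blast
    then have CN: "n c = N" "F c = E" if "c \<in> C" for c using that by auto
    from C(2) have "C \<noteq> {}" by auto
    with CN *(3) have "finite E" by blast
    moreover have "card E < card C" "g c \<in> lin E" if "c \<in> C" for c
      using C(2) CN[OF that] *(5)[of c] by simp_all
    ultimately obtain l where l: "\<exists>c\<in>C. l c \<noteq> 0" "\<And>x. (\<Sum>c\<in>C. l c * g c x) = 0"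
      using lin_dependent[of E C g] C(1,2) by (metis lessI)
    have hN: "h x ^ N = p c x + (f x - c) * g c x" if "c \<in> C" for c x
      using fun_cong[OF *(2)[of c], of x] CN(1)[OF that] by simp
    \<comment> \<open>Clearing denominators in the dependency \<Sum> l c / (f - c) = 0:
      \<open>q\<close> is the numerator. It is nonzero because at \<open>c0\<close> only the summand
      of \<open>c0\<close> survives.\<close>
    define q where "q = (\<Sum>c\<in>C. smult (l c) (\<Prod>d\<in>C - {c}. [:-d, 1:]))"
    have pq: "poly q z = (\<Sum>c\<in>C. l c * (\<Prod>d\<in>C - {c}. z - d))" for z
      by (simp add: q_def poly_sum poly_prod)
    from l(1) obtain c0 where c0: "c0 \<in> C" "l c0 \<noteq> 0" by blast
    have "poly q c0 = l c0 * (\<Prod>d\<in>C - {c0}. c0 - d)"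
    proof -
      have "(\<Sum>c\<in>C - {c0}. l c * (\<Prod>d\<in>C - {c}. c0 - d)) = 0"
      proof (intro sum.neutral ballI)
        fix c assume "c \<in> C - {c0}"
        then have "(\<Prod>d\<in>C - {c}. c0 - d) = 0"
          using C(1) c0(1) by (intro prod_zero) auto
        then show "l c * (\<Prod>d\<in>C - {c}. c0 - d) = 0" by simp
      qed
      then show ?thesis
        unfolding pq sum.remove[OF C(1) c0(1)] by simp
    qed
    then have "poly q c0 \<noteq> 0" using C(1) c0 by auto
    then have "q \<noteq> 0" by auto
    have "(\<lambda>x. \<Sum>c\<in>C. (l c * (\<Prod>d\<in>C - {c}. f x - d)) * p c x) \<in> P"
      by (intro fun_ideal_sum[OF id] fun_ideal_absorb[OF id _ *(1)] mult const prod diff f)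
    moreover have "(\<Sum>c\<in>C. (l c * (\<Prod>d\<in>C - {c}. f x - d)) * p c x) = poly q (f x) * h x ^ N" for x
    proof -
      have "poly q (f x) * h x ^ N =
          (\<Sum>c\<in>C. (l c * (\<Prod>d\<in>C - {c}. f x - d)) * (p c x + (f x - c) * g c x))"
        unfolding pq sum_distrib_right
        using hN by (intro sum.cong) (simp_all add: mult.assoc)
      also have "\<dots> = (\<Sum>c\<in>C. (l c * (\<Prod>d\<in>C - {c}. f x - d)) * p c x) +
          (\<Sum>c\<in>C. (\<Prod>d\<in>C. f x - d) * (l c * g c x))"
        using C(1) by (subst sum.distrib[symmetric], intro sum.cong) (simp_all add: prod.remove algebra_simps)
      also have "(\<Sum>c\<in>C. (\<Prod>d\<in>C. f x - d) * (l c * g c x)) = 0"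
        using l(2) by (simp add: sum_distrib_left[symmetric])
      finally show ?thesis by simp
    qed
    ultimately have "(\<lambda>x. poly q (f x) * h x ^ N) \<in> P" by simp
    then have "(\<lambda>x. poly q (f x)) \<in> P"
      using fun_primeD[OF P(1) _ power[OF h(1), of N] poly[OF f, of q] spec[OF P(3), of N]]
      by (simp add: mult.commute)
    with fun_prime_poly_root[OF P(1) f const poly[OF f] \<open>q \<noteq> 0\<close>] nex show False by blast
  qed
  moreover have "h \<notin> P" using spec[OF P(3), of 1] by simp
  ultimately show thesis using that[OF P(1,2)] by blast
qed

end

section \<open>Isolated zeros on the cone of a one-dimensional torus\<close>

locale torus_exponents =
  fixes W X Y :: "'i::finite set"
  assumes disjoint: "W \<inter> X = {}" "W \<inter> Y = {}" "X \<inter> Y = {}"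
begin

text \<open>Exponents of the monomials that are invariant under the one-dimensional torus acting with
  weight \<open>1\<close> on the variables in \<open>X\<close> and with weight \<open>-1\<close> on those in \<open>Y\<close>.\<close>

definition expo :: "('i \<Rightarrow> nat) set" where
  "expo = {\<alpha>. (\<forall>i. i \<notin> W \<union> X \<union> Y \<longrightarrow> \<alpha> i = 0) \<and> sum \<alpha> X = sum \<alpha> Y}"

text \<open>Every generator, a variable from \<open>W\<close> or a product of one variable from
  \<open>X\<close> and one from \<open>Y\<close>, has degree one. Exponents in \<open>Y\<close> are
  not counted because they balance those in \<open>X\<close>.\<close>

definition deg :: "('i \<Rightarrow> nat) \<Rightarrow> nat" where
  "deg \<alpha> = sum \<alpha> W + sum \<alpha> X"

definition invariants :: "(('i \<Rightarrow> complex) \<Rightarrow> complex) set" where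
  "invariants = lin (monomial ` expo)"

text \<open>The \<open>k\<close>-th power of the maximal ideal of the origin; describing it by
  degree keeps it spanned by monomials.\<close>

definition filt :: "nat \<Rightarrow> (('i \<Rightarrow> complex) \<Rightarrow> complex) set" where
  "filt k = lin (monomial ` {\<alpha> \<in> expo. k \<le> deg \<alpha>})"

definition gens :: "('i \<Rightarrow> nat) set" where
  "gens = {(\<lambda>j. if j = w then 1 else 0) |w. w \<in> W} \<union>
     {(\<lambda>j. if j = x \<or> j = y then 1 else 0) |x y. x \<in> X \<and> y \<in> Y}"

lemma expo_zero: "(\<lambda>_. 0) \<in> expo"
  by (simp add: expo_def)

lemma expo_plus: "\<alpha> \<in> expo \<Longrightarrow> \<beta> \<in> expo \<Longrightarrow> (\<lambda>i. \<alpha> i + \<beta> i) \<in> expo"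
  by (simp add: expo_def sum.distrib)

lemma deg_plus: "deg (\<lambda>i. \<alpha> i + \<beta> i) = deg \<alpha> + deg \<beta>"
  by (simp add: deg_def sum.distrib)

lemma sum_pair:
  fixes A :: "'i set"
  assumes "x \<noteq> y"
  shows "(\<Sum>j\<in>A. if j = x \<or> j = y then 1 else 0 :: nat) =
    (if x \<in> A then 1 else 0) + (if y \<in> A then 1 else 0)"
proof -
  have "(\<Sum>j\<in>A. if j = x \<or> j = y then 1 else 0 :: nat) =
      (\<Sum>j\<in>A. (if j = x then 1 else 0) + (if j = y then 1 else 0))"
    using assms by (intro sum.cong) auto
  then show ?thesis by (simp add: sum.distrib)
qed

lemma gens_cases [consumes 1, case_names unit pair]:
  assumes "g \<in> gens"
  obtains w where "w \<in> W" "w \<notin> X" "w \<notin> Y" "g = (\<lambda>j. if j = w then 1 else 0)"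
  | x y where "x \<in> X" "y \<in> Y" "x \<noteq> y" "x \<notin> W" "x \<notin> Y" "y \<notin> W" "y \<notin> X"
      "g = (\<lambda>j. if j = x \<or> j = y then 1 else 0)"
  using assms disjoint unfolding gens_def by blast

lemma gens_expo: "g \<in> gens \<Longrightarrow> g \<in> expo"
  by (erule gens_cases) (auto simp: expo_def sum_pair)

lemma gens_deg: "g \<in> gens \<Longrightarrow> deg g = 1"
  by (erule gens_cases) (auto simp: deg_def sum_pair)

lemma gens_finite: "finite gens"
proof -
  have "gens \<subseteq> (\<lambda>w j. if j = w then 1 else 0) ` UNIV \<union>
     (\<lambda>(x, y) j. if j = x \<or> j = y then 1 else 0) ` UNIV"
    by (auto simp: gens_def)
  then show ?thesis by (rule finite_subset) simp
qed

lemma expo_eq_zero: "\<alpha> \<in> expo \<Longrightarrow> deg \<alpha> = 0 \<Longrightarrow> \<alpha> = (\<lambda>_. 0)"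
  by (auto simp: expo_def deg_def fun_eq_iff)

lemma split_gen_power:
  assumes \<alpha>: "\<alpha> \<in> expo"
    and big: "(\<exists>w\<in>W. M \<le> \<alpha> w) \<or> (\<exists>x\<in>X. \<exists>y\<in>Y. M \<le> \<alpha> x \<and> M \<le> \<alpha> y)"
  obtains g \<beta> where "g \<in> gens" "\<beta> \<in> expo" "\<alpha> = (\<lambda>i. \<beta> i + M * g i)"
proof -
  note main = that
  have split: "thesis" if g: "g \<in> gens" and le: "\<And>i. M * g i \<le> \<alpha> i" for g
  proof -
    define \<beta> where "\<beta> i = \<alpha> i - M * g i" for i
    have eq: "\<alpha> = (\<lambda>i. \<beta> i + M * g i)" using le by (auto simp: \<beta>_def)
    have "sum \<alpha> A = sum \<beta> A + M * sum g A" for A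
      by (subst eq) (simp add: sum.distrib sum_distrib_left)
    with \<alpha> gens_expo[OF g] have "\<beta> \<in> expo"
      by (auto simp: expo_def \<beta>_def)
    from main[OF g this eq] show thesis .
  qed
  from big show thesis
  proof
    assume "\<exists>w\<in>W. M \<le> \<alpha> w"
    then obtain w where "w \<in> W" "M \<le> \<alpha> w" by blast
    then show thesis
      by (intro split[of "\<lambda>j. if j = w then 1 else 0"]) (auto simp: gens_def)
  next
    assume "\<exists>x\<in>X. \<exists>y\<in>Y. M \<le> \<alpha> x \<and> M \<le> \<alpha> y"
    then obtain x y where xy: "x \<in> X" "y \<in> Y" "M \<le> \<alpha> x" "M \<le> \<alpha> y" by blast
    then have "(\<lambda>j. if j = x \<or> j = y then 1 else 0) \<in> gens" unfolding gens_def by blast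
    then show thesis
      by (rule split) (use xy in auto)
  qed
qed

lemma sum_less_if_all_less:
  fixes \<alpha> :: "'i \<Rightarrow> nat"
  assumes "\<And>i. i \<in> A \<Longrightarrow> \<alpha> i < M"
  shows "sum \<alpha> A \<le> card A * M"
  using sum_bounded_above[of A \<alpha> M] assms by (simp add: less_imp_le)

text \<open>If no generator divides to the power \<open>M\<close>, all exponents on \<open>W\<close>
  are below \<open>M\<close>, and so are all those on \<open>X\<close> or all those on
  \<open>Y\<close>. As the two sums agree, the degree is bounded in either case.\<close>

lemma split_gen_power_deg:
  assumes \<alpha>: "\<alpha> \<in> expo" and d: "deg \<alpha> > (card W + card X + card Y) * M"
  obtains g \<beta> where "g \<in> gens" "\<beta> \<in> expo" "\<alpha> = (\<lambda>i. \<beta> i + M * g i)"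
proof (cases "(\<exists>w\<in>W. M \<le> \<alpha> w) \<or> (\<exists>x\<in>X. \<exists>y\<in>Y. M \<le> \<alpha> x \<and> M \<le> \<alpha> y)")
  case True
  from split_gen_power[OF \<alpha> this] that show thesis .
next
  case False
  then have "sum \<alpha> W \<le> card W * M" by (intro sum_less_if_all_less) auto
  moreover from False have "(\<forall>x\<in>X. \<alpha> x < M) \<or> (\<forall>y\<in>Y. \<alpha> y < M)" by force
  then have "sum \<alpha> X \<le> card X * M \<or> sum \<alpha> Y \<le> card Y * M"
    using sum_less_if_all_less by blast
  then have "sum \<alpha> X \<le> card X * M + card Y * M"
    using \<alpha> by (auto simp: expo_def)
  ultimately have False using d by (simp add: deg_def algebra_simps)
  then show thesis ..
qed

lemma split_gen:
  assumes \<alpha>: "\<alpha> \<in> expo" and "deg \<alpha> > 0"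
  obtains g \<beta> where "g \<in> gens" "\<beta> \<in> expo" "\<alpha> = (\<lambda>i. \<beta> i + g i)"
proof -
  have "(\<exists>w\<in>W. 1 \<le> \<alpha> w) \<or> (\<exists>x\<in>X. \<exists>y\<in>Y. 1 \<le> \<alpha> x \<and> 1 \<le> \<alpha> y)"
  proof (rule ccontr)
    assume *: "\<not> ?thesis"
    then have "sum \<alpha> W = 0" by (intro sum.neutral) force
    moreover from * have "(\<forall>x\<in>X. \<alpha> x = 0) \<or> (\<forall>y\<in>Y. \<alpha> y = 0)" by force
    then have "sum \<alpha> X = 0 \<or> sum \<alpha> Y = 0" by (metis sum.neutral)
    then have "sum \<alpha> X = 0" using \<alpha> by (auto simp: expo_def)
    ultimately show False using assms(2) by (simp add: deg_def)
  qed
  from split_gen_power[OF \<alpha> this] that show thesis by auto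
qed

lemma finite_expo_deg: "finite {\<alpha> \<in> expo. deg \<alpha> < k}"
proof (rule finite_subset)
  show "{\<alpha> \<in> expo. deg \<alpha> < k} \<subseteq> (UNIV :: 'i set) \<rightarrow>\<^sub>E {..k}"
  proof
    fix \<alpha> assume "\<alpha> \<in> {\<alpha> \<in> expo. deg \<alpha> < k}"
    then have \<alpha>: "\<alpha> \<in> expo" "deg \<alpha> < k" by auto
    have "\<alpha> i \<le> k" for i
    proof (cases "i \<in> W \<union> X \<union> Y")
      case True
      then have "\<alpha> i \<le> sum \<alpha> W \<or> \<alpha> i \<le> sum \<alpha> X \<or> \<alpha> i \<le> sum \<alpha> Y"
        by (auto intro: member_le_sum)
      with \<alpha> show ?thesis by (auto simp: deg_def expo_def)
    qed (use \<alpha> in \<open>auto simp: expo_def\<close>)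
    then show "\<alpha> \<in> (UNIV :: 'i set) \<rightarrow>\<^sub>E {..k}" by auto
  qed
qed (auto intro: finite_PiE)

sublocale fun_algebra "monomial ` expo" invariants
proof
  show "(\<lambda>x. 1) \<in> invariants"
    unfolding invariants_def using expo_zero
    by (intro fun_space.span_base image_eqI[of _ _ "\<lambda>_. 0"]) (auto simp: monomial_zero)
  fix a b assume "a \<in> monomial ` expo" "b \<in> monomial ` expo"
  then obtain \<alpha> \<beta> where "a = monomial \<alpha>" "b = monomial \<beta>" "\<alpha> \<in> expo" "\<beta> \<in> expo" by blast
  then show "(\<lambda>x. a x * b x) \<in> invariants"
    unfolding invariants_def
    by (intro fun_space.span_base image_eqI[of _ _ "\<lambda>i. \<alpha> i + \<beta> i"])
      (auto simp: monomial_plus expo_plus)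
qed (simp add: invariants_def)

lemma monomial_ring: "\<alpha> \<in> expo \<Longrightarrow> monomial \<alpha> \<in> invariants"
  unfolding invariants_def by (intro fun_space.span_base imageI)

lemma monomial_filt: "\<alpha> \<in> expo \<Longrightarrow> k \<le> deg \<alpha> \<Longrightarrow> monomial \<alpha> \<in> filt k"
  unfolding filt_def by (intro fun_space.span_base imageI) simp

lemma filt_mono: "k \<le> l \<Longrightarrow> filt l \<subseteq> filt k"
  unfolding filt_def by (intro fun_space.span_mono) auto

lemma filt_zero: "filt 0 = invariants"
  by (simp add: filt_def invariants_def)

lemma filt_mult:
  assumes "f \<in> filt k" "g \<in> filt l"
  shows "(\<lambda>x. f x * g x) \<in> filt (k + l)"
  unfolding filt_def
proof (rule lin_mult[OF assms[unfolded filt_def]])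
  fix a b assume "a \<in> monomial ` {\<alpha> \<in> expo. k \<le> deg \<alpha>}" "b \<in> monomial ` {\<alpha> \<in> expo. l \<le> deg \<alpha>}"
  then obtain \<alpha> \<beta> where *: "a = monomial \<alpha>" "b = monomial \<beta>" "\<alpha> \<in> expo" "\<beta> \<in> expo"
    "k \<le> deg \<alpha>" "l \<le> deg \<beta>" by blast
  then have "(\<lambda>x. a x * b x) = monomial (\<lambda>i. \<alpha> i + \<beta> i)" by (auto simp: monomial_plus)
  with * show "(\<lambda>x. a x * b x) \<in> lin (monomial ` {\<alpha> \<in> expo. k + l \<le> deg \<alpha>})"
    by (auto intro!: fun_space.span_base imageI simp: expo_plus deg_plus)
qed

lemma monomial_at_zero: "\<alpha> \<in> expo \<Longrightarrow> 0 < deg \<alpha> \<Longrightarrow> monomial \<alpha> (\<lambda>_. 0) = 0"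
proof -
  assume "\<alpha> \<in> expo" "0 < deg \<alpha>"
  then obtain i where "\<alpha> i \<noteq> 0" unfolding deg_def by (metis add_is_0 less_numeral_extra(3) sum.neutral)
  then show ?thesis unfolding monomial_def by (intro prod_zero) (auto intro!: bexI[of _ i])
qed

lemma minus_value_filt:
  assumes "f \<in> invariants"
  shows "(\<lambda>x. f x - f (\<lambda>_. 0)) \<in> filt 1"
  using assms unfolding invariants_def
proof (induction rule: lin_induct)
  case zero
  then show ?case by (simp add: filt_def lin_zero)
next
  case (step c b g)
  then obtain \<alpha> where \<alpha>: "b = monomial \<alpha>" "\<alpha> \<in> expo" by blast
  have "(\<lambda>x. b x - b (\<lambda>_. 0)) \<in> filt 1"
  proof (cases "deg \<alpha> = 0")
    case True
    with \<alpha> expo_eq_zero have "b = monomial (\<lambda>_. 0)" by blast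
    then show ?thesis by (simp add: monomial_zero filt_def lin_zero)
  next
    case False
    then show ?thesis
      using monomial_at_zero[OF \<alpha>(2)] monomial_filt[OF \<alpha>(2), of 1] \<alpha>(1) by simp
  qed
  from lin_add[OF lin_scale[OF this[unfolded filt_def]] step(3)[unfolded filt_def], of c]
  show ?case by (simp add: filt_def algebra_simps)
qed

text \<open>A prime with residue field the complex numbers yields a character of the invariants, and
  the task is to realise it as evaluation at a point. Its values at the products of a variable from
  \<open>X\<close> and one from \<open>Y\<close> form a matrix with vanishing 2 by 2 minors; a
  matrix of rank at most one factors as \<open>v x * v y\<close>.\<close>

lemma nullstellensatz:
  assumes J: "fun_ideal invariants J" and h: "h \<in> invariants"
    and zero: "\<And>u. (\<forall>f\<in>J. f u = 0) \<Longrightarrow> h u = 0"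
  shows "\<exists>n. (\<lambda>x. h x ^ n) \<in> J"
proof (rule ccontr)
  assume nex: "\<not> ?thesis"
  have "countable (monomial ` expo)"
    by (rule countable_image) (rule countableI_type)
  from residue_field_is_complex[OF this J h] nex obtain P where
    P: "fun_prime invariants P" "J \<subseteq> P" "h \<notin> P" and
    ex: "\<And>f. f \<in> invariants \<Longrightarrow> \<exists>c. (\<lambda>x. f x - c) \<in> P" by blast
  note id = fun_prime_ideal[OF P(1)]
  have P_const: "c = 0" if "(\<lambda>x. c) \<in> P" for c
  proof (rule ccontr)
    assume "c \<noteq> 0"
    with fun_ideal_absorb[OF id const that, of "inverse c"] P(1) show False
      by (simp add: fun_prime_def)
  qed
  define ch where "ch f = (SOME c. (\<lambda>x. f x - c) \<in> P)" for f
  have ch: "(\<lambda>x. f x - ch f) \<in> P" if "f \<in> invariants" for f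
    unfolding ch_def using ex[OF that] by (rule someI_ex)
  have ch_eq: "ch f = c" if "f \<in> invariants" "(\<lambda>x. f x - c) \<in> P" for f c
    using P_const[of "c - ch f"] ideal_diff[OF id ch[OF that(1)] that(2)] by simp
  have ch_mult: "ch (\<lambda>x. f x * g x) = ch f * ch g" if fg: "f \<in> invariants" "g \<in> invariants" for f g
  proof (rule ch_eq)
    have "(\<lambda>x. g x * (f x - ch f) + ch f * (g x - ch g)) \<in> P"
      by (rule fun_ideal_add[OF id fun_ideal_absorb[OF id fg(2) ch[OF fg(1)]]
            fun_ideal_absorb[OF id const ch[OF fg(2)]]])
    then show "(\<lambda>x. f x * g x - ch f * ch g) \<in> P" by (simp add: algebra_simps)
  qed (rule mult[OF fg])
  define c where "c \<alpha> = ch (monomial \<alpha>)" for \<alpha>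
  have c_plus: "c (\<lambda>i. \<alpha> i + \<beta> i) = c \<alpha> * c \<beta>" if "\<alpha> \<in> expo" "\<beta> \<in> expo" for \<alpha> \<beta>
    using ch_mult[OF monomial_ring[OF that(1)] monomial_ring[OF that(2)]]
    by (simp add: c_def monomial_plus[symmetric])
  have c_zero: "c (\<lambda>_. 0) = 1"
  proof -
    have "monomial (\<lambda>_. 0) = (\<lambda>_ :: 'i \<Rightarrow> complex. 1)" by (simp add: fun_eq_iff monomial_zero)
    with ch_eq[OF one, of 1] id show ?thesis by (simp add: c_def fun_ideal_def)
  qed
  define xy where "xy x y j = (if j = x \<or> j = y then 1 else 0 :: nat)" for x y j :: 'i
  have xy: "xy x y \<in> expo" if "x \<in> X" "y \<in> Y" for x y
    by (rule gens_expo) (use that in \<open>auto simp: gens_def xy_def[abs_def]\<close>)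
  have minor: "c (xy x y) * c (xy x' y') = c (xy x y') * c (xy x' y)"
    if *: "x \<in> X" "x' \<in> X" "y \<in> Y" "y' \<in> Y" for x x' y y'
  proof -
    have "(\<lambda>i. xy x y i + xy x' y' i) = (\<lambda>i. xy x y' i + xy x' y i)"
      using * disjoint by (auto simp: xy_def fun_eq_iff)
    with c_plus[OF xy xy, of x y x' y'] c_plus[OF xy xy, of x y' x' y] * show ?thesis by simp
  qed
  obtain v where v: "\<And>x y. x \<in> X \<Longrightarrow> y \<in> Y \<Longrightarrow> v x * v y = c (xy x y)"
  proof (cases "\<forall>x\<in>X. \<forall>y\<in>Y. c (xy x y) = 0")
    case True
    then show thesis using that[of "\<lambda>_. 0"] by simp
  next
    case False
    then obtain x0 y0 where x0: "x0 \<in> X" "y0 \<in> Y" "c (xy x0 y0) \<noteq> 0" by blast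
    \<comment> \<open>The column and the row through a nonzero entry; dividing the row by that entry
      normalises the product at \<open>(x0, y0)\<close>, and the minors give all other
      entries.\<close>
    define v where "v i = (if i \<in> X then c (xy i y0) else c (xy x0 i) / c (xy x0 y0))" for i
    show thesis
    proof (rule that[of v])
      fix x y assume "x \<in> X" "y \<in> Y"
      then show "v x * v y = c (xy x y)"
        using minor[of x x0 y y0] x0 disjoint(3) by (auto simp: v_def field_simps)
    qed
  qed
  define u where "u i = (if i \<in> W then c (\<lambda>j. if j = i then 1 else 0) else v i)" for i
  have u_gens: "monomial g u = c g" if g: "g \<in> gens" for g
  proof -
    from g consider w where "w \<in> W" "g = (\<lambda>j. if j = w then 1 else 0)" |
      x y where "x \<in> X" "y \<in> Y" "g = xy x y"
      by (auto simp: gens_def xy_def[abs_def])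
    then show ?thesis
    proof cases
      case 1
      then show ?thesis by (simp add: monomial_single[simplified] u_def)
    next
      case 2
      then have "x \<noteq> y" using disjoint by auto
      then have "monomial g u = u x * u y"
        unfolding 2(3) xy_def[abs_def] by (rule monomial_pair)
      also have "\<dots> = v x * v y" using 2 disjoint by (auto simp: u_def)
      finally show ?thesis using v 2 by simp
    qed
  qed
  have u: "monomial \<alpha> u = c \<alpha>" if "\<alpha> \<in> expo" for \<alpha>
    using that
  proof (induction "deg \<alpha>" arbitrary: \<alpha>)
    case 0
    then show ?case using expo_eq_zero c_zero monomial_zero by metis
  next
    case (Suc d)
    then obtain g \<beta> where g: "g \<in> gens" "\<beta> \<in> expo" "\<alpha> = (\<lambda>i. \<beta> i + g i)"
      using split_gen[of \<alpha>] by auto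
    with Suc gens_deg have "d = deg \<beta>" by (simp add: deg_plus)
    with Suc g have "monomial \<beta> u = c \<beta>" by blast
    with g u_gens c_plus gens_expo show ?case by (simp add: monomial_plus)
  qed
  have eval: "(\<lambda>x. f x - f u) \<in> P" if "f \<in> invariants" for f
    using that unfolding invariants_def
  proof (induction rule: lin_induct)
    case zero
    then show ?case using id by (simp add: fun_ideal_def)
  next
    case (step a b g)
    then obtain \<alpha> where \<alpha>: "b = monomial \<alpha>" "\<alpha> \<in> expo" by blast
    with u ch[OF monomial_ring] have "(\<lambda>x. b x - b u) \<in> P" by (simp add: c_def)
    from fun_ideal_add[OF id fun_ideal_absorb[OF id const this] step(3), of a]
    show ?case by (simp add: algebra_simps)
  qed
  have "f u = 0" if f: "f \<in> J" for f
  proof -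
    from f P(2) J have "f \<in> P" "f \<in> invariants" by (auto simp: fun_ideal_def)
    with ideal_diff[OF id _ eval, of f f] have "(\<lambda>x. f u) \<in> P" by simp
    then show ?thesis by (rule P_const)
  qed
  then have "h u = 0" using zero by blast
  with eval[OF h] P(3) show False by simp
qed

end

section \<open>Growth of the filtration and the number of equations of an isolated zero\<close>

context torus_exponents
begin

lemma filt_add: "f \<in> filt k \<Longrightarrow> g \<in> filt k \<Longrightarrow> (\<lambda>x. f x + g x) \<in> filt k"
  unfolding filt_def by (rule lin_add)

lemma filt_prod:
  assumes "\<And>s. s \<in> S \<Longrightarrow> G s \<in> filt 1"
  shows "(\<lambda>x. \<Prod>s\<in>S. G s x ^ \<beta> s) \<in> filt (sum \<beta> S)"
  using assms
proof (induction S rule: infinite_finite_induct)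
  case (insert s S)
  have "(\<lambda>x. G s x ^ n) \<in> filt n" for n
    using filt_mult[of "G s" 1] insert.prems[of s]
    by (induction n) (auto simp: filt_zero one)
  from filt_mult[OF this insert.IH] insert show ?case by simp
qed (auto simp: filt_zero one)

lemma low_degree_part:
  assumes "f \<in> invariants"
  shows "\<exists>w \<in> lin (monomial ` {\<alpha> \<in> expo. deg \<alpha> < d}). (\<lambda>x. f x - w x) \<in> filt d"
  using assms unfolding invariants_def
proof (induction rule: lin_induct)
  case zero
  show ?case by (rule bexI[of _ "\<lambda>x. 0"]) (auto simp: lin_zero filt_def)
next
  case (step c b g)
  then obtain \<alpha> w where \<alpha>: "b = monomial \<alpha>" "\<alpha> \<in> expo"
    and w: "w \<in> lin (monomial ` {\<alpha> \<in> expo. deg \<alpha> < d})" "(\<lambda>x. g x - w x) \<in> filt d" by blast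
  show ?case
  proof (cases "deg \<alpha> < d")
    case True
    with \<alpha> have "b \<in> lin (monomial ` {\<alpha> \<in> expo. deg \<alpha> < d})"
      by (intro fun_space.span_base) auto
    from lin_add[OF lin_scale[OF this] w(1), of c] w(2) show ?thesis
      by (intro bexI[of _ "\<lambda>x. c * b x + w x"]) auto
  next
    case False
    with \<alpha> have "b \<in> filt d" by (auto intro: monomial_filt)
    from filt_add[OF lin_scale[OF this[unfolded filt_def], folded filt_def] w(2), of c]
    show ?thesis by (intro bexI[OF _ w(1)]) (simp add: algebra_simps)
  qed
qed

text \<open>A lower bound for growth of order |W| + |Y| + 1: the exponents on \<open>W\<close>, on
  \<open>Y\<close> and at \<open>x2\<close> are chosen freely in a box, and the exponent at
  \<open>x1\<close> is forced by the balance.\<close>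

lemma card_box_le_expo:
  assumes x: "x1 \<in> X" "x2 \<in> X" "x1 \<noteq> x2" and y0: "y0 \<in> Y"
  shows "L ^ (card W + card Y + 1) \<le> card {\<alpha> \<in> expo. deg \<alpha> < (card W + card Y + 1) * L + 1}"
    (is "_ \<le> card ?E")
proof -
  define I where "I = insert x2 (W \<union> Y)"
  have "x2 \<notin> W \<union> Y" using x disjoint by auto
  then have card_I: "card I = card W + card Y + 1"
    using disjoint by (simp add: I_def card_Un_disjoint)
  \<comment> \<open>The extra \<open>L\<close> at \<open>y0\<close> keeps the exponent at
    \<open>x1\<close> nonnegative, because \<open>\<beta> x2 < L\<close>; the truncated subtraction
    is then exact and the balance holds.\<close>
  define \<phi> where "\<phi> \<beta> i = (if i \<in> W then \<beta> i else if i \<in> Y then \<beta> i + (if i = y0 then L else 0)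
      else if i = x2 then \<beta> x2 else if i = x1 then sum \<beta> Y + L - \<beta> x2 else 0)"
    for \<beta> :: "'i \<Rightarrow> nat" and i
  have "inj_on \<phi> (I \<rightarrow>\<^sub>E {..<L})"
  proof (rule inj_onI)
    fix \<beta> \<gamma> assume \<beta>: "\<beta> \<in> I \<rightarrow>\<^sub>E {..<L}" "\<gamma> \<in> I \<rightarrow>\<^sub>E {..<L}" and eq: "\<phi> \<beta> = \<phi> \<gamma>"
    show "\<beta> = \<gamma>"
    proof (rule PiE_ext[OF \<beta>])
      fix i assume "i \<in> I"
      with fun_cong[OF eq, of i] \<open>x2 \<notin> W \<union> Y\<close> show "\<beta> i = \<gamma> i"
        by (auto simp: \<phi>_def I_def split: if_splits)
    qed
  qed
  moreover have "\<phi> ` (I \<rightarrow>\<^sub>E {..<L}) \<subseteq> ?E"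
  proof (rule image_subsetI)
    fix \<beta> assume \<beta>: "\<beta> \<in> I \<rightarrow>\<^sub>E {..<L}"
    then have lt: "\<beta> i < L" if "i \<in> I" for i using that by (auto simp: PiE_def)
    have sX: "sum (\<phi> \<beta>) X = sum \<beta> Y + L"
    proof -
      have "sum (\<phi> \<beta>) X = sum (\<phi> \<beta>) {x1, x2}"
        using x disjoint by (intro sum.mono_neutral_right) (auto simp: \<phi>_def)
      also have "\<dots> = sum \<beta> Y + L"
        using x disjoint lt[of x2] by (auto simp: \<phi>_def I_def)
      finally show ?thesis .
    qed
    have "sum (\<phi> \<beta>) Y = (\<Sum>i\<in>Y. \<beta> i + (if i = y0 then L else 0))"
      using disjoint by (intro sum.cong) (auto simp: \<phi>_def)
    then have sY: "sum (\<phi> \<beta>) Y = sum \<beta> Y + L"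
      using y0 by (simp add: sum.distrib)
    have sW: "sum (\<phi> \<beta>) W = sum \<beta> W" by (intro sum.cong) (auto simp: \<phi>_def)
    have "sum \<beta> W \<le> card W * L" "sum \<beta> Y \<le> card Y * L"
      using lt by (auto intro!: sum_less_if_all_less simp: I_def)
    then have "deg (\<phi> \<beta>) < (card W + card Y + 1) * L + 1"
      unfolding deg_def sX sW by (simp add: algebra_simps)
    moreover have "\<phi> \<beta> \<in> expo"
      unfolding expo_def using sX sY x by (auto simp: \<phi>_def)
    ultimately show "\<phi> \<beta> \<in> ?E" by simp
  qed
  ultimately have "card (I \<rightarrow>\<^sub>E {..<L}) \<le> card ?E"
    by (rule card_inj_on_le[OF _ _ finite_expo_deg])
  then show ?thesis by (simp add: card_PiE card_I prod_constant)
qed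

text \<open>Modulo the ideal generated by the \<open>G s\<close> the ring is finite-dimensional near the origin,
  so modulo monomials of degree \<open>k\<close> it is spanned by few products of powers of the \<open>G s\<close>. Comparing
  the growth in \<open>k\<close> bounds the number of the \<open>G s\<close> from below.\<close>

lemma card_equations_isolated_zero:
  assumes x: "x1 \<in> X" "x2 \<in> X" "x1 \<noteq> x2" and y0: "y0 \<in> Y"
    and S: "finite S" and G: "\<And>s. s \<in> S \<Longrightarrow> G s \<in> invariants" "\<And>s. s \<in> S \<Longrightarrow> G s (\<lambda>_. 0) = 0"
    and e: "e \<in> invariants" "e (\<lambda>_. 0) = 1"
    and isolated: "\<And>u. (\<And>s. s \<in> S \<Longrightarrow> G s u = 0) \<Longrightarrow> e u \<noteq> 0 \<Longrightarrow>
      (\<forall>w\<in>W. u w = 0) \<and> (\<forall>x\<in>X. \<forall>y\<in>Y. u x * u y = 0)"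
  shows "card W + card Y < card S"
proof -
  define J where "J = {(\<lambda>x. \<Sum>s\<in>S. c s x * G s x) |c. \<forall>s\<in>S. c s \<in> invariants}"
  have JI: "(\<lambda>x. \<Sum>s\<in>S. c s x * G s x) \<in> J" if "\<And>s. s \<in> S \<Longrightarrow> c s \<in> invariants" for c
    using that by (auto simp: J_def)
  have J: "fun_ideal invariants J"
    unfolding fun_ideal_def
  proof (intro conjI ballI)
    show "J \<subseteq> invariants" by (auto simp: J_def intro!: sum mult G(1))
    show "(\<lambda>x. 0) \<in> J" using JI[of "\<lambda>s x. 0"] const[of 0] by simp
    fix f g assume "g \<in> J"
    then obtain c where c: "g = (\<lambda>x. \<Sum>s\<in>S. c s x * G s x)" "\<And>s. s \<in> S \<Longrightarrow> c s \<in> invariants"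
      by (auto simp: J_def)
    show "(\<lambda>x. f x * g x) \<in> J" if "f \<in> invariants"
      using JI[of "\<lambda>s x. f x * c s x", OF mult[OF that c(2)]]
      by (simp add: c(1) sum_distrib_left mult.assoc)
    show "(\<lambda>x. f x + g x) \<in> J" if "f \<in> J"
    proof -
      from that obtain d where d: "f = (\<lambda>x. \<Sum>s\<in>S. d s x * G s x)" "\<And>s. s \<in> S \<Longrightarrow> d s \<in> invariants"
        by (auto simp: J_def)
      show ?thesis
        using JI[of "\<lambda>s x. d s x + c s x", OF add[OF d(2) c(2)]]
        by (simp add: c(1) d(1) sum.distrib distrib_right)
    qed
  qed
  have G_J: "G s \<in> J" if "s \<in> S" for s
  proof -
    have "(\<lambda>x. if t = s then 1 else 0) \<in> invariants" for t by (rule const)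
    from JI[OF this] have "(\<lambda>x. \<Sum>t\<in>S. (if t = s then 1 else 0) * G t x) \<in> J" .
    also have "(\<lambda>x. \<Sum>t\<in>S. (if t = s then 1 else 0) * G t x) = G s"
      using that S by (simp add: if_distrib[of "\<lambda>z. z * _"] cong: if_cong)
    finally show ?thesis .
  qed
  \<comment> \<open>The factor \<open>e\<close> turns the local hypothesis into one about all common
    zeros of \<open>J\<close>: where \<open>e\<close> vanishes, so does the product.\<close>
  have "\<exists>n. (\<lambda>x. (e x * monomial g x) ^ n) \<in> J" if g: "g \<in> gens" for g
  proof (rule nullstellensatz[OF J])
    show "(\<lambda>x. e x * monomial g x) \<in> invariants" by (intro mult e monomial_ring gens_expo g)
    fix u assume "\<forall>f\<in>J. f u = 0"
    then have zero: "G s u = 0" if "s \<in> S" for s using G_J that by blast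
    have "monomial g u = 0" if "e u \<noteq> 0"
      using g isolated[OF zero that]
      by (cases rule: gens_cases) (auto simp: monomial_single[simplified] monomial_pair[simplified])
    then show "e u * monomial g u = 0" by auto
  qed
  then have "\<forall>g\<in>gens. \<exists>n. (\<lambda>x. (e x * monomial g x) ^ n) \<in> J" by blast
  from bchoice[OF this] obtain n where n: "\<And>g. g \<in> gens \<Longrightarrow> (\<lambda>x. (e x * monomial g x) ^ n g) \<in> J"
    by blast
  define M where "M = sum n gens"
  have M: "(\<lambda>x. (e x * monomial g x) ^ M) \<in> J" if g: "g \<in> gens" for g
  proof -
    have "n g \<le> M" unfolding M_def using g gens_finite by (intro member_le_sum) auto
    have "(\<lambda>x. (e x * monomial g x) ^ (M - n g) * (e x * monomial g x) ^ n g) \<in> J"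
      by (intro fun_ideal_absorb[OF J _ n[OF g]] power mult e monomial_ring gens_expo g)
    with \<open>n g \<le> M\<close> show ?thesis by (simp add: power_add[symmetric])
  qed
  \<comment> \<open>From degree \<open>d\<close> on, every monomial is divisible by the
    \<open>M\<close>-th power of some generator, so \<open>e ^ M\<close> carries it into
    \<open>J\<close>.\<close>
  define d where "d = (card W + card X + card Y) * M + 1"
  have eM_monomial: "(\<lambda>x. e x ^ M * monomial \<alpha> x) \<in> J" if \<alpha>: "\<alpha> \<in> expo" "d \<le> deg \<alpha>" for \<alpha>
  proof -
    from \<alpha>(2) have "(card W + card X + card Y) * M < deg \<alpha>" by (simp add: d_def)
    from split_gen_power_deg[OF \<alpha>(1) this] obtain g \<beta>
      where g: "g \<in> gens" "\<beta> \<in> expo" "\<alpha> = (\<lambda>i. \<beta> i + M * g i)" .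
    have "(\<lambda>x. monomial \<beta> x * (e x * monomial g x) ^ M) \<in> J"
      by (rule fun_ideal_absorb[OF J monomial_ring[OF g(2)] M[OF g(1)]])
    then show ?thesis
      unfolding g(3) by (simp add: monomial_plus monomial_mult power_mult_distrib algebra_simps)
  qed
  have eM: "(\<lambda>x. e x ^ M * f x) \<in> J" if "f \<in> filt d" for f
    using that unfolding filt_def
  proof (induction rule: lin_induct)
    case zero
    then show ?case using J by (simp add: fun_ideal_def)
  next
    case (step c b g)
    then have "(\<lambda>x. e x ^ M * b x) \<in> J" using eM_monomial by auto
    from fun_ideal_add[OF J fun_ideal_absorb[OF J const this] step(3), of c]
    show ?case by (simp add: algebra_simps)
  qed
  have eM1: "(\<lambda>x. 1 - e x ^ M) \<in> filt 1"
    using minus_value_filt[OF diff[OF one power[OF e(1), of M]]] e(2) by simp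
  \<comment> \<open>Modulo \<open>J\<close> the function \<open>f\<close> equals
    \<open>(1 - e ^ M) * f\<close>, which lies one step deeper in the filtration. Iterating this
    replaces inverting \<open>e\<close> near the origin.\<close>
  have J_filt: "\<exists>j\<in>J. (\<lambda>x. f x - j x) \<in> filt k" if "f \<in> filt l" "d \<le> l" for f k l
    using that
  proof (induction "k - l" arbitrary: f l)
    case 0
    then have "f \<in> filt k" using filt_mono[of k l] by auto
    moreover have "(\<lambda>x. 0) \<in> J" using J by (simp add: fun_ideal_def)
    ultimately show ?case by (intro bexI[of _ "\<lambda>x. 0"]) auto
  next
    case (Suc m)
    have "(\<lambda>x. (1 - e x ^ M) * f x) \<in> filt (1 + l)"
      by (rule filt_mult[OF eM1 Suc.prems(1)])
    moreover have "m = k - (1 + l)" "d \<le> 1 + l" using Suc.hyps(2) Suc.prems(2) by simp_all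
    ultimately obtain j where j: "j \<in> J" "(\<lambda>x. (1 - e x ^ M) * f x - j x) \<in> filt k"
      using Suc.hyps(1) by blast
    have "f \<in> filt d" using Suc.prems filt_mono by blast
    from fun_ideal_add[OF J eM[OF this] j(1)] j(2) show ?case
      by (intro bexI[of _ "\<lambda>x. e x ^ M * f x + j x"]) (auto simp: algebra_simps)
  qed
  define low where "low = {\<alpha> \<in> expo. deg \<alpha> < d}"
  have low: "finite low" unfolding low_def by (rule finite_expo_deg)
  define U where "U k = (\<lambda>(\<alpha>, \<beta>) x. monomial \<alpha> x * (\<Prod>s\<in>S. G s x ^ \<beta> s)) ` (low \<times> (S \<rightarrow>\<^sub>E {..<k}))"
    for k
  have U: "finite (U k)" "card (U k) \<le> card low * k ^ card S" for k
  proof -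
    show "finite (U k)" unfolding U_def using low S by (intro finite_imageI finite_cartesian_product finite_PiE) auto
    have "card (U k) \<le> card (low \<times> (S \<rightarrow>\<^sub>E {..<k}))"
      unfolding U_def using low S by (intro card_image_le finite_cartesian_product finite_PiE) auto
    then show "card (U k) \<le> card low * k ^ card S"
      using S by (simp add: card_cartesian_product card_PiE)
  qed
  define V where "V k = lin (U k \<union> monomial ` {\<alpha> \<in> expo. k \<le> deg \<alpha>})" for k
  have filt_V: "filt k \<subseteq> V k" for k
    unfolding filt_def V_def by (intro fun_space.span_mono) auto
  have G1: "G s \<in> filt 1" if "s \<in> S" for s
    using minus_value_filt[OF G(1)[OF that]] G(2)[OF that] by simp
  \<comment> \<open>Each round splits \<open>f\<close> into a part of degree below \<open>d\<close>,
    a part in \<open>J\<close> and a remainder in \<open>filt k\<close>. The part in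
    \<open>J\<close> supplies one more factor \<open>G s\<close>, so the exponent sum rises until it
    reaches \<open>k\<close>.\<close>
  have prod_V: "(\<lambda>x. (\<Prod>s\<in>S. G s x ^ \<beta> s) * f x) \<in> V k" if "f \<in> invariants" for f \<beta> k
    using that
  proof (induction "k - sum \<beta> S" arbitrary: f \<beta>)
    case 0
    from filt_mult[OF filt_prod[of S G, OF G1, where \<beta> = \<beta>] \<open>f \<in> invariants\<close>[folded filt_zero]]
    have "(\<lambda>x. (\<Prod>s\<in>S. G s x ^ \<beta> s) * f x) \<in> filt (sum \<beta> S)" by simp
    with 0 filt_mono[of k "sum \<beta> S"] filt_V[of k] show ?case by auto
  next
    case (Suc m)
    from low_degree_part[OF Suc.prems, of d] obtain w where
      w: "w \<in> lin (monomial ` low)" "(\<lambda>x. f x - w x) \<in> filt d" by (auto simp: low_def)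
    from J_filt[OF w(2) order_refl, of k] obtain j where
      "j \<in> J" and r: "(\<lambda>x. f x - w x - j x) \<in> filt k" by auto
    then obtain c where c: "j = (\<lambda>x. \<Sum>s\<in>S. c s x * G s x)" "\<And>s. s \<in> S \<Longrightarrow> c s \<in> invariants"
      by (auto simp: J_def)
    let ?P = "\<lambda>x. \<Prod>s\<in>S. G s x ^ \<beta> s"
    have 1: "(\<lambda>x. ?P x * w x) \<in> V k"
      using w(1)
    proof (induction rule: lin_induct)
      case zero
      then show ?case by (simp add: V_def lin_zero)
    next
      case (step a b g)
      then obtain \<alpha> where \<alpha>: "\<alpha> \<in> low" "b = monomial \<alpha>" by blast
      have "\<beta> s < k" if "s \<in> S" for s
        using member_le_sum[of s S \<beta>] that S Suc.hyps(2) by simp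
      then have "(\<alpha>, restrict \<beta> S) \<in> low \<times> (S \<rightarrow>\<^sub>E {..<k})" using \<alpha> by auto
      then have "(\<lambda>x. monomial \<alpha> x * (\<Prod>s\<in>S. G s x ^ restrict \<beta> S s)) \<in> U k"
        unfolding U_def by (intro image_eqI[of _ _ "(\<alpha>, restrict \<beta> S)"]) simp_all
      moreover have "(\<Prod>s\<in>S. G s x ^ restrict \<beta> S s) = ?P x" for x
        by (intro prod.cong) auto
      ultimately have "(\<lambda>x. ?P x * b x) \<in> V k"
        unfolding V_def \<alpha>(2) by (intro fun_space.span_base) (simp add: mult.commute)
      from lin_add[OF lin_scale[OF this[unfolded V_def]] step(3)[unfolded V_def], of a]
      show ?case by (simp add: V_def algebra_simps)
    qed
    have 2: "(\<lambda>x. \<Sum>s\<in>S. ?P x * G s x * c s x) \<in> V k"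
      unfolding V_def
    proof (rule lin_sum)
      fix s assume s: "s \<in> S"
      have "?P x * G s x = (\<Prod>t\<in>S. G t x ^ (\<beta>(s := Suc (\<beta> s))) t)" for x
      proof -
        have "(\<Prod>t\<in>S - {s}. G t x ^ (\<beta>(s := Suc (\<beta> s))) t) = (\<Prod>t\<in>S - {s}. G t x ^ \<beta> t)"
          by (intro prod.cong) auto
        then show ?thesis using s S by (simp add: prod.remove[of S s])
      qed
      moreover have "sum (\<beta>(s := Suc (\<beta> s))) S = Suc (sum \<beta> S)"
      proof -
        have "sum (\<beta>(s := Suc (\<beta> s))) (S - {s}) = sum \<beta> (S - {s})"
          by (intro sum.cong) auto
        then show ?thesis using s S by (simp add: sum.remove[of S s])
      qed
      then have "m = k - sum (\<beta>(s := Suc (\<beta> s))) S" using Suc.hyps(2) by simp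
      from Suc.hyps(1)[OF this c(2)[OF s]]
      have "(\<lambda>x. (\<Prod>t\<in>S. G t x ^ (\<beta>(s := Suc (\<beta> s))) t) * c s x) \<in> V k" .
      ultimately show "(\<lambda>x. ?P x * G s x * c s x) \<in> lin (U k \<union> monomial ` {\<alpha> \<in> expo. k \<le> deg \<alpha>})"
        by (simp add: V_def)
    qed
    have 3: "(\<lambda>x. ?P x * (f x - w x - j x)) \<in> V k"
      using filt_mult[OF filt_prod[of S G, OF G1, where \<beta> = \<beta>] r] filt_mono[of k "sum \<beta> S + k"] filt_V[of k]
      by auto
    have "(\<lambda>x. ?P x * w x + ((\<Sum>s\<in>S. ?P x * G s x * c s x) + ?P x * (f x - w x - j x))) \<in> V k"
      using lin_add[OF 1[unfolded V_def] lin_add[OF 2[unfolded V_def] 3[unfolded V_def]]]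
      by (simp add: V_def)
    also have "(\<lambda>x. ?P x * w x + ((\<Sum>s\<in>S. ?P x * G s x * c s x) + ?P x * (f x - w x - j x)))
        = (\<lambda>x. ?P x * f x)"
      by (simp add: c(1) sum_distrib_left algebra_simps)
    finally show ?case .
  qed
  \<comment> \<open>Modulo \<open>filt k\<close> the monomials of degree below \<open>k\<close>
    remain independent, whereas \<open>U k\<close> spans all invariants.\<close>
  have card_le: "card {\<alpha> \<in> expo. deg \<alpha> < k} \<le> card low * k ^ card S" for k
  proof (rule ccontr)
    assume "\<not> ?thesis"
    with U(2)[of k] have gt: "card (U k) < card {\<alpha> \<in> expo. deg \<alpha> < k}" (is "_ < card ?A") by simp
    have "\<exists>a. a \<in> lin (U k) \<and> (\<lambda>x. monomial \<alpha> x - a x) \<in> filt k" if "\<alpha> \<in> ?A" for \<alpha>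
    proof -
      have "monomial \<alpha> \<in> V k"
        using prod_V[OF monomial_ring, of \<alpha> "\<lambda>_. 0" k] that by simp
      then obtain a r where ar: "monomial \<alpha> = a + r" "a \<in> lin (U k)" "r \<in> filt k"
        unfolding V_def fun_space.span_Un filt_def by auto
      then have "r = (\<lambda>x. monomial \<alpha> x - a x)" by auto
      with ar show ?thesis by blast
    qed
    then have "\<forall>\<alpha>\<in>?A. \<exists>a. a \<in> lin (U k) \<and> (\<lambda>x. monomial \<alpha> x - a x) \<in> filt k" by blast
    from bchoice[OF this] obtain a where
      a: "\<And>\<alpha>. \<alpha> \<in> ?A \<Longrightarrow> a \<alpha> \<in> lin (U k)" "\<And>\<alpha>. \<alpha> \<in> ?A \<Longrightarrow> (\<lambda>x. monomial \<alpha> x - a \<alpha> x) \<in> filt k"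
      by blast
    have finA: "finite ?A" by (rule finite_expo_deg)
    obtain c where c: "\<exists>\<alpha>\<in>?A. c \<alpha> \<noteq> 0" "\<And>x. (\<Sum>\<alpha>\<in>?A. c \<alpha> * a \<alpha> x) = 0"
      by (rule lin_dependent[OF U(1) finA gt a(1)]) blast+
    have "(\<lambda>x. \<Sum>\<alpha>\<in>?A. c \<alpha> * (monomial \<alpha> x - a \<alpha> x)) \<in> filt k"
      unfolding filt_def by (intro lin_sum lin_scale a(2)[unfolded filt_def])
    then have "(\<lambda>x. \<Sum>\<alpha>\<in>?A. c \<alpha> * monomial \<alpha> x) \<in> filt k"
      using c(2) by (simp add: right_diff_distrib sum_subtractf)
    then obtain F b where F: "finite F" "F \<subseteq> {\<alpha> \<in> expo. k \<le> deg \<alpha>}"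
      "(\<lambda>x. \<Sum>\<alpha>\<in>?A. c \<alpha> * monomial \<alpha> x) = (\<lambda>x. \<Sum>\<alpha>\<in>F. b \<alpha> * monomial \<alpha> x)"
      unfolding filt_def by (rule lin_image_explicit)
    have disj: "?A \<inter> F = {}" using F(2) by auto
    define h where "h \<alpha> = (if \<alpha> \<in> ?A then c \<alpha> else - b \<alpha>)" for \<alpha>
    have "(\<Sum>\<alpha>\<in>?A \<union> F. h \<alpha> * monomial \<alpha> u) = 0" for u
    proof -
      have "(\<Sum>\<alpha>\<in>?A. h \<alpha> * monomial \<alpha> u) = (\<Sum>\<alpha>\<in>?A. c \<alpha> * monomial \<alpha> u)"
        by (intro sum.cong) (auto simp: h_def)
      moreover have "(\<Sum>\<alpha>\<in>F. h \<alpha> * monomial \<alpha> u) = (\<Sum>\<alpha>\<in>F. - (b \<alpha> * monomial \<alpha> u))"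
        using F(2) by (intro sum.cong) (auto simp: h_def)
      ultimately show ?thesis
        unfolding sum.union_disjoint[OF finA F(1) disj]
        using fun_cong[OF F(3), of u] by (simp add: sum_negf)
    qed
    then have "h \<alpha> = 0" if "\<alpha> \<in> ?A" for \<alpha>
      using monomial_independent[of "?A \<union> F" h \<alpha>] finA F(1) that by blast
    with c(1) show False by (auto simp: h_def)
  qed
  show ?thesis
  proof (rule ccontr)
    \<comment> \<open>Growth of order \<open>D + 1\<close> is played against growth of order at most
      \<open>D\<close>. Since \<open>k \<le> (D + 2) * L\<close>, the estimate becomes
      \<open>L * L ^ D \<le> K * L ^ D\<close>, and \<open>L\<close> is chosen just above
      \<open>K\<close>.\<close>
    define D where "D = card W + card Y"
    define K where "K = card low * (D + 2) ^ D"
    define L where "L = K + 1"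
    define k where "k = (D + 1) * L + 1"
    assume "\<not> ?thesis"
    then have "card S \<le> D" by (simp add: D_def)
    have "L ^ (D + 1) \<le> card {\<alpha> \<in> expo. deg \<alpha> < k}"
      using card_box_le_expo[OF x y0, of L] by (simp add: D_def k_def)
    also have "\<dots> \<le> card low * k ^ card S" by (rule card_le)
    also have "k ^ card S \<le> k ^ D" using \<open>card S \<le> D\<close> by (intro power_increasing) (auto simp: k_def)
    also have "k ^ D \<le> ((D + 2) * L) ^ D" by (intro power_mono) (auto simp: k_def L_def algebra_simps)
    also have "card low * ((D + 2) * L) ^ D = K * L ^ D" by (simp only: K_def power_mult_distrib mult.assoc)
    finally have "L * L ^ D \<le> K * L ^ D" by simp
    then have "L \<le> K" by (simp add: L_def)
    then show False by (simp add: L_def)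
  qed
qed

end

section \<open>Prime chains and algebraic independence\<close>

lemma fun_prime_power:
  assumes P: "fun_prime R P" and R: "\<And>n. (\<lambda>x. f x ^ n) \<in> R" "h \<in> R"
    and "f \<notin> P" "(\<lambda>x. f x ^ n * h x) \<in> P"
  shows "h \<in> P"
proof -
  have "(\<lambda>x. f x ^ n) \<notin> P" for n
  proof (induction n)
    case 0
    then show ?case using P by (simp add: fun_prime_def)
  next
    case (Suc n)
    show ?case
    proof
      assume "(\<lambda>x. f x ^ Suc n) \<in> P"
      then have "(\<lambda>x. f x * f x ^ n) \<in> P" by simp
      from fun_primeD[OF P this _ R(1) assms(4)] R(1)[of 1] Suc show False by simp
    qed
  qed
  from fun_primeD[OF P assms(5) R this] show ?thesis .
qed

context fun_algebra
begin

text \<open>Downward induction on \<open>k\<close>, reading the relation as a polynomial in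
  \<open>f k\<close>. Its lowest remaining coefficient can be freed of the power of
  \<open>f k\<close>, as \<open>f k \<notin> P k\<close>. All other terms still contain
  \<open>f k \<in> P (Suc k)\<close>, so this coefficient is a relation in \<open>P (Suc k)\<close>
  among the later elements. For \<open>k = m\<close> only a constant is left, and a proper ideal
  contains no nonzero one.\<close>

lemma prime_chain_independent:
  assumes P: "\<And>i. i \<le> m \<Longrightarrow> fun_prime R (P i)" "\<And>i. i < m \<Longrightarrow> P i \<subseteq> P (Suc i)"
    and f: "\<And>i. i < m \<Longrightarrow> f i \<in> P (Suc i)" "\<And>i. i < m \<Longrightarrow> f i \<notin> P i"
    and "k \<le> m"
    and "(\<lambda>x. \<Sum>\<alpha>\<in>{k..<m} \<rightarrow>\<^sub>E {..<T}. c \<alpha> * (\<Prod>i=k..<m. f i x ^ \<alpha> i)) \<in> P k"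
    and "\<alpha> \<in> {k..<m} \<rightarrow>\<^sub>E {..<T}"
  shows "c \<alpha> = 0"
  using assms(5-7)
proof (induction k arbitrary: c \<alpha> rule: inc_induct)
  case base
  have "c (\<lambda>_. undefined) = 0"
  proof (rule ccontr)
    assume nz: "c (\<lambda>_. undefined) \<noteq> 0"
    have "(\<lambda>x. c (\<lambda>_. undefined)) \<in> P m" using base(1) by simp
    from fun_ideal_absorb[OF fun_prime_ideal[OF P(1)] const this,
        of "inverse (c (\<lambda>_. undefined))"] nz P(1)[of m]
    show False by (simp add: fun_prime_def)
  qed
  then show ?case using base(2) by simp
next
  case (step k)
  have f_R: "f i \<in> R" if "i < m" for i
    using fun_prime_ideal[OF P(1)[of "Suc i"]] f(1)[OF that] that by (auto simp: fun_ideal_def)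
  let ?B = "{Suc k..<m} \<rightarrow>\<^sub>E {..<T}"
  define g where "g \<beta> x = (\<Prod>i=Suc k..<m. f i x ^ \<beta> i)" for \<beta> :: "nat \<Rightarrow> nat" and x
  define h where "h t x = (\<Sum>\<beta>\<in>?B. c (\<beta>(k := t)) * g \<beta> x)" for t x
  have g_R: "(\<lambda>x. g \<beta> x) \<in> R" for \<beta>
    unfolding g_def by (intro prod power f_R) auto
  have h_R: "(\<lambda>x. h t x) \<in> R" for t
    unfolding h_def by (intro sum mult const g_R)
  have ins: "{k..<m} = insert k {Suc k..<m}" using step.hyps by auto
  have total: "(\<Sum>\<alpha>\<in>{k..<m} \<rightarrow>\<^sub>E {..<T}. c \<alpha> * (\<Prod>i=k..<m. f i x ^ \<alpha> i))
      = (\<Sum>t<T. f k x ^ t * h t x)" for x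
  proof -
    have inj: "inj_on (\<lambda>(t, \<beta>). \<beta>(k := t)) ({..<T} \<times> ?B)"
      using inj_combinator[of k "{Suc k..<m}" "\<lambda>_. {..<T}"] by simp
    have "c (\<beta>(k := t)) * (\<Prod>i=k..<m. f i x ^ (\<beta>(k := t)) i) = f k x ^ t * (c (\<beta>(k := t)) * g \<beta> x)"
      for t \<beta>
    proof -
      have "(\<Prod>i=Suc k..<m. f i x ^ (\<beta>(k := t)) i) = g \<beta> x"
        unfolding g_def by (intro prod.cong) auto
      then show ?thesis unfolding ins by simp
    qed
    note term_eq = this[unfolded ins]
    show ?thesis
      unfolding ins PiE_insert_eq sum.reindex[OF inj] h_def sum_distrib_left o_def
      by (simp only: sum.cartesian_product case_prod_unfold term_eq)
  qed
  have coeff: "c (\<beta>(k := t)) = 0" if "t < T" "\<beta> \<in> ?B" for t \<beta>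
    using that
  proof (induction t arbitrary: \<beta> rule: less_induct)
    case (less t)
    have h0: "h s x = 0" if "s < t" for s x
    proof -
      have "c (\<beta>(k := s)) = 0" if "\<beta> \<in> ?B" for \<beta>
        by (rule less.IH[OF \<open>s < t\<close> _ that]) (use less.prems(1) \<open>s < t\<close> in simp)
      then show ?thesis unfolding h_def by (intro sum.neutral ballI) simp
    qed
    define q where "q x = (\<Sum>s\<in>{Suc t..<T}. f k x ^ (s - Suc t) * h s x)" for x
    have q_R: "(\<lambda>x. q x) \<in> R"
      unfolding q_def using step.hyps by (intro sum mult power f_R h_R) auto
    have "(\<Sum>s<T. f k x ^ s * h s x) = f k x ^ t * (h t x + q x * f k x)" for x
    proof -
      have "(\<Sum>s<T. f k x ^ s * h s x) = (\<Sum>s\<in>{t..<T}. f k x ^ s * h s x)"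
        using h0 by (intro sum.mono_neutral_right) auto
      also have "\<dots> = f k x ^ t * h t x + (\<Sum>s\<in>{Suc t..<T}. f k x ^ s * h s x)"
        using less.prems by (simp add: sum.atLeast_Suc_lessThan)
      also have "(\<Sum>s\<in>{Suc t..<T}. f k x ^ s * h s x) = f k x ^ t * (q x * f k x)"
        unfolding q_def sum_distrib_left sum_distrib_right
      proof (rule sum.cong)
        fix s assume "s \<in> {Suc t..<T}"
        then obtain r where "s = Suc (t + r)" using less_imp_Suc_add[of t s] by auto
        then show "f k x ^ s * h s x = f k x ^ t * (f k x ^ (s - Suc t) * h s x * f k x)"
          by (simp add: power_add)
      qed simp
      finally show ?thesis by (simp add: distrib_left)
    qed
    with step.prems(1) have "(\<lambda>x. f k x ^ t * (h t x + q x * f k x)) \<in> P k"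
      unfolding total by simp
    then have "(\<lambda>x. h t x + q x * f k x) \<in> P k"
      by (rule fun_prime_power[OF P(1) power[OF f_R] add[OF h_R mult[OF q_R f_R]] f(2), rotated -1])
        (use step.hyps in simp_all)
    then have "(\<lambda>x. h t x + q x * f k x) \<in> P (Suc k)"
      using P(2) step.hyps by blast
    moreover have id: "fun_ideal R (P (Suc k))" using P(1) step.hyps by (intro fun_prime_ideal) simp
    have "(\<lambda>x. q x * f k x) \<in> P (Suc k)"
      using step.hyps by (intro fun_ideal_absorb[OF id q_R] f) simp
    ultimately have "(\<lambda>x. h t x) \<in> P (Suc k)"
      using ideal_diff[OF id] by fastforce
    then have "(\<lambda>x. \<Sum>\<beta>\<in>?B. c (\<beta>(k := t)) * (\<Prod>i=Suc k..<m. f i x ^ \<beta> i)) \<in> P (Suc k)"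
      by (simp add: h_def g_def)
    from step.IH[OF this less.prems(2)] show ?case .
  qed
  from step.prems(2) have "\<alpha> \<in> (\<lambda>(t, \<beta>). \<beta>(k := t)) ` ({..<T} \<times> ?B)"
    unfolding ins PiE_insert_eq .
  then show ?case using coeff by auto
qed

end

section \<open>Polynomials with bounded exponents and the length of prime chains\<close>

definition polys :: "'i::finite set \<Rightarrow> nat \<Rightarrow> (('i \<Rightarrow> complex) \<Rightarrow> complex) set" where
  "polys I d = lin (monomial ` {\<alpha>. (\<forall>i. i \<notin> I \<longrightarrow> \<alpha> i = 0) \<and> (\<forall>i. \<alpha> i \<le> d)})"

lemma polys_mono: "d \<le> e \<Longrightarrow> polys I d \<subseteq> polys I e"
  unfolding polys_def by (intro fun_space.span_mono image_mono) (auto intro: order_trans)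

lemma polys_add: "f \<in> polys I d \<Longrightarrow> g \<in> polys I d \<Longrightarrow> (\<lambda>u. f u + g u) \<in> polys I d"
  unfolding polys_def by (rule lin_add)

lemma polys_const: "(\<lambda>u. c) \<in> polys I d"
proof -
  have "monomial (\<lambda>_. 0) \<in> polys I d"
    unfolding polys_def by (intro fun_space.span_base imageI) auto
  from lin_scale[OF this[unfolded polys_def], of c] show ?thesis
    by (simp add: polys_def monomial_zero)
qed

lemma polys_var:
  assumes "i \<in> I"
  shows "(\<lambda>u. u i) \<in> polys I 1"
proof -
  have "monomial (\<lambda>j. if j = i then 1 else 0) \<in> polys I 1"
    unfolding polys_def using assms by (intro fun_space.span_base imageI) auto
  also have "monomial (\<lambda>j. if j = i then 1 else 0) = (\<lambda>u. u i)"
    by (rule ext) (rule monomial_single)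
  finally show ?thesis .
qed

lemma polys_mult:
  assumes "f \<in> polys I d" "g \<in> polys I e"
  shows "(\<lambda>u. f u * g u) \<in> polys I (d + e)"
  unfolding polys_def
proof (rule lin_mult[OF assms[unfolded polys_def]])
  fix a b assume "a \<in> monomial ` {\<alpha>. (\<forall>i. i \<notin> I \<longrightarrow> \<alpha> i = 0) \<and> (\<forall>i. \<alpha> i \<le> d)}"
    "b \<in> monomial ` {\<alpha>. (\<forall>i. i \<notin> I \<longrightarrow> \<alpha> i = 0) \<and> (\<forall>i. \<alpha> i \<le> e)}"
  then obtain \<alpha> \<beta> where *: "a = monomial \<alpha>" "b = monomial \<beta>" "\<forall>i. i \<notin> I \<longrightarrow> \<alpha> i = 0"
    "\<forall>i. \<alpha> i \<le> d" "\<forall>i. i \<notin> I \<longrightarrow> \<beta> i = 0" "\<forall>i. \<beta> i \<le> e" by blast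
  then have "(\<lambda>x. a x * b x) = monomial (\<lambda>i. \<alpha> i + \<beta> i)" by (auto simp: monomial_plus)
  with * show "(\<lambda>x. a x * b x) \<in> lin (monomial ` {\<alpha>. (\<forall>i. i \<notin> I \<longrightarrow> \<alpha> i = 0) \<and> (\<forall>i. \<alpha> i \<le> d + e)})"
    by (auto intro!: fun_space.span_base imageI add_mono)
qed

lemma polys_power: "f \<in> polys I d \<Longrightarrow> (\<lambda>u. f u ^ n) \<in> polys I (n * d)"
  by (induction n) (auto intro: polys_const polys_mult)

lemma polys_prod:
  assumes "\<And>s. s \<in> S \<Longrightarrow> f s \<in> polys I d"
  shows "(\<lambda>u. \<Prod>s\<in>S. f s u) \<in> polys I (card S * d)"
  using assms
  by (induction S rule: infinite_finite_induct) (auto intro: polys_const polys_mult)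

text \<open>Exponents are bounded one by one, so they fill a box; what counts later is the order of
  growth \<open>card I\<close> in \<open>d\<close>.\<close>

lemma polys_span:
  fixes I :: "'i::finite set"
  obtains B where "finite B" "card B \<le> (d + 1) ^ card I" "polys I d = lin B"
proof -
  let ?E = "{\<alpha> :: 'i \<Rightarrow> nat. (\<forall>i. i \<notin> I \<longrightarrow> \<alpha> i = 0) \<and> (\<forall>i. \<alpha> i \<le> d)}"
  have "inj_on (\<lambda>\<alpha>. restrict \<alpha> I) ?E"
  proof (rule inj_onI)
    fix \<alpha> \<beta> assume *: "\<alpha> \<in> ?E" "\<beta> \<in> ?E" "restrict \<alpha> I = restrict \<beta> I"
    show "\<alpha> = \<beta>"
    proof
      fix i
      have "restrict \<alpha> I i = restrict \<beta> I i" using *(3) by simp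
      then show "\<alpha> i = \<beta> i" using *(1,2) by (cases "i \<in> I") auto
    qed
  qed
  moreover have "(\<lambda>\<alpha>. restrict \<alpha> I) ` ?E \<subseteq> I \<rightarrow>\<^sub>E {..d}" by auto
  moreover have fin: "finite (I \<rightarrow>\<^sub>E {..d})" by (rule finite_PiE) auto
  ultimately have "finite ?E" "card ?E \<le> card (I \<rightarrow>\<^sub>E {..d})"
    by (meson inj_on_finite, meson card_inj_on_le)
  then have "finite ?E" "card ?E \<le> (d + 1) ^ card I" by (simp_all add: card_PiE)
  then show thesis
    using that[of "monomial ` ?E"] card_image_le[of ?E monomial] by (auto simp: polys_def)
qed

text \<open>Transcendence degree bounds Krull dimension: elements separating consecutive primes of a chain
  are algebraically independent.\<close>

lemma (in fun_algebra) prime_chain_length_le: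
  fixes \<sigma> :: "('i::finite \<Rightarrow> complex) \<Rightarrow> 'x"
  assumes P: "\<And>i. i \<le> m \<Longrightarrow> fun_prime R (P i)" "\<And>i. i < m \<Longrightarrow> P i \<subset> P (Suc i)"
    and poly: "\<And>f. f \<in> R \<Longrightarrow> \<exists>d. (\<lambda>u. f (\<sigma> u)) \<in> polys I d"
    and dense: "\<And>f. f \<in> R \<Longrightarrow> (\<And>u. f (\<sigma> u) = 0) \<Longrightarrow> (\<And>x. f x = 0)"
  shows "m \<le> card I"
proof (rule ccontr)
  assume "\<not> ?thesis"
  then have m: "card I + 1 \<le> m" by simp
  have "\<forall>i\<in>{..<m}. \<exists>f. f \<in> P (Suc i) \<and> f \<notin> P i" using P(2) by auto
  from bchoice[OF this] obtain f where
    f: "\<And>i. i < m \<Longrightarrow> f i \<in> P (Suc i)" "\<And>i. i < m \<Longrightarrow> f i \<notin> P i" by auto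
  have f_R: "f i \<in> R" if "i < m" for i
    using fun_prime_ideal[OF P(1)[of "Suc i"]] f(1)[OF that] that by (auto simp: fun_ideal_def)
  have "\<forall>i\<in>{..<m}. \<exists>d. (\<lambda>u. f i (\<sigma> u)) \<in> polys I d" using poly f_R by auto
  from bchoice[OF this] obtain d where d: "\<And>i. i < m \<Longrightarrow> (\<lambda>u. f i (\<sigma> u)) \<in> polys I (d i)" by auto
  define \<delta> where "\<delta> = sum d {..<m}"
  have \<delta>: "(\<lambda>u. f i (\<sigma> u)) \<in> polys I \<delta>" if "i < m" for i
  proof -
    have "d i \<le> \<delta>" unfolding \<delta>_def using that by (intro member_le_sum) auto
    with d[OF that] polys_mono show ?thesis by blast
  qed
  \<comment> \<open>There are \<open>T ^ m\<close> products with \<open>m > card I\<close>, in a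
    space of dimension at most \<open>(m * \<delta> + 1) ^ card I * T ^ card I\<close>. Taking
    \<open>T\<close> one above the first factor makes them dependent.\<close>
  define T where "T = (m * \<delta> + 1) ^ card I + 1"
  let ?B = "{0..<m} \<rightarrow>\<^sub>E {..<T}"
  have prod_poly: "(\<lambda>u. \<Prod>i=0..<m. f i (\<sigma> u) ^ \<alpha> i) \<in> polys I (m * (T * \<delta>))" if "\<alpha> \<in> ?B" for \<alpha>
  proof -
    have "(\<lambda>u. f i (\<sigma> u) ^ \<alpha> i) \<in> polys I (T * \<delta>)" if "i \<in> {0..<m}" for i
    proof -
      from that \<open>\<alpha> \<in> ?B\<close> have "\<alpha> i < T" by (auto simp: PiE_def Pi_def)
      then have "\<alpha> i * \<delta> \<le> T * \<delta>" by simp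
      moreover have "(\<lambda>u. f i (\<sigma> u) ^ \<alpha> i) \<in> polys I (\<alpha> i * \<delta>)"
        using that by (intro polys_power \<delta>) simp
      ultimately show ?thesis using polys_mono by blast
    qed
    from polys_prod[of "{0..<m}", OF this] show ?thesis by simp
  qed
  obtain B where B: "finite B" "card B \<le> (m * (T * \<delta>) + 1) ^ card I"
    "polys I (m * (T * \<delta>)) = lin B" by (rule polys_span)
  have "card B \<le> ((m * \<delta> + 1) * T) ^ card I"
    using B(2) by (rule order_trans) (intro power_mono, auto simp: T_def algebra_simps)
  also have "\<dots> = (m * \<delta> + 1) ^ card I * T ^ card I" by (rule power_mult_distrib)
  also have "\<dots> < T * T ^ card I" by (simp add: T_def)
  also have "\<dots> \<le> T ^ m" using power_increasing[OF m, of T] by (simp add: T_def)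
  finally have "card B < card ?B" by (simp add: card_PiE)
  moreover have "finite ?B" by (rule finite_PiE) auto
  ultimately obtain c where c: "\<exists>\<alpha>\<in>?B. c \<alpha> \<noteq> 0"
    "\<And>u. (\<Sum>\<alpha>\<in>?B. c \<alpha> * (\<Prod>i=0..<m. f i (\<sigma> u) ^ \<alpha> i)) = 0"
    using lin_dependent[OF B(1), of ?B "\<lambda>\<alpha> u. \<Prod>i=0..<m. f i (\<sigma> u) ^ \<alpha> i"] prod_poly[unfolded B(3)]
    by blast
  have "(\<lambda>x. \<Sum>\<alpha>\<in>?B. c \<alpha> * (\<Prod>i=0..<m. f i x ^ \<alpha> i)) \<in> R"
    by (intro sum mult const prod power f_R) auto
  from dense[OF this c(2)] have "(\<lambda>x. \<Sum>\<alpha>\<in>?B. c \<alpha> * (\<Prod>i=0..<m. f i x ^ \<alpha> i)) = (\<lambda>x. 0)" by blast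
  also have "\<dots> \<in> P 0" using fun_prime_ideal[OF P(1)[of 0]] by (simp add: fun_ideal_def)
  finally have "c \<alpha> = 0" if "\<alpha> \<in> ?B" for \<alpha>
    using prime_chain_independent[of m P f 0 c T \<alpha>] P f that by blast
  with c(1) show False by blast
qed

lemma polynomial_functions_substitute:
  assumes "f \<in> polynomial_functions" and \<sigma>: "\<And>k i j. \<exists>d. (\<lambda>u. \<sigma> u $ k $ i $ j) \<in> polys I d"
  shows "\<exists>d. (\<lambda>u. f (\<sigma> u)) \<in> polys I d"
  using assms(1)
proof induction
  case (const c)
  show ?case using polys_const by blast
next
  case (coord k i j)
  show ?case by (rule \<sigma>)
next
  case (add f g)
  then obtain d e where "(\<lambda>u. f (\<sigma> u)) \<in> polys I d" "(\<lambda>u. g (\<sigma> u)) \<in> polys I e" by blast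
  then have "(\<lambda>u. f (\<sigma> u)) \<in> polys I (d + e)" "(\<lambda>u. g (\<sigma> u)) \<in> polys I (d + e)"
    using polys_mono[of d "d + e" I] polys_mono[of e "d + e" I] by auto
  then show ?case by (intro exI) (rule polys_add)
next
  case (mult f g)
  then show ?case using polys_mult by blast
qed

section \<open>Covariants of tuples of matrices\<close>

lemma polynomial_functions_uminus:
  "f \<in> polynomial_functions \<Longrightarrow> (\<lambda>v. - f v) \<in> polynomial_functions"
  using polynomial_functions.mult[OF polynomial_functions.const[of "-1"]] by force

lemma polynomial_functions_sum:
  "(\<And>i. i \<in> I \<Longrightarrow> f i \<in> polynomial_functions) \<Longrightarrow> (\<lambda>v. \<Sum>i\<in>I. f i v) \<in> polynomial_functions"
  by (induction I rule: infinite_finite_induct) (auto intro: polynomial_functions.intros)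

lemma polynomial_functions_prod:
  "(\<And>i. i \<in> I \<Longrightarrow> f i \<in> polynomial_functions) \<Longrightarrow> (\<lambda>v. \<Prod>i\<in>I. f i v) \<in> polynomial_functions"
  by (induction I rule: infinite_finite_induct) (auto intro: polynomial_functions.intros)

definition polynomial_map :: "(complex^'p^'p^'n \<Rightarrow> complex^'p^'p) \<Rightarrow> bool" where
  "polynomial_map K \<longleftrightarrow> (\<forall>i j. (\<lambda>v. K v $ i $ j) \<in> polynomial_functions)"

lemma polynomial_map_const: "polynomial_map (\<lambda>v. A)"
  by (simp add: polynomial_map_def polynomial_functions.const)

lemma polynomial_map_coord: "polynomial_map (\<lambda>v. v $ k)"
  by (simp add: polynomial_map_def polynomial_functions.coord)

lemma polynomial_map_diff:
  "polynomial_map K \<Longrightarrow> polynomial_map L \<Longrightarrow> polynomial_map (\<lambda>v. K v - L v)"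
  using polynomial_functions.add[OF _ polynomial_functions_uminus]
  by (fastforce simp: polynomial_map_def)

lemma polynomial_map_mult:
  "polynomial_map K \<Longrightarrow> polynomial_map L \<Longrightarrow> polynomial_map (\<lambda>v. K v ** L v)"
  unfolding polynomial_map_def matrix_matrix_mult_def
  by (auto intro!: polynomial_functions_sum polynomial_functions.mult)

lemma polynomial_functions_det:
  assumes "polynomial_map K"
  shows "(\<lambda>v. det (K v)) \<in> polynomial_functions"
  using assms unfolding polynomial_map_def det_def
  by (intro polynomial_functions_sum polynomial_functions.mult polynomial_functions.const
      polynomial_functions_prod) auto

lemma polynomial_functions_trace:
  "polynomial_map K \<Longrightarrow> (\<lambda>v. trace (K v)) \<in> polynomial_functions"
  by (auto simp: polynomial_map_def trace_def intro: polynomial_functions_sum)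

section \<open>Inverses, determinants and adjugates of complex matrices\<close>

lemma matrix_inv_eqI:
  fixes A B :: "complex^'p^'p"
  assumes "A ** B = mat 1"
  shows "matrix_inv A = B"
proof -
  have BA: "B ** A = mat 1" using assms by (simp add: matrix_left_right_inverse)
  have "A ** matrix_inv A = mat 1 \<and> matrix_inv A ** A = mat 1"
    unfolding matrix_inv_def by (rule someI[of _ B]) (use assms BA in simp)
  then have "B ** (A ** matrix_inv A) = B" by simp
  then show ?thesis by (simp add: matrix_mul_assoc BA)
qed

lemma matrix_inv_mult:
  fixes A :: "complex^'p^'p"
  assumes "det A \<noteq> 0"
  shows "A ** matrix_inv A = mat 1" "matrix_inv A ** A = mat 1"
proof -
  from assms obtain B where B: "A ** B = mat 1"
    using invertible_det_nz[of A] by (auto simp: invertible_def)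
  then show "A ** matrix_inv A = mat 1" using matrix_inv_eqI by blast
  then show "matrix_inv A ** A = mat 1" by (simp add: matrix_left_right_inverse)
qed

lemma det_matrix_inv:
  fixes A :: "complex^'p^'p"
  assumes "det A \<noteq> 0"
  shows "det (matrix_inv A) = 1 / det A"
proof -
  have "det A * det (matrix_inv A) = 1"
    using matrix_inv_mult(1)[OF assms] det_mul[of A "matrix_inv A"] by simp
  with assms show ?thesis by (simp add: field_simps)
qed

lemma matrix_inv_product:
  fixes A B :: "complex^'p^'p"
  assumes "det A \<noteq> 0" "det B \<noteq> 0"
  shows "matrix_inv (A ** B) = matrix_inv B ** matrix_inv A"
proof (rule matrix_inv_eqI)
  have "A ** B ** (matrix_inv B ** matrix_inv A) = A ** (B ** matrix_inv B) ** matrix_inv A"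
    by (simp add: matrix_mul_assoc)
  then show "A ** B ** (matrix_inv B ** matrix_inv A) = mat 1"
    using assms by (simp add: matrix_inv_mult)
qed

lemma matrix_inv_matrix_inv:
  fixes A :: "complex^'p^'p"
  assumes "det A \<noteq> 0"
  shows "matrix_inv (matrix_inv A) = A"
  by (rule matrix_inv_eqI) (rule matrix_inv_mult[OF assms])

text \<open>A polynomial substitute for the inverse. Replacing a column by a unit vector gives
  exactly the determinants that occur in Cramer's rule.\<close>

definition adjugate :: "complex^'p^'p \<Rightarrow> complex^'p^'p" where
  "adjugate A = (\<chi> k i. det (\<chi> a j. if j = k then (if a = i then 1 else 0) else A $ a $ j))"

lemma adjugate_eq:
  assumes "det A \<noteq> 0"
  shows "adjugate A = (\<chi> k i. det A * matrix_inv A $ k $ i)"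
proof -
  have "det (\<chi> a j. if j = k then (if a = i then 1 else 0) else A $ a $ j) = det A * matrix_inv A $ k $ i"
    for k i
  proof -
    have "A *v (\<chi> k. matrix_inv A $ k $ i) = (\<chi> a. (A ** matrix_inv A) $ a $ i)"
      by (simp add: matrix_vector_mult_def matrix_matrix_mult_def vec_eq_iff)
    also have "\<dots> = (\<chi> a. if a = i then 1 else 0)"
      using assms by (simp add: matrix_inv_mult mat_def)
    finally have *: "A *v (\<chi> k. matrix_inv A $ k $ i) = (\<chi> a. if a = i then 1 else 0)" .
    show ?thesis
      using cramer_lemma[of k A "\<chi> k. matrix_inv A $ k $ i"] unfolding * by (simp add: mult.commute cong: if_cong)
  qed
  then show ?thesis by (simp add: adjugate_def)
qed

lemma polynomial_map_adjugate:
  assumes "polynomial_map K"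
  shows "polynomial_map (\<lambda>v. adjugate (K v))"
  unfolding polynomial_map_def adjugate_def
proof (intro allI)
  fix k i
  have "(\<lambda>v. if j = k then (if a = i then 1 else 0) else K v $ a $ j) \<in> polynomial_functions" for a j
    using assms by (cases "j = k"; cases "a = i") (auto simp: polynomial_map_def polynomial_functions.const)
  then have "polynomial_map (\<lambda>v. \<chi> a j. if j = k then (if a = i then 1 else 0) else K v $ a $ j)"
    by (simp add: polynomial_map_def)
  then show "(\<lambda>v. (\<chi> k i. det (\<chi> a j. if j = k then (if a = i then 1 else 0) else K v $ a $ j)) $ k $ i)
      \<in> polynomial_functions"
    by (simp add: polynomial_functions_det)
qed

lemma special_linear_det: "h \<in> special_linear \<Longrightarrow> det h = 1"
  by (simp add: special_linear_def)

lemma left_right_action_nth: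
  "left_right_action h v $ k = fst h ** v $ k ** matrix_inv (snd h)"
  by (simp add: left_right_action_def)

lemma det_left_right_action:
  assumes "h \<in> special_linear \<times> special_linear"
  shows "det (left_right_action h v $ k) = det (v $ k)"
  using assms by (auto simp: left_right_action_nth det_mul det_matrix_inv special_linear_det)

text \<open>The left factor of the group has cancelled and the right one acts by conjugation. The
  class is closed under products and differences and contains the scalars, so noncommutative
  polynomials in covariants are covariant.\<close>

definition covariant :: "'n \<Rightarrow> (complex^'p^'p^'n \<Rightarrow> complex^'p^'p) \<Rightarrow> bool" where
  "covariant k K \<longleftrightarrow> polynomial_map K \<and> (\<forall>h\<in>special_linear \<times> special_linear. \<forall>v. det (v $ k) \<noteq> 0 \<longrightarrow>
     K (left_right_action h v) = snd h ** K v ** matrix_inv (snd h))"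

lemma covariantD:
  "covariant k K \<Longrightarrow> h \<in> special_linear \<times> special_linear \<Longrightarrow> det (v $ k) \<noteq> 0 \<Longrightarrow>
    K (left_right_action h v) = snd h ** K v ** matrix_inv (snd h)"
  unfolding covariant_def by blast

lemma covariant_mult:
  fixes K L :: "complex^'p^'p^'n \<Rightarrow> complex^'p^'p"
  assumes "covariant k K" "covariant k L"
  shows "covariant k (\<lambda>v. K v ** L v)"
  unfolding covariant_def
proof (intro conjI ballI allI impI)
  show "polynomial_map (\<lambda>v. K v ** L v)"
    using assms by (auto simp: covariant_def intro: polynomial_map_mult)
  fix h :: "(complex^'p^'p) \<times> (complex^'p^'p)" and v :: "complex^'p^'p^'n"
  assume h: "h \<in> special_linear \<times> special_linear" and v: "det (v $ k) \<noteq> 0"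
  have d: "det (snd h) \<noteq> 0" using h by (auto simp: special_linear_def)
  have "K (left_right_action h v) ** L (left_right_action h v) =
      (snd h ** K v ** matrix_inv (snd h)) ** (snd h ** L v ** matrix_inv (snd h))"
    by (simp only: covariantD[OF assms(1) h v] covariantD[OF assms(2) h v])
  also have "\<dots> = snd h ** K v ** (matrix_inv (snd h) ** snd h) ** L v ** matrix_inv (snd h)"
    by (simp add: matrix_mul_assoc)
  also have "\<dots> = snd h ** (K v ** L v) ** matrix_inv (snd h)"
    using d by (simp add: matrix_inv_mult matrix_mul_assoc)
  finally show "K (left_right_action h v) ** L (left_right_action h v) =
    snd h ** (K v ** L v) ** matrix_inv (snd h)" .
qed

lemma mat_mult_commute: "mat (c :: complex) ** A = A ** mat c" for A :: "complex^'p^'p"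
  by (simp add: matrix_matrix_mult_def mat_def vec_eq_iff if_distrib[of "\<lambda>x. x * _"]
      if_distrib[of "\<lambda>x. _ * x"] mult.commute cong: if_cong)

lemma covariant_mat: "covariant k (\<lambda>v :: complex^'p^'p^'n. mat c)"
  unfolding covariant_def
proof (intro conjI ballI allI impI polynomial_map_const)
  fix h :: "(complex^'p^'p) \<times> (complex^'p^'p)" assume "h \<in> special_linear \<times> special_linear"
  then have "det (snd h) \<noteq> 0" by (auto simp: special_linear_def)
  moreover have "snd h ** mat c ** matrix_inv (snd h) = mat c ** (snd h ** matrix_inv (snd h))"
    by (simp add: mat_mult_commute[symmetric] matrix_mul_assoc)
  ultimately show "mat c = snd h ** mat c ** matrix_inv (snd h)"
    by (simp add: matrix_inv_mult)
qed

lemma matrix_diff_distrib: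
  fixes A B C :: "complex^'p^'p"
  shows "A ** (B - C) = A ** B - A ** C" "(B - C) ** A = B ** A - C ** A"
  by (simp_all add: matrix_matrix_mult_def vec_eq_iff sum_subtractf algebra_simps)

lemma covariant_diff:
  assumes "covariant k K" "covariant k L"
  shows "covariant k (\<lambda>v. K v - L v)"
  using assms polynomial_map_diff by (auto simp: covariant_def matrix_diff_distrib)

text \<open>The reason is \<open>(P A Q^-1)^-1 (P B Q^-1) = Q (A^-1 B) Q^-1\<close>. Passing from
  the inverse to the adjugate multiplies by \<open>det (v $ k)\<close>, which the action
  preserves.\<close>

lemma covariant_adjugate_mult: "covariant k (\<lambda>v :: complex^'p^'p^'n. adjugate (v $ k) ** v $ l)"
  unfolding covariant_def
proof (intro conjI ballI allI impI)
  show "polynomial_map (\<lambda>v :: complex^'p^'p^'n. adjugate (v $ k) ** v $ l)"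
    by (intro polynomial_map_mult polynomial_map_adjugate polynomial_map_coord)
  fix h :: "(complex^'p^'p) \<times> (complex^'p^'p)" and v :: "complex^'p^'p^'n"
  assume h: "h \<in> special_linear \<times> special_linear" and v: "det (v $ k) \<noteq> 0"
  then have d: "det (fst h) = 1" "det (snd h) = 1" by (auto simp: special_linear_def)
  have scale: "adjugate A = mat (det A) ** matrix_inv A" if "det A \<noteq> 0" for A :: "complex^'p^'p"
    using adjugate_eq[OF that]
    by (simp add: matrix_matrix_mult_def mat_def vec_eq_iff if_distrib[of "\<lambda>x. x * _"] cong: if_cong)
  let ?P = "fst h" and ?Q = "snd h" and ?w = "left_right_action h v"
  have dw: "det (?w $ k) = det (v $ k)" by (rule det_left_right_action[OF h])
  have inv: "matrix_inv (?w $ k) = ?Q ** matrix_inv (v $ k) ** matrix_inv ?P"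
    using d v by (simp add: left_right_action_nth matrix_inv_product det_mul det_matrix_inv
        matrix_inv_matrix_inv matrix_mul_assoc)
  have "adjugate (?w $ k) ** ?w $ l =
      mat (det (v $ k)) ** ?Q ** matrix_inv (v $ k) ** (matrix_inv ?P ** ?P) ** v $ l ** matrix_inv ?Q"
    using v by (simp add: scale dw inv) (simp add: left_right_action_nth matrix_mul_assoc)
  also have "\<dots> = ?Q ** (mat (det (v $ k)) ** matrix_inv (v $ k)) ** v $ l ** matrix_inv ?Q"
    using d by (simp add: matrix_inv_mult matrix_mul_assoc mat_mult_commute[of _ ?Q])
  finally show "adjugate (?w $ k) ** ?w $ l = ?Q ** (adjugate (v $ k) ** v $ l) ** matrix_inv ?Q"
    using v by (simp add: scale matrix_mul_assoc)
qed

lemma carrier_iff: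
  "f \<in> carrier matrix_semi_invariants \<longleftrightarrow> f \<in> polynomial_functions \<and>
    (\<forall>h \<in> special_linear \<times> special_linear. \<forall>v. f (left_right_action h v) = f v)"
  by (simp add: matrix_semi_invariants_def)

lemma det_invariant: "(\<lambda>v. det (v $ k)) \<in> carrier matrix_semi_invariants"
  unfolding carrier_iff
  using det_left_right_action polynomial_functions_det[OF polynomial_map_coord] by blast

text \<open>The covariants transform well only where \<open>v $ k\<close> is invertible; the factor
  \<open>det (v $ k)\<close> makes the traces and determinants invariant everywhere.\<close>

lemma trace_covariant_invariant:
  fixes K :: "complex^'p^'p^'n \<Rightarrow> complex^'p^'p"
  assumes "covariant k K"
  shows "(\<lambda>v. det (v $ k) * trace (K v)) \<in> carrier matrix_semi_invariants"
  unfolding carrier_iff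
proof (intro conjI ballI allI)
  show "(\<lambda>v. det (v $ k) * trace (K v)) \<in> polynomial_functions"
    using assms by (intro polynomial_functions.mult polynomial_functions_det
        polynomial_functions_trace polynomial_map_coord) (simp add: covariant_def)
  fix h :: "(complex^'p^'p) \<times> (complex^'p^'p)" and v :: "complex^'p^'p^'n"
  assume h: "h \<in> special_linear \<times> special_linear"
  have "trace (snd h ** K v ** matrix_inv (snd h)) = trace (K v)"
    using h trace_mul_sym[of "snd h ** K v" "matrix_inv (snd h)"]
    by (auto simp: matrix_mul_assoc matrix_inv_mult special_linear_def)
  then show "det (left_right_action h v $ k) * trace (K (left_right_action h v)) = det (v $ k) * trace (K v)"
    using assms h by (cases "det (v $ k) = 0") (simp_all add: det_left_right_action covariantD)
qed

lemma det_covariant_invariant: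
  fixes K :: "complex^'p^'p^'n \<Rightarrow> complex^'p^'p"
  assumes "covariant k K"
  shows "(\<lambda>v. det (v $ k) * det (K v)) \<in> carrier matrix_semi_invariants"
  unfolding carrier_iff
proof (intro conjI ballI allI)
  show "(\<lambda>v. det (v $ k) * det (K v)) \<in> polynomial_functions"
    using assms by (intro polynomial_functions.mult polynomial_functions_det
        polynomial_map_coord) (simp add: covariant_def)
  fix h :: "(complex^'p^'p) \<times> (complex^'p^'p)" and v :: "complex^'p^'p^'n"
  assume h: "h \<in> special_linear \<times> special_linear"
  have "det (snd h ** K v ** matrix_inv (snd h)) = det (K v)"
    using h by (auto simp: det_mul det_matrix_inv special_linear_def)
  then show "det (left_right_action h v $ k) * det (K (left_right_action h v)) = det (v $ k) * det (K v)"
    using assms h by (cases "det (v $ k) = 0") (simp_all add: det_left_right_action covariantD)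
qed

section \<open>Diagonal matrices, closed walks and the extension from SL to GL\<close>

definition diag_matrix :: "('p \<Rightarrow> complex) \<Rightarrow> complex^'p^'p" where
  "diag_matrix d = (\<chi> a b. if a = b then d a else 0)"

lemma det_diag_matrix: "det (diag_matrix d) = prod d UNIV"
  by (subst det_diagonal) (auto simp: diag_matrix_def)

lemma diag_matrix_mult: "diag_matrix d ** diag_matrix e = diag_matrix (\<lambda>i. d i * e i)"
  by (simp add: matrix_matrix_mult_def diag_matrix_def vec_eq_iff if_distrib[of "\<lambda>x. x * _"] cong: if_cong)

lemma diag_matrix_minus_mat: "diag_matrix d - mat c = diag_matrix (\<lambda>i. d i - c)"
  by (simp add: diag_matrix_def mat_def vec_eq_iff)

lemma mat_eq_diag_matrix: "mat c = diag_matrix (\<lambda>_. c)"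
  by (simp add: diag_matrix_def mat_def)

lemma diag_matrix_mult_left: "(diag_matrix d ** A) $ i $ j = d i * A $ i $ j"
  by (simp add: matrix_matrix_mult_def diag_matrix_def if_distrib[of "\<lambda>x. x * _"] cong: if_cong)

lemma diag_matrix_mult_right: "(A ** diag_matrix d) $ i $ j = A $ i $ j * d j"
  by (simp add: matrix_matrix_mult_def diag_matrix_def if_distrib[of "\<lambda>x. _ * x"] cong: if_cong)

text \<open>Diagonal matrices with a single nonzero entry are multiples of elementary idempotents;
  placed between the factors they select one closed walk \<open>i, j, l, m, i\<close> from the
  trace.\<close>

lemma trace_four_cycle:
  fixes A B C D :: "complex^'p^'p"
  shows "trace (diag_matrix (\<lambda>a. if a = i then p else 0) ** A ** diag_matrix (\<lambda>a. if a = j then q else 0) ** B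
     ** diag_matrix (\<lambda>a. if a = l then r else 0) ** C ** diag_matrix (\<lambda>a. if a = m then s else 0) ** D)
   = p * q * r * s * (A $ i $ j * B $ j $ l * C $ l $ m * D $ m $ i)" (is "trace (?X ** D) = _")
proof -
  have step: "(Y ** M ** diag_matrix (\<lambda>a. if a = l then r else 0)) $ a $ b =
      (if a = i \<and> b = l then x * M $ j $ l * r else 0)"
    if "\<And>a b. Y $ a $ b = (if a = i \<and> b = j then x else 0)"
    for Y M :: "complex^'p^'p" and i j l x r a b
    unfolding diag_matrix_mult_right
    by (simp add: matrix_matrix_mult_def that if_distrib[of "\<lambda>x. x * _"] cong: if_cong)
  have "?X $ a $ b = (if a = i \<and> b = m then p * A $ i $ j * q * B $ j $ l * r * C $ l $ m * s else 0)" for a b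
    by (intro step) (simp add: diag_matrix_def)
  then have "(?X ** D) $ a $ a =
      (if a = i then p * A $ i $ j * q * B $ j $ l * r * C $ l $ m * s * D $ m $ i else 0)" for a
    unfolding matrix_matrix_mult_def[of ?X D]
    by (simp add: if_distrib[of "\<lambda>x. x * _"] cong: if_cong)
  then show ?thesis by (simp add: trace_def)
qed

lemma det_mat: "det (mat c :: complex^'p^'p) = c ^ CARD('p)"
  by (simp add: mat_eq_diag_matrix det_diag_matrix)

lemma complex_root_inverse:
  assumes "c \<noteq> (0::complex)" "n > 0"
  obtains z where "z \<noteq> 0" "z ^ n * c = 1"
proof -
  have "n \<noteq> 0" using assms(2) by simp
  from exists_complex_root[OF this, of "inverse c"] obtain z where "inverse c = z ^ n" .
  then have "z ^ n * c = 1" using assms(1) by (metis left_inverse)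
  with that assms(2) show thesis by (metis mult_zero_left power_0_left less_numeral_extra(3) zero_neq_one)
qed

text \<open>A scalar \<open>\<tau>\<close> on the left and its inverse on the right act trivially,
  and \<open>\<tau> ^ CARD('p) = det Q\<close> brings the right factor to determinant one. Hence
  only the product of the two determinants survives, and it can be put into any single row.\<close>

lemma invariant_two_sided:
  fixes f :: "complex^'p^'p^'n \<Rightarrow> complex"
  assumes f: "f \<in> carrier matrix_semi_invariants" and PQ: "det P \<noteq> 0" "det Q \<noteq> 0"
  shows "f (\<chi> k. P ** v $ k ** Q) =
    f (\<chi> k. diag_matrix (\<lambda>i. if i = r then det P * det Q else 1) ** v $ k)"
proof -
  define \<delta> where "\<delta> = det P * det Q"
  have \<delta>: "\<delta> \<noteq> 0" using PQ by (simp add: \<delta>_def)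
  obtain \<tau> where \<tau>: "\<tau> \<noteq> 0" "\<tau> ^ CARD('p) * (1 / det Q) = 1"
    using complex_root_inverse[of "1 / det Q" "CARD('p)"] PQ by auto
  then have \<tau>Q: "\<tau> ^ CARD('p) = det Q" using PQ by (simp add: field_simps)
  define d where "d = diag_matrix (\<lambda>i. if i = r then \<delta> else 1)"
  define d' where "d' = diag_matrix (\<lambda>i. if i = r then inverse \<delta> else 1)"
  have dd: "d' ** d = mat 1"
    unfolding d_def d'_def diag_matrix_mult mat_eq_diag_matrix
    by (rule arg_cong[of _ _ diag_matrix]) (use \<delta> in auto)
  have det_d': "det d' = inverse \<delta>" by (simp add: d'_def det_diag_matrix)
  define h1 where "h1 = mat \<tau> ** P ** d'"
  define Q' where "Q' = mat (inverse \<tau>) ** Q"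
  have detQ': "det Q' = 1"
    unfolding Q'_def det_mul det_mat using \<tau>(1) PQ by (simp add: \<tau>Q power_inverse)
  have deth1: "det h1 = 1"
    unfolding h1_def det_mul det_mat det_d' \<tau>Q using PQ by (simp add: \<delta>_def field_simps)
  have inv: "matrix_inv (matrix_inv Q') = Q'" using detQ' by (simp add: matrix_inv_matrix_inv)
  have "(h1, matrix_inv Q') \<in> special_linear \<times> special_linear"
    using deth1 detQ' by (simp add: special_linear_def det_matrix_inv)
  then have "f (left_right_action (h1, matrix_inv Q') (\<chi> k. d ** v $ k)) = f (\<chi> k. d ** v $ k)"
    using f unfolding carrier_iff by blast
  also have "left_right_action (h1, matrix_inv Q') (\<chi> k. d ** v $ k) = (\<chi> k. P ** v $ k ** Q)"
  proof -
    have "h1 ** (d ** A) ** Q' = P ** A ** Q" for A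
    proof -
      have "h1 ** (d ** A) ** Q' = mat \<tau> ** P ** (d' ** d) ** A ** (mat (inverse \<tau>) ** Q)"
        by (simp add: h1_def Q'_def matrix_mul_assoc)
      also have "\<dots> = mat \<tau> ** ((P ** A) ** mat (inverse \<tau>)) ** Q"
        unfolding dd by (simp add: matrix_mul_assoc)
      also have "\<dots> = (mat \<tau> ** mat (inverse \<tau>)) ** (P ** A ** Q)"
        unfolding mat_mult_commute[of "inverse \<tau>" "P ** A", symmetric] by (simp add: matrix_mul_assoc)
      also have "mat \<tau> ** mat (inverse \<tau>) = (mat 1 :: complex^'p^'p)"
        using \<tau>(1) by (simp add: mat_eq_diag_matrix diag_matrix_mult)
      finally show ?thesis by simp
    qed
    then show ?thesis by (simp add: left_right_action_def inv)
  qed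
  finally show ?thesis unfolding d_def \<delta>_def .
qed

lemma invariant_diag_conjugation:
  fixes f :: "complex^'p^'p^'n \<Rightarrow> complex"
  assumes f: "f \<in> carrier matrix_semi_invariants" and g: "\<And>i. g i \<noteq> 0"
  shows "f (\<chi> k. diag_matrix g ** v $ k ** diag_matrix (\<lambda>i. inverse (g i))) = f v"
proof -
  have "det (diag_matrix g) \<noteq> 0" "det (diag_matrix (\<lambda>i. inverse (g i))) \<noteq> 0"
    using g by (simp_all add: det_diag_matrix)
  from invariant_two_sided[OF f this, of v r] show ?thesis
    using g by (simp add: det_diag_matrix prod.distrib[symmetric] mat_eq_diag_matrix[symmetric] cong: if_cong)
qed

text \<open>The covariants \<open>X k\<close> take the values \<open>M k\<close> and
  \<open>M' k\<close> at the two points. Polynomials in \<open>X k2\<close>, which is diagonal with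
  distinct entries, give multiples of the elementary idempotents, and traces of words in these read
  off closed walks. Shorter walks are the case where a factor is
  \<open>M k1 = mat 1\<close>.\<close>

lemma invariants_determine_cycles:
  fixes M M' :: "'n::finite \<Rightarrow> complex^'p^'p"
  assumes M: "M k1 = mat 1" "M' k1 = mat 1" "M k2 = diag_matrix D" "M' k2 = diag_matrix d"
    and d: "inj d" and nz: "\<And>i l. i \<noteq> l \<Longrightarrow> D i \<noteq> d l"
    and agree: "\<And>f. f \<in> carrier matrix_semi_invariants \<Longrightarrow> f (\<chi> k. C ** M k) = f (\<chi> k. M' k)"
  shows "det C = 1" "D = d"
    "M a $ i $ j * M b $ j $ l * M c $ l $ m * M e $ m $ i =
     M' a $ i $ j * M' b $ j $ l * M' c $ l $ m * M' e $ m $ i"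
proof -
  let ?v = "(\<chi> k. C ** M k) :: complex^'p^'p^'n" and ?w = "(\<chi> k. M' k) :: complex^'p^'p^'n"
  show C: "det C = 1"
    using agree[OF det_invariant[of k1]] M by (simp add: det_mul)
  define X where "X k v = adjugate (v $ k1) ** v $ k" for k and v :: "complex^'p^'p^'n"
  have X: "covariant k1 (X k)" for k
    unfolding X_def[abs_def] by (rule covariant_adjugate_mult)
  have "adjugate C = matrix_inv C" using adjugate_eq[of C] C by (simp add: vec_eq_iff)
  then have Xv: "X k ?v = M k" for k
    using C M by (simp add: X_def matrix_mul_assoc matrix_inv_mult)
  have "matrix_inv (mat 1 :: complex^'p^'p) = mat 1" by (rule matrix_inv_eqI) simp
  then have "adjugate (mat 1 :: complex^'p^'p) = mat 1"
    using adjugate_eq[of "mat 1 :: complex^'p^'p"] by (simp add: vec_eq_iff)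
  then have Xw: "X k ?w = M' k" for k
    using M by (simp add: X_def)
  have det1: "det (?v $ k1) = 1" "det (?w $ k1) = 1" using C M by simp_all
  \<comment> \<open>Each \<open>d l\<close> is a root of the characteristic polynomial of
    \<open>diag_matrix D\<close>, hence equal to some \<open>D i\<close>; \<open>nz\<close> forces
    \<open>i = l\<close>.\<close>
  have D: "D l = d l" for l
  proof -
    have "covariant k1 (\<lambda>v. X k2 v - mat (d l))"
      by (intro covariant_diff X covariant_mat)
    from agree[OF det_covariant_invariant[OF this]]
    have "(\<Prod>i\<in>UNIV. D i - d l) = (\<Prod>i\<in>UNIV. d i - d l)"
      unfolding det1 Xv Xw M by (simp add: diag_matrix_minus_mat det_diag_matrix)
    also have "\<dots> = 0" by (rule prod_zero) auto
    finally obtain i where "D i = d l" by auto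
    with nz show ?thesis by metis
  qed
  then show "D = d" by auto
  then have M2: "M k2 = diag_matrix d" using M by simp
  \<comment> \<open>For a list of all indices other than \<open>i\<close> this is the numerator of a
    Lagrange interpolation polynomial in \<open>X k2\<close>: a diagonal matrix whose only nonzero
    entry stands at \<open>i\<close>.\<close>
  define E where "E ts v = foldr (\<lambda>t K. (X k2 v - mat (d t)) ** K) ts (mat 1)"
    for ts and v :: "complex^'p^'p^'n"
  have E_cov: "covariant k1 (E ts)" for ts
    unfolding E_def[abs_def]
  proof (induction ts)
    case Nil
    then show ?case by (simp add: covariant_mat)
  next
    case (Cons t ts)
    have "covariant k1 (\<lambda>v. (X k2 v - mat (d t)) ** foldr (\<lambda>t K. (X k2 v - mat (d t)) ** K) ts (mat 1))"
      by (intro covariant_mult covariant_diff X covariant_mat Cons)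
    then show ?case by simp
  qed
  have E_val: "E ts u = diag_matrix (\<lambda>a. prod_list (map (\<lambda>t. d a - d t) ts))"
    if "X k2 u = diag_matrix d" for ts u
    unfolding E_def by (induction ts)
      (simp_all add: that mat_eq_diag_matrix[of 1] diag_matrix_minus_mat diag_matrix_mult)
  have "\<exists>ts. set ts = UNIV - {i}" for i :: 'p by (rule finite_list) simp
  then obtain ts where ts: "\<And>i :: 'p. set (ts i) = UNIV - {i}" by metis
  define \<epsilon> where "\<epsilon> i = prod_list (map (\<lambda>t. d i - d t) (ts i))" for i
  have \<epsilon>: "\<epsilon> i \<noteq> 0" for i
    unfolding \<epsilon>_def prod_list_zero_iff using d ts by (auto simp: inj_eq)
  have "prod_list (map (\<lambda>t. d a - d t) (ts i)) = (if a = i then \<epsilon> i else 0)" for a i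
    using ts by (auto simp: \<epsilon>_def prod_list_zero_iff image_iff)
  then have E: "E (ts i) ?v = diag_matrix (\<lambda>a. if a = i then \<epsilon> i else 0)"
    "E (ts i) ?w = diag_matrix (\<lambda>a. if a = i then \<epsilon> i else 0)" for i
    using E_val[of ?v "ts i"] E_val[of ?w "ts i"] by (simp_all add: Xv Xw M2 M)
  have "covariant k1 (\<lambda>v. E (ts i) v ** X a v ** E (ts j) v ** X b v ** E (ts l) v ** X c v ** E (ts m) v ** X e v)"
    by (intro covariant_mult X E_cov)
  from agree[OF trace_covariant_invariant[OF this]]
  show "M a $ i $ j * M b $ j $ l * M c $ l $ m * M e $ m $ i =
     M' a $ i $ j * M' b $ j $ l * M' c $ l $ m * M' e $ m $ i"
    unfolding det1 Xv Xw E trace_four_cycle using \<epsilon> by simp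
qed

section \<open>Polynomial functions vanishing on an open set, and the two multiplications as
  bilinear maps\<close>

lemma polynomial_function_along_line:
  fixes v w :: "complex^'p^'p^'n"
  assumes "f \<in> polynomial_functions"
  shows "\<exists>q. \<forall>t::real. f (v + t *\<^sub>R w) = poly q (of_real t)"
  using assms
proof induction
  case (const c)
  show ?case by (rule exI[of _ "[:c:]"]) simp
next
  case (coord k i j)
  show ?case by (rule exI[of _ "[:v $ k $ i $ j, w $ k $ i $ j:]"]) (simp add: scaleR_conv_of_real[where 'a = complex])
next
  case (add f g)
  then obtain q r where "\<forall>t::real. f (v + t *\<^sub>R w) = poly q (of_real t)"
    "\<forall>t::real. g (v + t *\<^sub>R w) = poly r (of_real t)" by blast
  then show ?case by (intro exI[of _ "q + r"]) simp
next
  case (mult f g)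
  then obtain q r where "\<forall>t::real. f (v + t *\<^sub>R w) = poly q (of_real t)"
    "\<forall>t::real. g (v + t *\<^sub>R w) = poly r (of_real t)" by blast
  then show ?case by (intro exI[of _ "q * r"]) simp
qed

text \<open>On the real line through \<open>v\<close> and any \<open>x\<close> the function is a
  polynomial in the parameter with infinitely many zeros near \<open>v\<close>, hence zero at
  \<open>x\<close> as well.\<close>

lemma polynomial_function_zero_on_open:
  fixes f :: "complex^'p^'p^'n \<Rightarrow> complex"
  assumes f: "f \<in> polynomial_functions" and T: "v \<in> interior T" and zero: "\<And>x. x \<in> T \<Longrightarrow> f x = 0"
  shows "f x = 0"
proof -
  define w where "w = x - v"
  obtain q where q: "\<And>t::real. f (v + t *\<^sub>R w) = poly q (of_real t)"
    using polynomial_function_along_line[OF f] by blast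
  obtain e where e: "e > 0" "ball v e \<subseteq> T" using T mem_interior by blast
  have "poly q (of_real t) = 0" if "t \<in> {0<..<e / (norm w + 1)}" for t
  proof -
    have "\<bar>t\<bar> * norm w \<le> t * (norm w + 1)" using that by (simp add: algebra_simps)
    also have "\<dots> < e" using that by (simp add: pos_less_divide_eq add_nonneg_pos)
    finally have "v + t *\<^sub>R w \<in> ball v e" by (simp add: dist_norm)
    with e(2) have "f (v + t *\<^sub>R w) = 0" by (intro zero) blast
    then show ?thesis using q by simp
  qed
  then have "of_real ` {0<..<e / (norm w + 1)} \<subseteq> {z. poly q z = 0}" by auto
  moreover have "infinite (of_real ` {0<..<e / (norm w + 1)} :: complex set)"
    using e(1) by (subst finite_image_iff) (auto simp: inj_on_def add_nonneg_pos infinite_Ioo)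
  ultimately have "q = 0" using poly_roots_finite finite_subset by blast
  then show ?thesis using q[of 1] by (simp add: w_def)
qed

lemma bounded_bilinear_left_mult:
  "bounded_bilinear (\<lambda>(P :: complex^'p^'p) (v :: complex^'p^'p^'n). \<chi> k. P ** v $ k)"
  unfolding bilinear_conv_bounded_bilinear[symmetric] bilinear_def
  by (auto intro!: linearI simp: vec_eq_iff matrix_matrix_mult_def algebra_simps
      sum.distrib scaleR_sum_right)

lemma bounded_bilinear_right_mult:
  "bounded_bilinear (\<lambda>(v :: complex^'p^'p^'n) (Q :: complex^'p^'p). \<chi> k. v $ k ** Q)"
  unfolding bilinear_conv_bounded_bilinear[symmetric] bilinear_def
  by (auto intro!: linearI simp: vec_eq_iff matrix_matrix_mult_def algebra_simps
      sum.distrib scaleR_sum_right)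

section \<open>A slice\<close>

text \<open>A normal form for GL x GL: the matrix at \<open>k1\<close> becomes the identity, the one
  at \<open>k2\<close> diagonal, and the remaining torus modulo scalars turns the off-diagonal
  entries of row \<open>r\<close> at \<open>k3\<close> into ones. The entries not normalised are
  collected here.\<close>

definition slice_free :: "'n \<Rightarrow> 'n \<Rightarrow> 'n \<Rightarrow> 'p \<Rightarrow> ('n \<times> 'p \<times> 'p) set" where
  "slice_free k1 k2 k3 r = {(k, i, j). k \<noteq> k1 \<and> (k = k2 \<longrightarrow> i = j) \<and> (k = k3 \<longrightarrow> i = r \<longrightarrow> j = r)}"

text \<open>As only SL x SL acts, the product of the determinants survives as one more coordinate.
  It is stored at \<open>(k1, o', o')\<close>, an index never in \<open>slice_free\<close>, and
  scales row \<open>o'\<close>.\<close>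

definition slice :: "'n \<Rightarrow> 'n \<Rightarrow> 'n \<Rightarrow> 'p \<Rightarrow> 'p \<Rightarrow> ('n \<times> 'p \<times> 'p \<Rightarrow> complex) \<Rightarrow> complex^'p^'p^'n" where
  "slice k1 k2 k3 r o' u = (\<chi> k i j. (if i = o' then u (k1, o', o') else 1) *
     (if (k, i, j) \<in> slice_free k1 k2 k3 r then u (k, i, j)
      else if k = k1 \<and> i = j \<or> k = k3 \<and> i = r \<and> j \<noteq> r then 1 else 0))"

text \<open>Near a point of the slice the group \<open>GL \<times> GL\<close> sweeps the slice across an open set.\<close>

lemma slice_dense:
  fixes f :: "complex^'p^'p^'n \<Rightarrow> complex"
  assumes f: "f \<in> carrier matrix_semi_invariants"
    and k: "k1 \<noteq> k2" "k1 \<noteq> k3" "k2 \<noteq> k3"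
    and d: "inj (d :: 'p \<Rightarrow> complex)"
    and zero: "\<And>u. f (slice k1 k2 k3 r o' u) = 0"
  shows "f v = 0"
proof -
  let ?F = "slice_free k1 k2 k3 r"
  define v0 :: "complex^'p^'p^'n" where "v0 = (\<chi> k i j.
    if (k = k1 \<and> i = j) \<or> (k = k3 \<and> i = r \<and> j \<noteq> r) then 1 else if k = k2 \<and> i = j then d i else 0)"
  define mask :: "complex^'p^'p^'n \<Rightarrow> complex^'p^'p^'n" where
    "mask w = (\<chi> k i j. if (k, i, j) \<in> ?F then w $ k $ i $ j else 0)" for w
  have mask: "bounded_linear mask"
    by (subst linear_conv_bounded_linear[symmetric], rule linearI) (auto simp: mask_def vec_eq_iff)
  define L where "L P v = (\<chi> k. P ** v $ k)" for P :: "complex^'p^'p" and v :: "complex^'p^'p^'n"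
  define R where "R v Q = (\<chi> k. v $ k ** Q)" for Q :: "complex^'p^'p" and v :: "complex^'p^'p^'n"
  have L: "bounded_bilinear L" and R: "bounded_bilinear R"
    unfolding L_def[abs_def] R_def[abs_def]
    by (rule bounded_bilinear_left_mult bounded_bilinear_right_mult)+
  define \<Phi> where "\<Phi> x = R (L (fst x) (v0 + mask (snd (snd x)))) (fst (snd x))"
    for x :: "(complex^'p^'p) \<times> (complex^'p^'p) \<times> (complex^'p^'p^'n)"
  define \<Phi>' where "\<Phi>' h = R v0 (fst (snd h)) + (mask (snd (snd h)) + L (fst h) v0)"
    for h :: "(complex^'p^'p) \<times> (complex^'p^'p) \<times> (complex^'p^'p^'n)"
  let ?x = "(mat 1, mat 1, 0) :: (complex^'p^'p) \<times> (complex^'p^'p) \<times> (complex^'p^'p^'n)"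
  have mask0: "mask 0 = 0" using mask by (rule linear_simps)
  have L1: "L (mat 1) w = w" and R1: "R w (mat 1) = w" for w
    by (simp_all add: L_def R_def)
  have der0: "(\<Phi> has_derivative (\<lambda>h. R (L (fst x) (v0 + mask (snd (snd x)))) (fst (snd h)) +
      R (L (fst x) (mask (snd (snd h))) + L (fst h) (v0 + mask (snd (snd x)))) (fst (snd x)))) (at x)" for x
    unfolding \<Phi>_def[abs_def]
    by (rule bounded_bilinear.FDERIV[OF R] bounded_bilinear.FDERIV[OF L]
        has_derivative_add[OF has_derivative_const, simplified]
        bounded_linear.has_derivative[OF mask] has_derivative_fst has_derivative_snd has_derivative_ident)+
  have der: "(\<Phi> has_derivative \<Phi>') (at ?x)"
    using der0[of ?x] by (simp add: mask0 L1 R1 \<Phi>'_def[abs_def])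
  have cont: "continuous_on UNIV \<Phi>"
    by (rule has_derivative_continuous_on) (rule der0)
  have surj: "surj \<Phi>'"
    unfolding surj_def
  proof
    fix z :: "complex^'p^'p^'n"
    \<comment> \<open>To be solved is \<open>P v0 + v0 Q + w = z\<close> with \<open>w\<close>
      supported on the free entries. The matrix at \<open>k1\<close> gives
      \<open>Q = z $ k1 - P\<close>. Off the diagonal, the one at \<open>k2\<close> then determines
      \<open>(d j - d i) * P $ i $ j\<close>. Row \<open>r\<close> at \<open>k3\<close> determines
      the diagonal of \<open>P\<close>, where \<open>P $ r $ r = 0\<close> uses the freedom of
      scalars.\<close>
    define offdiag where "offdiag i j = (z $ k2 $ i $ j - d i * z $ k1 $ i $ j) / (d j - d i)" for i j
    define P :: "complex^'p^'p" where "P = (\<chi> i j. if i \<noteq> j then offdiag i j else if j = r then 0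
      else (v0 $ k3 ** z $ k1) $ r $ j - (\<Sum>a\<in>UNIV - {r, j}. offdiag a j) - z $ k3 $ r $ j)"
    define Q where "Q = z $ k1 - P"
    define w where "w = z - (\<chi> k. P ** v0 $ k + v0 $ k ** Q)"
    have v01: "v0 $ k1 = mat 1" using k by (auto simp: v0_def mat_def vec_eq_iff)
    have v02: "v0 $ k2 = diag_matrix d" using k by (auto simp: v0_def diag_matrix_def vec_eq_iff)
    have v03: "v0 $ k3 $ i $ j = (if i = r \<and> j \<noteq> r then 1 else 0)" for i j
      using k by (auto simp: v0_def)
    have w1: "w $ k1 $ i $ j = 0" for i j
      by (simp add: w_def v01 Q_def)
    have w2: "w $ k2 $ i $ j = 0" if "i \<noteq> j" for i j
    proof -
      have "d j - d i \<noteq> 0" using d that by (auto simp: inj_eq)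
      moreover have "P $ i $ j = offdiag i j" using that by (simp add: P_def)
      ultimately have "P $ i $ j * (d j - d i) = z $ k2 $ i $ j - d i * z $ k1 $ i $ j"
        by (simp add: offdiag_def)
      then show ?thesis
        by (simp add: w_def v02 diag_matrix_mult_left diag_matrix_mult_right Q_def algebra_simps)
    qed
    have w3: "w $ k3 $ r $ j = 0" if "j \<noteq> r" for j
    proof -
      have PY: "(P ** v0 $ k3) $ r $ j = 0"
        using that by (simp add: matrix_matrix_mult_def v03 P_def if_distrib[of "\<lambda>x. _ * x"] cong: if_cong)
      have "(v0 $ k3 ** P) $ r $ j = (\<Sum>a\<in>UNIV - {r}. P $ a $ j)"
        by (simp add: matrix_matrix_mult_def v03 if_distrib[of "\<lambda>x. x * _"] sum.If_cases
            Compl_eq_Diff_UNIV[symmetric] Collect_neg_eq cong: if_cong)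
      also have "\<dots> = P $ j $ j + (\<Sum>a\<in>UNIV - {r} - {j}. P $ a $ j)"
        using that by (intro sum.remove) auto
      also have "(\<Sum>a\<in>UNIV - {r} - {j}. P $ a $ j) = (\<Sum>a\<in>UNIV - {r, j}. offdiag a j)"
        by (intro sum.cong) (auto simp: P_def)
      finally have "(v0 $ k3 ** P) $ r $ j = (v0 $ k3 ** z $ k1) $ r $ j - z $ k3 $ r $ j"
        using that by (simp add: P_def)
      then show ?thesis by (simp add: w_def Q_def PY matrix_diff_distrib)
    qed
    have "w $ k $ i $ j = 0" if "(k, i, j) \<notin> ?F" for k i j
      using that w1 w2 w3 by (auto simp: slice_free_def)
    then have "mask w = w" by (auto simp: mask_def vec_eq_iff)
    then have "z = \<Phi>' (P, Q, w)"
      by (simp add: \<Phi>'_def L_def R_def w_def vec_eq_iff)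
    then show "\<exists>x. z = \<Phi>' x" by blast
  qed
  have "linear \<Phi>'" using der by (rule has_derivative_linear)
  from linear_surjective_right_inverse[OF this surj] obtain g' where
    g': "linear g'" "\<Phi>' \<circ> g' = id" by blast
  define T :: "((complex^'p^'p) \<times> (complex^'p^'p) \<times> (complex^'p^'p^'n)) set"
    where "T = {x. det (fst x) \<noteq> 0 \<and> det (fst (snd x)) \<noteq> 0}"
  have "continuous_on UNIV (\<lambda>x :: (complex^'p^'p) \<times> (complex^'p^'p) \<times> (complex^'p^'p^'n). det (fst x))"
    "continuous_on UNIV (\<lambda>x :: (complex^'p^'p) \<times> (complex^'p^'p) \<times> (complex^'p^'p^'n). det (fst (snd x)))"
    unfolding det_def by (intro continuous_intros)+
  then have "open T"
    unfolding T_def by (intro open_Collect_conj open_Collect_neq continuous_on_const)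
  moreover have "?x \<in> T" by (simp add: T_def)
  ultimately have "?x \<in> interior T" by (simp add: interior_open)
  from sussmann_open_mapping[OF open_UNIV cont UNIV_I der _ g'(2) subset_UNIV this] g'(1)
  have int: "\<Phi> ?x \<in> interior (\<Phi> ` T)" by (simp add: linear_conv_bounded_linear)
  show ?thesis
  proof (rule polynomial_function_zero_on_open[OF _ int])
    show "f \<in> polynomial_functions" using f by (simp add: carrier_iff)
    fix y assume "y \<in> \<Phi> ` T"
    then obtain P Q w where PQ: "det P \<noteq> 0" "det Q \<noteq> 0" and y: "y = \<Phi> (P, Q, w)"
      by (auto simp: T_def)
    let ?v = "v0 + mask w"
    define u where "u x = (if x = (k1, o', o') then det P * det Q
      else case x of (k, i, j) \<Rightarrow> ?v $ k $ i $ j)" for x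
    have "f y = f (\<chi> k. diag_matrix (\<lambda>i. if i = o' then det P * det Q else 1) ** ?v $ k)"
      unfolding y using invariant_two_sided[OF f PQ, of ?v o'] by (simp add: \<Phi>_def L_def R_def)
    also have "(\<chi> k. diag_matrix (\<lambda>i. if i = o' then det P * det Q else 1) ** ?v $ k) = slice k1 k2 k3 r o' u"
    proof -
      have "?v $ k $ i $ j = (if (k, i, j) \<in> ?F then u (k, i, j)
          else if k = k1 \<and> i = j \<or> k = k3 \<and> i = r \<and> j \<noteq> r then 1 else 0)" for k i j
        using assms(2-4) by (auto simp: u_def mask_def v0_def slice_free_def)
      then show ?thesis
        by (simp add: slice_def vec_eq_iff diag_matrix_mult_left u_def[of "(k1, o', o')"])
    qed
    finally show "f y = 0" using zero by simp
  qed
qed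

section \<open>The two families\<close>

lemma carrier_fun_algebra:
  "fun_algebra (carrier matrix_semi_invariants) (carrier (matrix_semi_invariants :: (complex^'p^'p^'n \<Rightarrow> complex) ring))"
proof
  let ?R = "carrier (matrix_semi_invariants :: (complex^'p^'p^'n \<Rightarrow> complex) ring)"
  have "f \<in> ?R" if "f \<in> lin ?R" for f
    using that
    by (induction rule: lin_induct) (auto simp: carrier_iff
        intro!: polynomial_functions.add polynomial_functions.mult polynomial_functions.const)
  then show "?R = lin ?R" using fun_space.span_superset[of ?R] by blast
  show "(\<lambda>v. 1) \<in> ?R" by (auto simp: carrier_iff intro: polynomial_functions.intros)
  fix f g assume "f \<in> ?R" "g \<in> ?R"
  then show "(\<lambda>v. f v * g v) \<in> ?R"
    by (auto simp: carrier_iff intro: polynomial_functions.intros)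
qed

lemma primeideal_fun_prime:
  assumes "primeideal P matrix_semi_invariants"
  shows "fun_prime (carrier matrix_semi_invariants) P"
proof -
  interpret primeideal P matrix_semi_invariants by fact
  have P: "additive_subgroup P matrix_semi_invariants" by unfold_locales
  have "(\<lambda>v. 1) \<notin> P"
    using one_imp_carrier I_notcarr by (auto simp: matrix_semi_invariants_def)
  moreover have "(\<lambda>v. 0) \<in> P" "\<And>f g. f \<in> P \<Longrightarrow> g \<in> P \<Longrightarrow> (\<lambda>v. f v + g v) \<in> P"
    using additive_subgroup.zero_closed[OF P] additive_subgroup.a_closed[OF P]
    by (auto simp: matrix_semi_invariants_def)
  moreover have "\<And>f g. f \<in> carrier matrix_semi_invariants \<Longrightarrow> g \<in> P \<Longrightarrow> (\<lambda>v. f v * g v) \<in> P"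
    using I_l_closed by (auto simp: matrix_semi_invariants_def)
  moreover have "\<And>f g. f \<in> carrier matrix_semi_invariants \<Longrightarrow> g \<in> carrier matrix_semi_invariants \<Longrightarrow>
      (\<lambda>v. f v * g v) \<in> P \<Longrightarrow> f \<in> P \<or> g \<in> P"
    using I_prime by (auto simp: matrix_semi_invariants_def)
  moreover have "P \<subseteq> carrier matrix_semi_invariants" by (rule a_subset)
  ultimately show ?thesis by (simp add: fun_prime_def fun_ideal_def)
qed

lemma slice_polys:
  "(\<lambda>u. slice k1 k2 k3 r o' u $ k $ i $ j) \<in> polys (insert (k1, o', o') (slice_free k1 k2 k3 r)) 2"
    (is "_ \<in> polys ?I 2")
proof -
  have "(\<lambda>u. if i = o' then u (k1, o', o') else 1) \<in> polys ?I 1"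
    by (cases "i = o'") (auto intro: polys_var[unfolded One_nat_def] polys_const)
  moreover have "(\<lambda>u. if (k, i, j) \<in> slice_free k1 k2 k3 r then u (k, i, j)
      else if k = k1 \<and> i = j \<or> k = k3 \<and> i = r \<and> j \<noteq> r then 1 else 0) \<in> polys ?I 1"
    by (cases "(k, i, j) \<in> slice_free k1 k2 k3 r") (auto intro: polys_var[unfolded One_nat_def] polys_const)
  ultimately show ?thesis
    using polys_mult[of _ ?I 1 _ 1] by (simp add: slice_def numeral_2_eq_2)
qed

lemma krull_dim_le:
  fixes k1 k2 k3 :: "'n::finite" and r o' :: "'p::finite"
  assumes k: "k1 \<noteq> k2" "k1 \<noteq> k3" "k2 \<noteq> k3" and d: "inj (d :: 'p \<Rightarrow> complex)"
  shows "krull_dim (matrix_semi_invariants :: (complex^'p^'p^'n \<Rightarrow> complex) ring) \<le>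
    enat (card (insert (k1, o', o') (slice_free k1 k2 k3 r)))"
  unfolding krull_dim_def
proof (rule Sup_least, clarsimp)
  let ?R = "matrix_semi_invariants :: (complex^'p^'p^'n \<Rightarrow> complex) ring"
  interpret fun_algebra "carrier ?R" "carrier ?R" by (rule carrier_fun_algebra)
  fix m P assume P: "\<forall>i\<le>m. primeideal (P i) ?R" "\<forall>i<m. P i \<subset> P (Suc i)"
  show "m \<le> card (insert (k1, o', o') (slice_free k1 k2 k3 r))"
  proof (rule prime_chain_length_le[of m P "slice k1 k2 k3 r o'"])
    show "fun_prime (carrier ?R) (P i)" if "i \<le> m" for i
      using P that primeideal_fun_prime by blast
    show "P i \<subset> P (Suc i)" if "i < m" for i using P that by blast
    show "\<exists>e. (\<lambda>u. f (slice k1 k2 k3 r o' u)) \<in> polys (insert (k1, o', o') (slice_free k1 k2 k3 r)) e"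
      if "f \<in> carrier ?R" for f
    proof (rule polynomial_functions_substitute)
      show "f \<in> polynomial_functions" using that unfolding carrier_iff by (rule conjunct1)
    qed (rule exI, rule slice_polys)
    show "f v = 0" if "f \<in> carrier ?R" "\<And>u. f (slice k1 k2 k3 r o' u) = 0" for f v
      using slice_dense[OF that(1) k d that(2)] .
  qed
qed

text \<open>A monomial is an eigenvector with eigenvalue 2 to the power
  \<open>sum \<alpha> X - sum \<alpha> Y\<close>. As 2 is not a root of unity, invariance under this
  one torus element already forces the exponents to balance.\<close>

lemma (in torus_exponents) torus_invariant_in_ring:
  assumes f: "f \<in> lin (monomial ` A)" and A: "\<And>\<alpha> i. \<alpha> \<in> A \<Longrightarrow> i \<notin> W \<union> X \<union> Y \<Longrightarrow> \<alpha> i = 0"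
    and inv: "\<And>u. f (\<lambda>i. if i \<in> X then 2 * u i else if i \<in> Y then u i / 2 else u i) = f u"
  shows "f \<in> invariants"
proof -
  from f obtain F c where F: "finite F" "F \<subseteq> A" "f = (\<lambda>u. \<Sum>\<alpha>\<in>F. c \<alpha> * monomial \<alpha> u)"
    by (rule lin_image_explicit)
  define t where "t i = (if i \<in> X then 2 else if i \<in> Y then 1 / 2 else 1 :: complex)" for i
  have t: "(\<lambda>i. if i \<in> X then 2 * u i else if i \<in> Y then u i / 2 else u i) = (\<lambda>i. t i * u i)" for u :: "'i \<Rightarrow> complex"
    by (auto simp: t_def)
  have monomial_t: "monomial \<alpha> (\<lambda>i. t i * u i) = monomial \<alpha> t * monomial \<alpha> u" for \<alpha> u
    by (simp add: monomial_def power_mult_distrib prod.distrib)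
  have wt: "monomial \<alpha> t = 2 ^ sum \<alpha> X / 2 ^ sum \<alpha> Y" for \<alpha>
  proof -
    have "monomial \<alpha> t = (\<Prod>i\<in>X \<union> Y. t i ^ \<alpha> i)"
      unfolding monomial_def by (intro prod.mono_neutral_right) (auto simp: t_def)
    also have "\<dots> = (\<Prod>i\<in>X. t i ^ \<alpha> i) * (\<Prod>i\<in>Y. t i ^ \<alpha> i)"
      using disjoint by (intro prod.union_disjoint) auto
    also have "(\<Prod>i\<in>X. t i ^ \<alpha> i) = 2 ^ sum \<alpha> X"
      unfolding power_sum by (intro prod.cong) (auto simp: t_def)
    also have "(\<Prod>i\<in>Y. t i ^ \<alpha> i) = (1 / 2) ^ sum \<alpha> Y"
      unfolding power_sum using disjoint by (intro prod.cong) (auto simp: t_def)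
    finally show ?thesis by (simp add: power_one_over)
  qed
  have "(\<Sum>\<alpha>\<in>F. c \<alpha> * (monomial \<alpha> t - 1) * monomial \<alpha> u) = 0" for u
    using inv[of u] unfolding t F(3) monomial_t
    by (simp add: algebra_simps sum_subtractf)
  from monomial_independent[OF F(1) this] have *: "c \<alpha> * (monomial \<alpha> t - 1) = 0" if "\<alpha> \<in> F" for \<alpha>
    using that .
  have "c \<alpha> = 0 \<or> \<alpha> \<in> expo" if "\<alpha> \<in> F" for \<alpha>
  proof (cases "c \<alpha> = 0")
    case False
    with *[OF that] have "(2 :: complex) ^ sum \<alpha> X = 2 ^ sum \<alpha> Y" by (simp add: wt)
    then have "of_nat (2 ^ sum \<alpha> X) = (of_nat (2 ^ sum \<alpha> Y) :: complex)" by simp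
    then have "sum \<alpha> X = sum \<alpha> Y" unfolding of_nat_eq_iff by simp
    with that F(2) A show ?thesis by (auto simp: expo_def)
  qed simp
  then have "(\<lambda>u. c \<alpha> * monomial \<alpha> u) \<in> invariants" if "\<alpha> \<in> F" for \<alpha>
    using that const[of 0] mult[OF const monomial_ring] by (cases "c \<alpha> = 0") auto
  then show ?thesis unfolding F(3) by (rule sum)
qed

lemma (in torus_exponents) polys_in_ring: "polys W d \<subseteq> invariants"
  unfolding polys_def invariants_def
proof (intro fun_space.span_mono image_mono subsetI)
  fix \<alpha> assume "\<alpha> \<in> {\<alpha>. (\<forall>i. i \<notin> W \<longrightarrow> \<alpha> i = 0) \<and> (\<forall>i. \<alpha> i \<le> d)}"
  then have "\<alpha> i = 0" if "i \<notin> W" for i using that by blast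
  moreover from this have "sum \<alpha> X = 0" "sum \<alpha> Y = 0" using disjoint by (auto intro!: sum.neutral)
  ultimately show "\<alpha> \<in> expo" by (simp add: expo_def)
qed

section \<open>The two families, their intersection and the count of parameters\<close>

locale separating_families =
  fixes k1 k2 k3 :: "'n::finite" and o' r j1 j2 :: "'p::finite" and d :: "'p \<Rightarrow> complex"
  assumes k: "k1 \<noteq> k2" "k1 \<noteq> k3" "k2 \<noteq> k3"
    and p: "o' \<noteq> r" "o' \<noteq> j1" "o' \<noteq> j2" "r \<noteq> j1" "r \<noteq> j2" "j1 \<noteq> j2"
    and d: "inj d"
begin

text \<open>Parameters of the smooth family; \<open>o'\<close> is the index scaled by the
  stabilising torus. Row \<open>o'\<close> off the diagonal is left out because x is fixed, while
  column \<open>o'\<close>, which carries y, is present. The entry \<open>(k3, r, o')\<close> is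
  free here though the slice normalises it to one: the torus is already used up in making
  \<open>(k3, o', r)\<close> equal to one.\<close>

definition W0 :: "('n \<times> 'p \<times> 'p) set" where
  "W0 = {(k, i, j). (k, i, j) = (k1, o', o') \<or> k \<noteq> k1 \<and> (k = k2 \<longrightarrow> i = j) \<and>
     (k \<noteq> k2 \<longrightarrow> i = o' \<longrightarrow> j = o') \<and> (k = k3 \<longrightarrow> i = r \<longrightarrow> j = o' \<or> j = r)}"

text \<open>The plane for x inside row \<open>o'\<close> at \<open>k3\<close>. It avoids the place
  \<open>(k3, o', r)\<close> of the fixed vector of the other family.\<close>

definition X0 :: "('n \<times> 'p \<times> 'p) set" where
  "X0 = {(k3, o', j1), (k3, o', j2)}"

definition Y0 :: "('n \<times> 'p \<times> 'p) set" where
  "Y0 = {(k, i, j). k \<noteq> k1 \<and> k \<noteq> k2 \<and> i \<noteq> o' \<and> j = o'}"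

text \<open>The semisimple point, with \<open>o'\<close> split off. The ones in row and column
  \<open>r\<close> at \<open>k3\<close> connect all other indices, so the complementary block is
  fixed by scalars only, and each of its entries lies on a closed walk that returns through
  \<open>r\<close> along ones.\<close>

definition base :: "'n \<Rightarrow> complex^'p^'p" where
  "base k = (\<chi> i j. if k = k1 \<and> i = j then 1 else if k = k2 \<and> i = j then d i
     else if k = k3 \<and> i \<noteq> o' \<and> j \<noteq> o' \<and> (i = r \<or> j = r) then 1 else 0)"

text \<open>One parameter function serves both families, \<open>Inl\<close> indices for this one and
  \<open>Inr\<close> indices for \<open>MB\<close>, so that a pair of points is a single
  \<open>u\<close>. The constant one at \<open>(k3, o', r)\<close> is the fixed vector x.\<close>

definition MA :: "('n \<times> 'p \<times> 'p + 'n \<times> 'p \<times> 'p \<Rightarrow> complex) \<Rightarrow> 'n \<Rightarrow> complex^'p^'p" where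
  "MA u k = (\<chi> i j. base k $ i $ j + (if (k, i, j) \<in> W0 \<and> k \<noteq> k1 then u (Inl (k, i, j)) else 0) +
     (if (k, i, j) = (k3, o', r) then 1 else 0))"

definition MB :: "('n \<times> 'p \<times> 'p + 'n \<times> 'p \<times> 'p \<Rightarrow> complex) \<Rightarrow> 'n \<Rightarrow> complex^'p^'p" where
  "MB u k = (\<chi> i j. base k $ i $ j + (if (k, i, j) \<in> X0 \<union> Y0 then u (Inr (k, i, j)) else 0))"

definition ptA :: "('n \<times> 'p \<times> 'p + 'n \<times> 'p \<times> 'p \<Rightarrow> complex) \<Rightarrow> complex^'p^'p^'n" where
  "ptA u = (\<chi> k. diag_matrix (\<lambda>i. if i = o' then 1 + u (Inl (k1, o', o')) else 1) ** MA u k)"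

definition ptB :: "('n \<times> 'p \<times> 'p + 'n \<times> 'p \<times> 'p \<Rightarrow> complex) \<Rightarrow> complex^'p^'p^'n" where
  "ptB u = (\<chi> k. MB u k)"

lemma k1_W0: "(k1, o', o') \<in> W0"
  by (simp add: W0_def)

sublocale torus_exponents "Inl ` W0" "Inr ` X0" "Inr ` Y0"
  by standard (use p in \<open>auto simp: X0_def Y0_def\<close>)

lemma MA_entries:
  "MA u k1 = mat 1" "MA u k2 = diag_matrix (\<lambda>i. d i + u (Inl (k2, i, i)))"
  "k \<noteq> k1 \<Longrightarrow> (k, i, j) \<in> W0 \<Longrightarrow> MA u k $ i $ j = base k $ i $ j + u (Inl (k, i, j))"
  "k \<noteq> k1 \<Longrightarrow> (k, i, j) \<notin> W0 \<Longrightarrow> (k, i, j) \<noteq> (k3, o', r) \<Longrightarrow> MA u k $ i $ j = base k $ i $ j"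
  "MA u k3 $ o' $ r = 1"
  using k p by (auto simp: MA_def base_def W0_def mat_def diag_matrix_def vec_eq_iff)

lemma MB_entries:
  "MB u k1 = mat 1" "MB u k2 = diag_matrix d"
  "(k, i, j) \<in> X0 \<union> Y0 \<Longrightarrow> MB u k $ i $ j = base k $ i $ j + u (Inr (k, i, j))"
  "(k, i, j) \<notin> X0 \<union> Y0 \<Longrightarrow> MB u k $ i $ j = base k $ i $ j"
  using k p by (auto simp: MB_def base_def X0_def Y0_def mat_def diag_matrix_def vec_eq_iff)

lemma base_entries:
  "j \<noteq> o' \<Longrightarrow> base k3 $ r $ j = 1" "j \<noteq> o' \<Longrightarrow> base k3 $ j $ r = 1"
  "k \<noteq> k1 \<Longrightarrow> k \<noteq> k2 \<Longrightarrow> base k $ o' $ j = 0" "k \<noteq> k1 \<Longrightarrow> k \<noteq> k2 \<Longrightarrow> base k $ j $ o' = 0"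
  using k p by (auto simp: base_def)

text \<open>Closed walks are compared. Those inside the block return through \<open>r\<close> along
  ones, so the blocks agree. The walk \<open>i, o', r, i\<close> uses the entry
  \<open>(k3, o', r)\<close>, which is one in the first family and zero in the second, so column
  \<open>o'\<close> of the first family vanishes off the diagonal. With that, the walk
  \<open>i, o', j, r, i\<close> is zero in the first family and equals y times x in the
  second.\<close>

lemma agree_imp_zero:
  assumes agree: "\<And>f. f \<in> carrier matrix_semi_invariants \<Longrightarrow> f (ptA u) = f (ptB u)"
    and nz: "\<And>i l. i \<noteq> l \<Longrightarrow> d i + u (Inl (k2, i, i)) \<noteq> d l"
  shows "\<forall>w\<in>Inl ` W0. u w = 0" "\<forall>x\<in>Inr ` X0. \<forall>y\<in>Inr ` Y0. u x * u y = 0"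
proof -
  note det = invariants_determine_cycles[where ?k1.0 = k1 and ?k2.0 = k2 and M = "MA u" and M' = "MB u" and d = d,
      OF MA_entries(1) MB_entries(1) MA_entries(2) MB_entries(2) d nz agree[unfolded ptA_def ptB_def]]
  have c: "u (Inl (k1, o', o')) = 0"
    using det(1) by (simp add: det_diag_matrix)
  have d0: "u (Inl (k2, i, i)) = 0" for i
    using fun_cong[OF det(2), of i] by simp
  note cyc4 = det(3)
  have one: "MA u k1 $ i $ i = 1" "MB u k1 $ i $ i = 1" for i
    by (simp_all add: MA_entries(1) MB_entries(1) mat_def)
  have cyc3: "MA u a $ i $ j * MA u b $ j $ l * MA u c $ l $ i = MB u a $ i $ j * MB u b $ j $ l * MB u c $ l $ i"
    for a b c i j l
    using cyc4[of a i j b l c i k1] by (simp add: one)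
  have cyc2: "MA u a $ i $ j * MA u b $ j $ i = MB u a $ i $ j * MB u b $ j $ i" for a b i j
    using cyc3[of a i j b i k1] by (simp add: one)
  have cyc1: "MA u a $ i $ i = MB u a $ i $ i" for a i
    using cyc2[of a i i k1] by (simp add: one)
  have B_row: "MB u k3 $ r $ j = 1" "MB u k3 $ j $ r = 1" if "j \<noteq> o'" for j
    using that p k MB_entries(4)[of k3 r j u] MB_entries(4)[of k3 j r u] base_entries
    by (auto simp: X0_def Y0_def)
  have A_rr: "MA u k3 $ r $ r = 1" using cyc1[of k3 r] B_row p by simp
  have A_row: "MA u k3 $ r $ j = 1" if "j \<noteq> o'" for j
  proof (cases "j = r")
    case False
    with that have "(k3, r, j) \<notin> W0" using k p by (auto simp: W0_def)
    then show ?thesis using MA_entries(4)[of k3 r j u] base_entries(1)[OF that] k p by simp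
  qed (simp add: A_rr)
  have A_col: "MA u k3 $ j $ r = 1" if "j \<noteq> o'" for j
    using cyc2[of k3 r j k3] by (simp add: A_row B_row that)
  have block: "MA u k $ i $ j = MB u k $ i $ j" if "i \<noteq> o'" "j \<noteq> o'" for k i j
    using cyc3[of k i j k3 r k3] by (simp add: A_row A_col B_row that)
  have column: "MA u k $ i $ o' = 0" if "i \<noteq> o'" for k i
  proof -
    have "MB u k3 $ o' $ r = 0"
      using MB_entries(4)[of k3 o' r u] base_entries(3)[of k3 r] k p by (auto simp: X0_def Y0_def)
    with cyc3[of k i o' k3 r k3] show ?thesis by (simp add: A_row MA_entries(5) that)
  qed
  show "\<forall>w\<in>Inl ` W0. u w = 0"
  proof
    fix w :: "'n \<times> 'p \<times> 'p + 'n \<times> 'p \<times> 'p" assume "w \<in> Inl ` W0"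
    then obtain k i j where w: "(k, i, j) \<in> W0" "w = Inl (k, i, j)" by auto
    have "u (Inl (k, i, j)) = 0"
    proof (cases "k = k1 \<or> k = k2")
      case True
      with w c d0 k show ?thesis by (auto simp: W0_def)
    next
      case False
      then have A: "MA u k $ i $ j = base k $ i $ j + u (Inl (k, i, j))"
        using w by (intro MA_entries) auto
      consider "i \<noteq> o'" "j \<noteq> o'" | "i \<noteq> o'" "j = o'" | "i = o'" "j = o'"
        using w False by (auto simp: W0_def)
      then show ?thesis
      proof cases
        case 1
        then have "(k, i, j) \<notin> X0 \<union> Y0" by (auto simp: X0_def Y0_def)
        with A block[OF 1] MB_entries(4)[of k i j u] show ?thesis by simp
      next
        case 2
        with A column[of i k] base_entries(4)[of k i] False show ?thesis by simp
      next
        case 3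
        then have "(k, i, j) \<notin> X0 \<union> Y0" using p by (auto simp: X0_def Y0_def)
        with 3 A cyc1[of k o'] MB_entries(4)[of k i j u] show ?thesis by simp
      qed
    qed
    then show "u w = 0" by (simp add: w)
  qed
  show "\<forall>x\<in>Inr ` X0. \<forall>y\<in>Inr ` Y0. u x * u y = 0"
  proof (intro ballI)
    fix x y :: "'n \<times> 'p \<times> 'p + 'n \<times> 'p \<times> 'p" assume "x \<in> Inr ` X0" "y \<in> Inr ` Y0"
    then obtain k i j k' i' j' where x: "(k, i, j) \<in> X0" and y: "(k', i', j') \<in> Y0"
      and xy: "x = Inr (k, i, j)" "y = Inr (k', i', j')" by auto
    then have x': "k = k3" "i = o'" "j \<noteq> o'" using p by (auto simp: X0_def)
    have y': "k' \<noteq> k1" "k' \<noteq> k2" "i' \<noteq> o'" "j' = o'" using y by (auto simp: Y0_def)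
    have "MB u k3 $ o' $ j = u (Inr (k, i, j))"
      using MB_entries(3)[of k i j u] x x' base_entries(3)[of k3 j] k by simp
    moreover have "MB u k' $ i' $ o' = u (Inr (k', i', j'))"
      using MB_entries(3)[of k' i' j' u] y y' base_entries(4)[of k' i'] by simp
    moreover have "MB u k' $ i' $ o' * MB u k3 $ o' $ j = 0"
      using cyc4[of k' i' o' k3 j k3 r k3] by (simp add: column B_row y' x')
    ultimately show "u x * u y = 0" unfolding xy by auto
  qed
qed

text \<open>The point \<open>ptB 0\<close> is the limit of the torus orbit of \<open>ptA 0\<close>.\<close>

lemma agree_at_zero:
  assumes f: "f \<in> carrier matrix_semi_invariants"
  shows "f (ptA (\<lambda>_. 0)) = f (ptB (\<lambda>_. 0))"
proof -
  define w :: "complex^'p^'p^'n" where "w = (\<chi> k i j. if (k, i, j) = (k3, o', r) then 1 else 0)"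
  obtain q where q: "\<And>t::real. f (ptB (\<lambda>_. 0) + t *\<^sub>R w) = poly q (of_real t)"
    using polynomial_function_along_line f unfolding carrier_iff by blast
  have A: "ptA (\<lambda>_. 0) = ptB (\<lambda>_. 0) + w"
    by (simp add: ptA_def ptB_def MA_def MB_def w_def vec_eq_iff diag_matrix_mult_left)
  have "poly q (of_real t) = f (ptA (\<lambda>_. 0))" if "t > 0" for t :: real
  proof -
    define g where "g i = (if i = o' then complex_of_real t else 1)" for i
    have "ptB (\<lambda>_. 0) + t *\<^sub>R w =
        (\<chi> k. diag_matrix g ** ptA (\<lambda>_. 0) $ k ** diag_matrix (\<lambda>i. inverse (g i)))"
      unfolding A vec_eq_iff
    proof (intro allI)
      fix k i j
      show "(ptB (\<lambda>_. 0) + t *\<^sub>R w) $ k $ i $ j = (\<chi> k. diag_matrix g **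
          (ptB (\<lambda>_. 0) + w) $ k ** diag_matrix (\<lambda>i. inverse (g i))) $ k $ i $ j"
        using that k p
        by (auto simp: diag_matrix_mult_left diag_matrix_mult_right g_def w_def ptB_def MB_def base_def
            scaleR_conv_of_real[where 'a = complex])
    qed
    moreover have "g i \<noteq> 0" for i using that by (simp add: g_def)
    ultimately show ?thesis
      using invariant_diag_conjugation[OF f, of g "ptA (\<lambda>_. 0)"] q[of t] by simp
  qed
  then have "of_real ` {0<..<1} \<subseteq> {z. poly (q - [:f (ptA (\<lambda>_. 0)):]) z = 0}" by auto
  moreover have "infinite (of_real ` {0<..<1} :: complex set)"
    by (subst finite_image_iff) (auto simp: inj_on_def infinite_Ioo)
  ultimately have "q - [:f (ptA (\<lambda>_. 0)):] = 0" using poly_roots_finite finite_subset by blast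
  then have "poly q 0 = f (ptA (\<lambda>_. 0))" by simp
  with q[of 0] show ?thesis by simp
qed

lemma ptA_in_ring:
  assumes "f \<in> polynomial_functions"
  shows "(\<lambda>u. f (ptA u)) \<in> invariants"
proof -
  have "\<exists>e. (\<lambda>u. ptA u $ k $ i $ j) \<in> polys (Inl ` W0) e" for k i j
  proof -
    have "(\<lambda>u. if i = o' then 1 + u (Inl (k1, o', o')) else 1) \<in> polys (Inl ` W0) 1"
      by (cases "i = o'") (auto intro!: polys_add polys_var[unfolded One_nat_def] polys_const imageI simp: k1_W0)
    moreover have "(\<lambda>u. MA u k $ i $ j) \<in> polys (Inl ` W0) 1"
      unfolding MA_def by (cases "(k, i, j) \<in> W0 \<and> k \<noteq> k1") (auto intro!: polys_add polys_var[unfolded One_nat_def] polys_const)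
    ultimately show ?thesis
      unfolding ptA_def using polys_mult by (simp add: diag_matrix_mult_left) blast
  qed
  from polynomial_functions_substitute[OF assms this] polys_in_ring show ?thesis by blast
qed

lemma ptB_in_ring:
  assumes f: "f \<in> carrier matrix_semi_invariants"
  shows "(\<lambda>u. f (ptB u)) \<in> invariants"
proof -
  have "\<exists>e. (\<lambda>u. ptB u $ k $ i $ j) \<in> polys (Inr ` (X0 \<union> Y0)) e" for k i j
  proof -
    have "(\<lambda>u. MB u k $ i $ j) \<in> polys (Inr ` (X0 \<union> Y0)) 1"
      unfolding MB_def by (cases "(k, i, j) \<in> X0 \<union> Y0") (auto intro!: polys_add polys_var[unfolded One_nat_def] polys_const)
    then show ?thesis unfolding ptB_def by auto
  qed
  from polynomial_functions_substitute[OF _ this] f obtain e where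
    "(\<lambda>u. f (ptB u)) \<in> polys (Inr ` (X0 \<union> Y0)) e" unfolding carrier_iff by blast
  then show ?thesis
    unfolding polys_def
  proof (rule torus_invariant_in_ring)
    fix u :: "'n \<times> 'p \<times> 'p + 'n \<times> 'p \<times> 'p \<Rightarrow> complex"
    let ?u = "\<lambda>i. if i \<in> Inr ` X0 then 2 * u i else if i \<in> Inr ` Y0 then u i / 2 else u i"
    \<comment> \<open>Conjugation by this diagonal matrix doubles row \<open>o'\<close> and halves
      column \<open>o'\<close> off the diagonal, and it fixes \<open>base\<close>, where both
      vanish.\<close>
    define g where "g i = (if i = o' then 2 else 1 :: complex)" for i
    have "ptB ?u = (\<chi> k. diag_matrix g ** ptB u $ k ** diag_matrix (\<lambda>i. inverse (g i)))"
      unfolding vec_eq_iff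
    proof (intro allI)
      fix k i j
      show "ptB ?u $ k $ i $ j =
          (\<chi> k. diag_matrix g ** ptB u $ k ** diag_matrix (\<lambda>i. inverse (g i))) $ k $ i $ j"
        using k p
        by (auto simp: diag_matrix_mult_left diag_matrix_mult_right g_def ptB_def MB_def base_def
            X0_def Y0_def inj_image_mem_iff)
    qed
    moreover have "g i \<noteq> 0" for i by (simp add: g_def)
    ultimately show "f (ptB ?u) = f (ptB u)"
      using invariant_diag_conjugation[OF f, of g "ptB u"] by simp
  qed auto
qed

text \<open>Transposing \<open>Y0\<close> fills the places of row \<open>o'\<close> that
  \<open>W0\<close> omits. The union contains exactly one index beyond the coordinates of the slice,
  namely \<open>(k3, r, o')\<close>.\<close>

lemma card_index_sets: "card (insert (k1, o', o') (slice_free k1 k2 k3 r)) + 1 = card W0 + card Y0"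
proof -
  define swap where "swap = (\<lambda>(k :: 'n, i :: 'p, j :: 'p). (k, j, i))"
  have "card Y0 = card (swap ` Y0)"
    by (rule card_image[symmetric]) (auto simp: inj_on_def swap_def)
  also have "swap ` Y0 = {(k, i, j). k \<noteq> k1 \<and> k \<noteq> k2 \<and> i = o' \<and> j \<noteq> o'}" (is "_ = ?Z")
    by (auto simp: swap_def Y0_def image_iff)
  also have "card W0 + card ?Z = card (W0 \<union> ?Z)"
    by (rule card_Un_disjoint[symmetric]) (auto simp: W0_def)
  also have "W0 \<union> ?Z = insert (k3, r, o') (insert (k1, o', o') (slice_free k1 k2 k3 r))"
    using k p by (auto simp: W0_def slice_free_def)
  also have "card \<dots> = card (insert (k1, o', o') (slice_free k1 k2 k3 r)) + 1"
    using k p by (subst card_insert_disjoint) (auto simp: slice_free_def)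
  finally show ?thesis ..
qed

lemma card_separating_set:
  assumes S: "separating_set (matrix_semi_invariants :: (complex^'p^'p^'n \<Rightarrow> complex) ring) S" "finite S"
  shows "card W0 + card Y0 < card S"
proof -
  have S_inv: "s \<in> carrier matrix_semi_invariants" if "s \<in> S" for s
    using S(1) that by (auto simp: separating_set_def)
  \<comment> \<open>Where \<open>e\<close> is nonzero, the moved eigenvalue
    \<open>d i + u (Inl (k2, i, i))\<close> stays away from every other \<open>d l\<close>, so a
    permuted spectrum cannot produce further meeting points. The denominators normalise
    \<open>e\<close> to one at the origin.\<close>
  define e where "e u = (\<Prod>(i, l)\<in>{(i, l). i \<noteq> l}. (d i + u (Inl (k2, i, i)) - d l) / (d i - d l))"
    for u :: "'n \<times> 'p \<times> 'p + 'n \<times> 'p \<times> 'p \<Rightarrow> complex"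
  have d_diff: "d i - d l \<noteq> 0" if "i \<noteq> l" for i l using d that by (auto simp: inj_eq)
  have var: "(\<lambda>u. u (Inl (k2, i, i))) \<in> invariants" for i
    using polys_in_ring[of 1] polys_var[of "Inl (k2, i, i)" "Inl ` W0"] k by (auto simp: W0_def)
  have "card (Inl ` W0 :: ('n \<times> 'p \<times> 'p + 'n \<times> 'p \<times> 'p) set) +
      card (Inr ` Y0 :: ('n \<times> 'p \<times> 'p + 'n \<times> 'p \<times> 'p) set) < card S"
  proof (rule card_equations_isolated_zero[where ?x1.0 = "Inr (k3, o', j1)" and ?x2.0 = "Inr (k3, o', j2)"
        and ?y0.0 = "Inr (k3, r, o')" and G = "\<lambda>s u. s (ptA u) - s (ptB u)" and e = e])
    show "(\<lambda>u. s (ptA u) - s (ptB u)) \<in> invariants" if "s \<in> S" for s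
      using S_inv[OF that] by (intro diff ptA_in_ring ptB_in_ring) (auto simp: carrier_iff)
    show "s (ptA (\<lambda>_. 0)) - s (ptB (\<lambda>_. 0)) = 0" if "s \<in> S" for s
      using agree_at_zero[OF S_inv[OF that]] by simp
    have "(\<lambda>u. (d i + u (Inl (k2, i, i)) - d l) * inverse (d i - d l)) \<in> invariants" for i l
      by (intro mult diff add const var)
    then show "e \<in> invariants"
      unfolding e_def[abs_def] case_prod_unfold divide_inverse by (intro prod)
    show "e (\<lambda>_. 0) = 1"
      unfolding e_def by (rule prod.neutral) (use d_diff in auto)
    fix u assume zero: "\<And>s. s \<in> S \<Longrightarrow> s (ptA u) - s (ptB u) = 0" and "e u \<noteq> 0"
    have "\<forall>s\<in>S. s (ptA u) = s (ptB u)" using zero by simp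
    then have agree: "f (ptA u) = f (ptB u)" if "f \<in> carrier matrix_semi_invariants" for f
      using S(1) that unfolding separating_set_def by blast
    have nz: "d i + u (Inl (k2, i, i)) \<noteq> d l" if "i \<noteq> l" for i l
    proof
      assume "d i + u (Inl (k2, i, i)) = d l"
      with that have "e u = 0" unfolding e_def by (intro prod_zero) auto
      with \<open>e u \<noteq> 0\<close> show False by simp
    qed
    show "(\<forall>w\<in>Inl ` W0. u w = 0) \<and> (\<forall>x\<in>Inr ` X0. \<forall>y\<in>Inr ` Y0. u x * u y = 0)"
      using agree_imp_zero[OF agree nz] by blast
  qed (use k p S(2) in \<open>auto simp: X0_def Y0_def\<close>)
  then show ?thesis by (simp add: card_image)
qed

text \<open>The slice has one coordinate less than \<open>card W0 + card Y0\<close>, and a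
  separating set at least one element more. The gap of two excludes the sizes
  \<open>krull_dim\<close> and \<open>krull_dim + 1\<close> together.\<close>

lemma krull_dim_separating_set:
  assumes "separating_set (matrix_semi_invariants :: (complex^'p^'p^'n \<Rightarrow> complex) ring) S" "finite S"
  shows "krull_dim (matrix_semi_invariants :: (complex^'p^'p^'n \<Rightarrow> complex) ring) + 1 < enat (card S)"
proof -
  have "krull_dim (matrix_semi_invariants :: (complex^'p^'p^'n \<Rightarrow> complex) ring) + 1 \<le>
      enat (card (insert (k1, o', o') (slice_free k1 k2 k3 r))) + 1"
    by (intro add_right_mono krull_dim_le[OF k d])
  also have "\<dots> = enat (card W0 + card Y0)"
    by (simp add: card_index_sets[symmetric] one_enat_def del: card_insert_disjoint)
  also have "\<dots> < enat (card S)" using card_separating_set[OF assms] by simp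
  finally show ?thesis .
qed

end

theorem theorem6p1:
  assumes "CARD('n::finite) \<ge> 3" and "CARD('p::finite) \<ge> 4"
  shows "(\<nexists>S. polynomial_separating_set
            (matrix_semi_invariants :: (complex^'p^'p^'n \<Rightarrow> complex) ring) S) \<and>
         (\<nexists>S. hypersurface_separating_set
            (matrix_semi_invariants :: (complex^'p^'p^'n \<Rightarrow> complex) ring) S)"
proof -
  let ?R = "matrix_semi_invariants :: (complex^'p^'p^'n \<Rightarrow> complex) ring"
  obtain T :: "'n set" where "card T = 3" using assms(1) obtain_subset_with_card_n by metis
  then obtain k1 k2 k3 :: 'n where k: "k1 \<noteq> k2" "k1 \<noteq> k3" "k2 \<noteq> k3"
    by (auto simp: card_3_iff)
  obtain T :: "'p set" where "card T = Suc 3"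
    using assms(2) obtain_subset_with_card_n[of 4 "UNIV :: 'p set"] by auto
  then obtain o' :: 'p and T' where "o' \<notin> T'" "card T' = 3"
    unfolding card_Suc_eq by blast
  then obtain r j1 j2 where p: "o' \<noteq> r" "o' \<noteq> j1" "o' \<noteq> j2" "r \<noteq> j1" "r \<noteq> j2" "j1 \<noteq> j2"
    by (auto simp: card_3_iff)
  obtain h :: "'p \<Rightarrow> nat" where "inj h"
    using finite_imp_inj_to_nat_seg[of "UNIV :: 'p set"] by auto
  then have "inj (\<lambda>i. complex_of_nat (h i))" by (simp add: inj_def)
  with k p interpret separating_families k1 k2 k3 o' r j1 j2 "\<lambda>i. complex_of_nat (h i)"
    by unfold_locales
  have bound: "krull_dim ?R + 1 < enat (card S)" if "separating_set ?R S" "finite S" for S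
    using krull_dim_separating_set that .
  have "krull_dim ?R \<le> krull_dim ?R + 1" by simp
  with bound show ?thesis
    unfolding polynomial_separating_set_def hypersurface_separating_set_def by fastforce
qed

end
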